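(* Let $\chi\subset\mathbb{R}^n$ be open and let $h:\mathbb{R}^n\to\mathbb{R}$ satisfy (Z1), (Z2), (Z3) of the context. Put $B(x):=1/h(x)$ for $x\in\chi$. Suppose that $B$ is an almost sure reciprocal control barrier function (AS-RCBF) for the system $$dX_t=\{f(X_t)+g(X_t)(u_o(X_t)+u(t))\}\,dt+\sigma(X_t)\,dW_t,\qquad X_0=x_0\in\chi,$$ i.e. there exist a continuous mapping $\phi:\chi\to\mathbb{R}^m$ and a constant $\gamma>0$ such that $$\mathcal{L}_{f,g,\sigma}(\phi(x),u_o(x),B(x))\le\gamma B(x)\qquad\text{for all }x\in\chi.$$ Then the system with $u=\phi(X_t)$ is forward invariant in probability (FIiP) in $\chi$.
   Context: System data: $f:\mathbb{R}^n\to\mathbb{R}^n$, $g:\mathbb{R}^n\to\mathbb{R}^{n\times m}$, $\sigma:\mathbb{R}^n\to\mathbb{R}^{n\times d}$ are locally Lipschitz, $u_o:\mathbb{R}^n\to\mathbb{R}^m$ is continuous, $W_t$ is a $d$-dimensional standard Wiener process on a filtered probability space, and the stochastic differential is in the Itô sense. For a feedback $u=\phi(x)$, $(X_t)_{t<T}$ denotes the maximal solution of the closed-loop system, $T$ being a stopping time. $\mathbb{P}_{x_0}$ is probability conditioned on $X_0=x_0$. Operators: for a $C^2$ function $y$, let $(L_Fy)(x)=\left(\frac{\partial y}{\partial x}F_1(x),\ldots,\frac{\partial y}{\partial x}F_q(x)\right)$ for $F=(F_1,\ldots,F_q)$, and $$L^D_{f,g}(u,u_o(x),y(x))=(L_fy)(x)+(L_gy)(x)(u+u_o(x)),$$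 $$L^I_\sigma(y(x))=\tfrac12\mathrm{tr}\left[\sigma(x)\sigma(x)^T\,\nabla^2y(x)\right],$$ $$\mathcal{L}_{f,g,\sigma}(u,u_o(x),y(x))=L^D_{f,g}(u,u_o(x),y(x))+L^I_\sigma(y(x)).$$ Conditions on $h$ and $\chi$: (Z1) $h$ is $C^2$ on $\chi$. (Z2) $h$ is proper in $\chi$: for every $L\in(0,\infty)$ the set $\{x\in\chi\mid h(x)\ge L\}$ is compact. (Z3) $\chi=\{x\in\mathbb{R}^n\mid h(x)>0\}$ and $\partial\chi=\{x\in\mathbb{R}^n\mid h(x)=0\}$. FIiP: let $M\subset\mathbb{R}^n$ be open and $\phi:M\to\mathbb{R}^m$ continuous. The system with $u=\phi(x)$ is forward invariant in probability (FIiP) in $M$ if there is a $C^2$ mapping $Y:M\to[0,\infty)$ that is proper (for every $L\in[0,\infty)$ the set $\{x\in M\mid Y(x)\le L\}$ is compact) and, for every $x_0\in M$, a continuous mapping $\psi:[0,\infty)\times(0,1)\to[0,\infty)$ such that $$\mathbb{P}_{x_0}\left(\forall t\in[0,l],\ Y(X_t)\le\psi(l,\epsilon)\right)\ge1-\epsilon$$ for all $l\in[0,\infty)$ and $\epsilon\in(0,1)$. The event includes the requirement that $X_t$ is defined and lies in $M$ for all $t\in[0,l]$. *)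

theory Defs
  imports "HOL-Analysis.Analysis" "HOL-Probability.Probability"
begin

section \<open>Differential operators\<close>

definition locally_lipschitz :: "('a::metric_space \<Rightarrow> 'b::metric_space) \<Rightarrow> bool" where
  "locally_lipschitz f \<longleftrightarrow> (\<forall>x. \<exists>u>0. \<exists>L. L-lipschitz_on (cball x u) f)"

definition partial :: "'n \<Rightarrow> (real^'n \<Rightarrow> real) \<Rightarrow> real^'n \<Rightarrow> real" where
  "partial i y x = frechet_derivative y (at x) (axis i 1)"

definition gradient :: "(real^'n \<Rightarrow> real) \<Rightarrow> real^'n \<Rightarrow> real^'n" where
  "gradient y x = (\<chi> i. partial i y x)"

definition hessian :: "(real^'n \<Rightarrow> real) \<Rightarrow> real^'n \<Rightarrow> real^'n^'n" where
  "hessian y x = (\<chi> i j. partial i (partial j y) x)"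

text \<open>Only used for open \<open>S\<close>.\<close>

definition C2_on :: "(real^'n) set \<Rightarrow> (real^'n \<Rightarrow> real) \<Rightarrow> bool" where
  "C2_on S y \<longleftrightarrow>
     (\<forall>x\<in>S. y differentiable (at x)) \<and>
     (\<forall>i. \<forall>x\<in>S. partial i y differentiable (at x)) \<and>
     (\<forall>i j. continuous_on S (partial i (partial j y)))"

definition lie_vec :: "(real^'n \<Rightarrow> real^'n) \<Rightarrow> (real^'n \<Rightarrow> real) \<Rightarrow> real^'n \<Rightarrow> real" where
  "lie_vec f y x = gradient y x \<bullet> f x"

text \<open>For a matrix field, the row vector of Lie derivatives along its columns.\<close>

definition lie_mat :: "(real^'n \<Rightarrow> real^'q^'n) \<Rightarrow> (real^'n \<Rightarrow> real) \<Rightarrow> real^'n \<Rightarrow> real^'q" where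
  "lie_mat F y x = gradient y x v* F x"

definition LD ::
  "(real^'n \<Rightarrow> real^'n) \<Rightarrow> (real^'n \<Rightarrow> real^'m^'n) \<Rightarrow>
   real^'m \<Rightarrow> (real^'n \<Rightarrow> real^'m) \<Rightarrow> (real^'n \<Rightarrow> real) \<Rightarrow> real^'n \<Rightarrow> real" where
  "LD f g u uo y x = lie_vec f y x + lie_mat g y x \<bullet> (u + uo x)"

definition LI :: "(real^'n \<Rightarrow> real^'d^'n) \<Rightarrow> (real^'n \<Rightarrow> real) \<Rightarrow> real^'n \<Rightarrow> real" where
  "LI \<sigma> y x = 1/2 * trace (\<sigma> x ** transpose (\<sigma> x) ** hessian y x)"

definition generator ::
  "(real^'n \<Rightarrow> real^'n) \<Rightarrow> (real^'n \<Rightarrow> real^'m^'n) \<Rightarrow> (real^'n \<Rightarrow> real^'d^'n) \<Rightarrow>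
   real^'m \<Rightarrow> (real^'n \<Rightarrow> real^'m) \<Rightarrow> (real^'n \<Rightarrow> real) \<Rightarrow> real^'n \<Rightarrow> real" where
  "generator f g \<sigma> u uo y x = LD f g u uo y x + LI \<sigma> y x"

section \<open>Wiener process and Ito integral\<close>

text \<open>
  Time is indexed by \<open>real\<close>; only times \<open>t \<ge> 0\<close> matter. A filtration on \<open>[0,\<infinity>)\<close> is
  extended to negative times by any smaller \<open>\<sigma>\<close>-algebras, for instance by its value at \<open>0\<close>.
  The usual conditions are not required.
\<close>

definition filtered_prob_space :: "'w measure \<Rightarrow> (real \<Rightarrow> 'w measure) \<Rightarrow> bool" where
  "filtered_prob_space M F \<longleftrightarrow>
     prob_space M \<and> filtration (space M) F \<and> (\<forall>t. subalgebra M (F t))"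

text \<open>Standard Wiener process relative to the filtration \<open>F\<close>.\<close>

definition wiener_process ::
  "'w measure \<Rightarrow> (real \<Rightarrow> 'w measure) \<Rightarrow> (real \<Rightarrow> 'w \<Rightarrow> real^'d) \<Rightarrow> bool" where
  "wiener_process M F W \<longleftrightarrow>
     (\<forall>t\<ge>0. W t \<in> borel_measurable (F t)) \<and>
     (AE \<omega> in M. W 0 \<omega> = 0) \<and>
     (AE \<omega> in M. continuous_on {0..} (\<lambda>t. W t \<omega>)) \<and>
     (\<forall>s t. 0 \<le> s \<and> s < t \<longrightarrow>
        prob_space.indep_set M (sets (F s))
          {(\<lambda>\<omega>. W t \<omega> - W s \<omega>) -` A \<inter> space M | A. A \<in> sets borel} \<and>
        prob_space.indep_vars M (\<lambda>_. borel) (\<lambda>i \<omega>. (W t \<omega> - W s \<omega>) $ i) UNIV \<and>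
        (\<forall>i. distributed M lborel (\<lambda>\<omega>. (W t \<omega> - W s \<omega>) $ i) (normal_density 0 (sqrt (t - s)))))"

definition tendsto_in_prob :: "'w measure \<Rightarrow> (nat \<Rightarrow> 'w \<Rightarrow> ennreal) \<Rightarrow> bool" where
  "tendsto_in_prob M Z \<longleftrightarrow>
     (\<forall>e>0. (\<lambda>k. measure M {\<omega>\<in>space M. ennreal e < Z k \<omega>}) \<longlonglongrightarrow> 0)"

text \<open>
  Simple integrands \<open>\<Sum>i<k. 1 (p i, p (i+1)] \<xi> i\<close> with bounded, \<open>F (p i)\<close>-measurable, matrix-valued
  \<open>\<xi> i\<close>, and their integrals over \<open>[0,t]\<close>.
\<close>

definition simple_integrand ::
  "'w measure \<Rightarrow> (real \<Rightarrow> 'w measure) \<Rightarrow> nat \<Rightarrow> (nat \<Rightarrow> real) \<Rightarrow> (nat \<Rightarrow> 'w \<Rightarrow> real^'d^'n) \<Rightarrow> bool" where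
  "simple_integrand M F k p \<xi> \<longleftrightarrow>
     0 \<le> p 0 \<and> (\<forall>i<k. p i \<le> p (Suc i)) \<and>
     (\<forall>i<k. \<xi> i \<in> borel_measurable (F (p i)) \<and> bounded (\<xi> i ` space M))"

definition simple_process ::
  "nat \<Rightarrow> (nat \<Rightarrow> real) \<Rightarrow> (nat \<Rightarrow> 'w \<Rightarrow> real^'d^'n) \<Rightarrow> real \<Rightarrow> 'w \<Rightarrow> real^'d^'n" where
  "simple_process k p \<xi> s \<omega> = (\<Sum>i<k. indicator {p i<..p (Suc i)} s *\<^sub>R \<xi> i \<omega>)"

definition simple_integral ::
  "(real \<Rightarrow> 'w \<Rightarrow> real^'d) \<Rightarrow> nat \<Rightarrow> (nat \<Rightarrow> real) \<Rightarrow> (nat \<Rightarrow> 'w \<Rightarrow> real^'d^'n) \<Rightarrow> real \<Rightarrow> 'w \<Rightarrow> real^'n" where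
  "simple_integral W k p \<xi> t \<omega> =
     (\<Sum>i<k. \<xi> i \<omega> *v (W (min t (p (Suc i))) \<omega> - W (min t (p i)) \<omega>))"

definition progressive_upto ::
  "(real \<Rightarrow> 'w measure) \<Rightarrow> real \<Rightarrow> (real \<Rightarrow> 'w \<Rightarrow> real^'d^'n) \<Rightarrow> bool" where
  "progressive_upto F t H \<longleftrightarrow>
     (\<forall>u\<in>{0..t}. (\<lambda>(s, \<omega>). H s \<omega>) \<in> borel_measurable (restrict_space borel {0..u} \<Otimes>\<^sub>M F u))"

text \<open>
  \<open>J\<close> is a version of the Ito integral of \<open>H\<close> with respect to \<open>W\<close> over \<open>[0,t]\<close>: the integrals of
  simple integrands converge to \<open>J\<close> in probability, while the simple integrands converge to \<open>H\<close> in
  \<open>L\<^sup>2([0,t])\<close> in probability. Almost sure square integrability of \<open>H\<close> on \<open>[0,t]\<close> is implied.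
  Progressive measurability makes all events below measurable.
\<close>

definition has_ito_integral ::
  "'w measure \<Rightarrow> (real \<Rightarrow> 'w measure) \<Rightarrow> (real \<Rightarrow> 'w \<Rightarrow> real^'d) \<Rightarrow>
   (real \<Rightarrow> 'w \<Rightarrow> real^'d^'n) \<Rightarrow> real \<Rightarrow> ('w \<Rightarrow> real^'n) \<Rightarrow> bool" where
  "has_ito_integral M F W H t J \<longleftrightarrow>
     progressive_upto F t H \<and> J \<in> borel_measurable M \<and>
     (\<exists>k p \<xi>.
        (\<forall>r. simple_integrand M F (k r) (p r) (\<xi> r)) \<and>
        tendsto_in_prob M (\<lambda>r \<omega>. \<integral>\<^sup>+ s\<in>{0..t}.
          ennreal ((norm (simple_process (k r) (p r) (\<xi> r) s \<omega> - H s \<omega>))\<^sup>2) \<partial>lborel) \<and>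
        tendsto_in_prob M (\<lambda>r \<omega>.
          ennreal (norm (simple_integral W (k r) (p r) (\<xi> r) t \<omega> - J \<omega>))))"

section \<open>Maximal solutions of the closed-loop system\<close>

definition closed_loop ::
  "(real^'n \<Rightarrow> real^'n) \<Rightarrow> (real^'n \<Rightarrow> real^'m^'n) \<Rightarrow> (real^'n \<Rightarrow> real^'m) \<Rightarrow>
   (real^'n \<Rightarrow> real^'m) \<Rightarrow> real^'n \<Rightarrow> real^'n" where
  "closed_loop f g uo \<phi> x = f x + g x *v (uo x + \<phi> x)"

definition extended_stopping_time :: "(real \<Rightarrow> 'w measure) \<Rightarrow> ('w \<Rightarrow> ereal) \<Rightarrow> bool" where
  "extended_stopping_time F T \<longleftrightarrow> (\<forall>t\<ge>0. Measurable.pred (F t) (\<lambda>\<omega>. T \<omega> \<le> ereal t))"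

text \<open>
  \<open>(X\<^sub>t)\<close> for \<open>t < T\<close> solves \<open>dX = b(X) dt + \<sigma>(X) dW\<close>, \<open>X\<^sub>0 = x0\<close>, in the open set \<open>D\<close>, on which the
  coefficients are defined. Values \<open>X t \<omega>\<close> with \<open>t \<ge> T \<omega>\<close> are meaningless; the integral equation is
  required for the process stopped at any stopping time \<open>\<tau> < T\<close>.
\<close>

definition local_solution ::
  "'w measure \<Rightarrow> (real \<Rightarrow> 'w measure) \<Rightarrow> (real \<Rightarrow> 'w \<Rightarrow> real^'d) \<Rightarrow>
   (real^'n \<Rightarrow> real^'n) \<Rightarrow> (real^'n \<Rightarrow> real^'d^'n) \<Rightarrow> (real^'n) set \<Rightarrow> real^'n \<Rightarrow>
   (real \<Rightarrow> 'w \<Rightarrow> real^'n) \<Rightarrow> ('w \<Rightarrow> ereal) \<Rightarrow> bool" where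
  "local_solution M F W b \<sigma> D x0 X T \<longleftrightarrow>
     extended_stopping_time F T \<and>
     (\<forall>\<omega>\<in>space M. 0 < T \<omega>) \<and>
     (\<forall>t\<ge>0. (\<lambda>\<omega>. if ereal t < T \<omega> then X t \<omega> else 0) \<in> borel_measurable (F t)) \<and>
     (\<forall>\<omega>\<in>space M. continuous_on {t. 0 \<le> t \<and> ereal t < T \<omega>} (\<lambda>t. X t \<omega>)) \<and>
     (\<forall>\<omega>\<in>space M. \<forall>t\<ge>0. ereal t < T \<omega> \<longrightarrow> X t \<omega> \<in> D) \<and>
     (AE \<omega> in M. X 0 \<omega> = x0) \<and>
     (\<forall>\<tau>. stopping_time F \<tau> \<and> (\<forall>\<omega>\<in>space M. 0 \<le> \<tau> \<omega>) \<and> (AE \<omega> in M. ereal (\<tau> \<omega>) < T \<omega>) \<longrightarrow>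
        (\<forall>t\<ge>0. \<exists>J.
           has_ito_integral M F W
             (\<lambda>s \<omega>. if s \<le> \<tau> \<omega> \<and> ereal s < T \<omega> then \<sigma> (X s \<omega>) else 0) t J \<and>
           (AE \<omega> in M. X (min t (\<tau> \<omega>)) \<omega> =
              x0 + (LINT s:{0..min t (\<tau> \<omega>)}|lborel. b (X s \<omega>)) + J \<omega>)))"

text \<open>
  Maximality: if the lifetime is finite, the path leaves every compact subset of \<open>D\<close> before \<open>T\<close>, so
  that it has no continuous extension to \<open>[0,T]\<close> in \<open>D\<close>. Conversely, a solution whose path stays in a
  compact subset of \<open>D\<close> up to a finite \<open>T\<close> has a limit in \<open>D\<close> at \<open>T\<close> almost surely and is not
  maximal.
\<close>

definition maximal_solution ::
  "'w measure \<Rightarrow> (real \<Rightarrow> 'w measure) \<Rightarrow> (real \<Rightarrow> 'w \<Rightarrow> real^'d) \<Rightarrow>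
   (real^'n \<Rightarrow> real^'n) \<Rightarrow> (real^'n \<Rightarrow> real^'d^'n) \<Rightarrow> (real^'n) set \<Rightarrow> real^'n \<Rightarrow>
   (real \<Rightarrow> 'w \<Rightarrow> real^'n) \<Rightarrow> ('w \<Rightarrow> ereal) \<Rightarrow> bool" where
  "maximal_solution M F W b \<sigma> D x0 X T \<longleftrightarrow>
     local_solution M F W b \<sigma> D x0 X T \<and>
     (AE \<omega> in M. T \<omega> < \<infinity> \<longrightarrow>
        (\<forall>K. compact K \<and> K \<subseteq> D \<longrightarrow> (\<exists>t\<ge>0. ereal t < T \<omega> \<and> X t \<omega> \<notin> K)))"

section \<open>Barrier functions and forward invariance in probability\<close>

text \<open>
  The feedback \<open>\<phi>\<close> witnessing the barrier property is kept as a parameter because the closed-loop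
  system depends on it.
\<close>

definition AS_RCBF_with ::
  "(real^'n \<Rightarrow> real^'n) \<Rightarrow> (real^'n \<Rightarrow> real^'m^'n) \<Rightarrow> (real^'n \<Rightarrow> real^'d^'n) \<Rightarrow>
   (real^'n \<Rightarrow> real^'m) \<Rightarrow> (real^'n) set \<Rightarrow> (real^'n \<Rightarrow> real^'m) \<Rightarrow> (real^'n \<Rightarrow> real) \<Rightarrow> bool" where
  "AS_RCBF_with f g \<sigma> uo D \<phi> B \<longleftrightarrow>
     continuous_on D \<phi> \<and>
     (\<exists>\<gamma>>0. \<forall>x\<in>D. generator f g \<sigma> (\<phi> x) uo B x \<le> \<gamma> * B x)"

text \<open>
  The closed-loop drift is merely continuous, so solutions need not be unique; the bound \<open>\<psi>\<close> is
  required to work for every maximal solution started at \<open>x0\<close>.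
\<close>

definition FIiP ::
  "'w measure \<Rightarrow> (real \<Rightarrow> 'w measure) \<Rightarrow> (real \<Rightarrow> 'w \<Rightarrow> real^'d) \<Rightarrow>
   (real^'n \<Rightarrow> real^'n) \<Rightarrow> (real^'n \<Rightarrow> real^'m^'n) \<Rightarrow> (real^'n \<Rightarrow> real^'d^'n) \<Rightarrow>
   (real^'n \<Rightarrow> real^'m) \<Rightarrow> (real^'n \<Rightarrow> real^'m) \<Rightarrow> (real^'n) set \<Rightarrow> bool" where
  "FIiP M F W f g \<sigma> uo \<phi> D \<longleftrightarrow>
     (\<exists>Y. C2_on D Y \<and> (\<forall>x\<in>D. 0 \<le> Y x) \<and> (\<forall>L\<ge>0. compact {x\<in>D. Y x \<le> L}) \<and>
       (\<forall>x0\<in>D. \<exists>\<psi>.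
          continuous_on ({0..} \<times> {0<..<1}) (\<lambda>(l, \<epsilon>). \<psi> l \<epsilon>) \<and>
          (\<forall>l\<ge>0. \<forall>\<epsilon>\<in>{0<..<1}. 0 \<le> \<psi> l \<epsilon>) \<and>
          (\<forall>X T. maximal_solution M F W (closed_loop f g uo \<phi>) \<sigma> D x0 X T \<longrightarrow>
             (\<forall>l\<ge>0. \<forall>\<epsilon>\<in>{0<..<1}.
                measure M {\<omega>\<in>space M. \<forall>t\<in>{0..l}. ereal t < T \<omega> \<and> X t \<omega> \<in> D \<and> Y (X t \<omega>) \<le> \<psi> l \<epsilon>}
                  \<ge> 1 - \<epsilon>))))"

end

theory Submission
  imports Defs
begin

text \<open>
  Let \<open>Z\<close> be the solution stopped when \<open>B = 1/h\<close> reaches a level \<open>k\<close>, or at time \<open>l\<close>. A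
  second-order Taylor expansion of \<open>B\<close> over a short time step, together with the martingale
  property, the isometry and a fourth-moment bound for increments of the Ito integral, gives
  \<open>E B(Z\<^sub>t) \<le> (1 + \<gamma>(t-s)) E B(Z\<^sub>s) + o(t-s)\<close>, uniformly in \<open>s\<close>. Discrete Gronwall yields
  \<open>E B(Z\<^sub>l) \<le> exp(\<gamma>l) B(x\<^sub>0)\<close>, so by Markov's inequality the level \<open>k = exp(\<gamma>l) B(x\<^sub>0)/\<epsilon>\<close> is
  reached before \<open>l\<close> with probability at most \<open>\<epsilon>\<close>; by maximality the solution cannot end earlier.
\<close>

section \<open>Calculus on compact sets\<close>

text \<open>The integral equation is given for each fixed time separately, with an Ito integral
  known only as a limit in probability. The argument therefore uses nothing but moments of
  increments between two fixed times. Stopping makes the integrand bounded, and for bounded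
  integrands convergence in probability improves to convergence in mean square. The obstacle in the
  Taylor step is the remainder. The level set \<open>K\<close> need not be convex, so distant pairs
  of points have to be paid for by a power of the increment whose mean is o(t-s). The second power
  is too weak; the fourth has mean of order (t-s)^2 and is bounded through exponential moments at
  scale 1/sqrt(t-s). Its constant depends on the tolerance, so the tolerance is fixed first and the
  step length last. The generator inequality has all its terms at one point, whereas a step pairs
  derivatives frozen at its start with coefficients along the path. Compactness of \<open>K\<close>
  bounds the mismatch by a small constant plus a multiple of the squared displacement, whose mean is
  again of first order.\<close>

lemma frechet_derivative_partial:
  assumes "y differentiable (at x)"
  shows "frechet_derivative y (at x) v = (\<Sum>i\<in>UNIV. v $ i * partial i y x)"
proof -
  have lin: "linear (frechet_derivative y (at x))"
    using assms by (simp add: frechet_derivative_works has_derivative_linear)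
  have "frechet_derivative y (at x) v = frechet_derivative y (at x) (\<Sum>i\<in>UNIV. v $ i *\<^sub>R axis i 1)"
    by (metis basis_expansion scalar_mult_eq_scaleR)
  also have "\<dots> = (\<Sum>i\<in>UNIV. v $ i * frechet_derivative y (at x) (axis i 1))"
    by (simp add: linear_sum[OF lin] linear_cmul[OF lin])
  finally show ?thesis by (simp add: partial_def)
qed

lemma has_derivative_partial:
  assumes "y differentiable (at x)"
  shows "(y has_derivative (\<lambda>v. \<Sum>i\<in>UNIV. v $ i * partial i y x)) (at x)"
  using assms frechet_derivative_partial[OF assms]
  by (metis (no_types, lifting) ext frechet_derivative_works)

lemma partial_eqI:
  assumes "(y has_derivative y') (at x)"
  shows "partial i y x = y' (axis i 1)"
  using frechet_derivative_at[OF assms] by (simp add: partial_def)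

text \<open>Partial derivatives at a point only see a neighbourhood, so a formula known on the open
  set \<open>S\<close> may be differentiated there. This gives the second partials of
  \<open>1 / h\<close>, whose first partials are known on \<open>S\<close> alone.\<close>

lemma partial_cong_open:
  assumes "open S" "x \<in> S" "\<And>z. z \<in> S \<Longrightarrow> y z = w z" "w differentiable (at x)"
  shows "partial i y x = partial i w x"
proof -
  have "(y has_derivative frechet_derivative w (at x)) (at x)"
    by (rule has_derivative_transform_within_open[OF _ assms(1,2)])
       (use assms in \<open>auto simp: frechet_derivative_works[symmetric]\<close>)
  from partial_eqI[OF this] show ?thesis by (simp add: partial_def)
qed

text \<open>The quotient rule twice. Since \<open>C2_on\<close> speaks about iterated
  \<open>partial\<close> operators, the derivatives are identified in closed form by
  \<open>p1\<close> and \<open>p2\<close>; \<open>der2\<close> gives differentiability of the first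
  partials, and continuity of the second ones is read off from \<open>p2\<close>.\<close>

lemma C2_on_inverse:
  fixes h :: "real^'n \<Rightarrow> real"
  assumes S: "open S" and h: "C2_on S h" and nz: "\<And>x. x \<in> S \<Longrightarrow> h x \<noteq> 0"
  shows "C2_on S (\<lambda>x. 1 / h x)"
proof -
  have dh: "h differentiable (at x)" if "x \<in> S" for x
    using h that by (auto simp: C2_on_def)
  have dph: "partial i h differentiable (at x)" if "x \<in> S" for x i
    using h that by (auto simp: C2_on_def)
  have der: "((\<lambda>x. 1 / h x) has_derivative (\<lambda>v. - (\<Sum>i\<in>UNIV. v $ i * partial i h x) / (h x)\<^sup>2)) (at x)"
    if "x \<in> S" for x
    using has_derivative_partial[OF dh[OF that]] nz[OF that]
    by (auto intro!: derivative_eq_intros simp: field_simps power2_eq_square)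
  have p1: "partial i (\<lambda>x. 1 / h x) x = - partial i h x / (h x)\<^sup>2" if "x \<in> S" for i x
    unfolding partial_eqI[OF der[OF that]] by (simp add: axis_def if_distrib[of "\<lambda>u. u * _"] cong: if_cong)
  have der2: "((\<lambda>x. - partial j h x / (h x)\<^sup>2) has_derivative
      (\<lambda>v. - (\<Sum>i\<in>UNIV. v $ i * partial i (partial j h) x) / (h x)\<^sup>2
         + 2 * partial j h x * (\<Sum>i\<in>UNIV. v $ i * partial i h x) / (h x)^3)) (at x)"
    if "x \<in> S" for j x
    using has_derivative_partial[OF dh[OF that]] has_derivative_partial[OF dph[OF that, of j]] nz[OF that]
    by (auto intro!: derivative_eq_intros simp: field_simps power2_eq_square power3_eq_cube)
  have diff2: "(\<lambda>x. - partial j h x / (h x)\<^sup>2) differentiable (at x)" if "x \<in> S" for j x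
    using der2[OF that] unfolding differentiable_def by blast
  have p2: "partial i (partial j (\<lambda>x. 1 / h x)) x
      = - partial i (partial j h) x / (h x)\<^sup>2 + 2 * partial j h x * partial i h x / (h x)^3"
    if "x \<in> S" for i j x
  proof -
    have "partial i (partial j (\<lambda>x. 1 / h x)) x = partial i (\<lambda>x. - partial j h x / (h x)\<^sup>2) x"
      by (rule partial_cong_open[OF S that _ diff2[OF that]]) (simp add: p1)
    also have "\<dots> = - partial i (partial j h) x / (h x)\<^sup>2 + 2 * partial j h x * partial i h x / (h x)^3"
      unfolding partial_eqI[OF der2[OF that]]
      by (simp add: axis_def if_distrib[of "\<lambda>u. u * _"] cong: if_cong)
    finally show ?thesis .
  qed
  have ch: "continuous_on S h" "continuous_on S (partial i h)" for i
    using dh dph by (auto intro!: differentiable_imp_continuous_on differentiable_at_imp_differentiable_on)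
  show ?thesis
    unfolding C2_on_def
  proof (intro conjI ballI allI)
    fix x assume x: "x \<in> S"
    show "(\<lambda>x. 1 / h x) differentiable at x" using der[OF x] unfolding differentiable_def by blast
    fix i
    show "partial i (\<lambda>x. 1 / h x) differentiable at x"
      using has_derivative_transform_within_open[OF der2[OF x] S x] p1
      unfolding differentiable_def by (metis (no_types, lifting))
  next
    fix i j
    have "continuous_on S (\<lambda>x. - partial i (partial j h) x / (h x)\<^sup>2 + 2 * partial j h x * partial i h x / (h x)^3)"
      using h by (intro continuous_intros ch) (auto simp: C2_on_def nz)
    then show "continuous_on S (partial i (partial j (\<lambda>x. 1 / h x)))"
      by (rule continuous_on_eq) (simp add: p2)
  qed
qed

lemma C2_on_continuous:
  assumes "C2_on S y"
  shows "continuous_on S y" "continuous_on S (gradient y)" "continuous_on S (hessian y)"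
proof -
  show "continuous_on S y" "continuous_on S (gradient y)"
    using assms unfolding C2_on_def gradient_def[abs_def]
    by (auto intro!: differentiable_imp_continuous_on differentiable_at_imp_differentiable_on continuous_intros)
  show "continuous_on S (hessian y)"
    using assms unfolding C2_on_def hessian_def[abs_def] by (auto intro!: continuous_intros)
qed

lemma continuous_on_comp_fst:
  assumes "continuous_on K u" "K' \<subseteq> K"
  shows "continuous_on (K' \<times> L) (\<lambda>p. u (fst p))"
  by (rule continuous_on_compose2[OF assms(1)]) (use assms in \<open>auto intro!: continuous_intros\<close>)

lemma continuous_on_comp_snd:
  assumes "continuous_on K u" "K' \<subseteq> K"
  shows "continuous_on (L \<times> K') (\<lambda>p. u (snd p))"
  by (rule continuous_on_compose2[OF assms(1)]) (use assms in \<open>auto intro!: continuous_intros\<close>)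

lemma continuous_on_matrix_mult:
  fixes f :: "'a::topological_space \<Rightarrow> real^'m^'n"
  shows "continuous_on S f \<Longrightarrow> continuous_on S x \<Longrightarrow> continuous_on S (\<lambda>z. f z *v x z)"
    and "continuous_on S f \<Longrightarrow> continuous_on S y \<Longrightarrow> continuous_on S (\<lambda>z. y z v* f z)"
    and "continuous_on S f \<Longrightarrow> continuous_on S g \<Longrightarrow> continuous_on S (\<lambda>z. f z ** g z)"
  unfolding matrix_vector_mult_def vector_matrix_mult_def matrix_matrix_mult_def
  by (intro continuous_on_vec_lambda continuous_on_sum continuous_on_mult continuous_on_component; assumption)+

text \<open>The norm on matrices is the Euclidean norm of all entries, so Cauchy-Schwarz in each row
  suffices.\<close>

lemma norm_matrix_vector_mult_le:
  fixes A :: "real^'d^'n" shows "norm (A *v x) \<le> norm A * norm x"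
proof -
  have "norm (A *v x) \<le> L2_set (\<lambda>i. norm (A $ i) * norm x) UNIV"
    unfolding norm_vec_def[of "A *v x"]
    by (intro L2_set_mono) (auto simp: matrix_vector_mul_component Cauchy_Schwarz_ineq2)
  then show ?thesis by (simp add: norm_vec_def[of A] L2_set_left_distrib)
qed

text \<open>The second-order Maclaurin formula for \<open>y\<close> along the segment, parametrised
  over \<open>[0, 1]\<close>; the intermediate parameter becomes the point \<open>w\<close>.\<close>

lemma Taylor2_on_segment:
  fixes y :: "real^'n \<Rightarrow> real"
  assumes y: "C2_on S y" and seg: "closed_segment x z \<subseteq> S"
  shows "\<exists>w\<in>closed_segment x z. y z = y x + gradient y x \<bullet> (z - x) + 1/2 * ((z - x) \<bullet> (hessian y w *v (z - x)))"
proof -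
  define v where "v = z - x"
  define c where "c s = x + s *\<^sub>R v" for s :: real
  have c_in: "c s \<in> closed_segment x z" if "0 \<le> s" "s \<le> 1" for s
    using that unfolding c_def v_def in_segment
    by (intro exI[of _ s]) (auto simp: algebra_simps)
  have cS: "c s \<in> S" if "0 \<le> s" "s \<le> 1" for s
    using c_in that seg by blast
  have dc: "(c has_derivative (\<lambda>s. s *\<^sub>R v)) (at s)" for s
    unfolding c_def by (auto intro!: derivative_eq_intros)
  \<comment> \<open>The family of derivatives that \<open>Maclaurin\<close> expects: for
    \<open>m \<le> 2\<close>, \<open>g m\<close> is the \<open>m\<close>-th derivative of
    \<open>y\<close> along the segment.\<close>
  define g where "g m s = (if m = (0::nat) then y (c s) else if m = 1 then gradient y (c s) \<bullet> v
     else v \<bullet> (hessian y (c s) *v v))" for m s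
  have chain: "((\<lambda>s. u (c s)) has_real_derivative (\<Sum>i\<in>UNIV. v $ i * partial i u (c s))) (at s)"
    if "u differentiable (at (c s))" for u s
    unfolding has_field_derivative_def
    using has_derivative_compose[OF dc has_derivative_partial[OF that]]
    by (rule has_derivative_eq_rhs) (auto simp: sum_distrib_left sum_distrib_right mult_ac)
  have D0: "(g 0 has_real_derivative g 1 s) (at s)" if "0 \<le> s" "s \<le> 1" for s
  proof -
    have "y differentiable (at (c s))" using y cS[OF that] by (auto simp: C2_on_def)
    from chain[OF this] show ?thesis
      by (simp add: g_def[abs_def] inner_vec_def gradient_def mult_ac)
  qed
  have D1: "(g 1 has_real_derivative g 2 s) (at s)" if "0 \<le> s" "s \<le> 1" for s
  proof -
    have "partial j y differentiable (at (c s))" for j using y cS[OF that] by (auto simp: C2_on_def)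
    from chain[OF this]
    have "((\<lambda>s. \<Sum>j\<in>UNIV. v $ j * partial j y (c s)) has_real_derivative
       (\<Sum>j\<in>UNIV. v $ j * (\<Sum>i\<in>UNIV. v $ i * partial i (partial j y) (c s)))) (at s)"
      by (intro DERIV_sum DERIV_cmult)
    also have "(\<Sum>j\<in>UNIV. v $ j * (\<Sum>i\<in>UNIV. v $ i * partial i (partial j y) (c s)))
      = v \<bullet> (hessian y (c s) *v v)"
      unfolding inner_vec_def matrix_vector_mult_def hessian_def
      by (simp add: sum_distrib_left mult_ac) (subst sum.swap, simp add: mult_ac)
    finally show ?thesis by (simp add: g_def[abs_def] inner_vec_def gradient_def mult_ac)
  qed
  have "\<exists>t. 0 < t \<and> t < 1 \<and> g 0 1 = (\<Sum>m<2. g m 0 / fact m * 1 ^ m) + g 2 t / fact 2 * 1 ^ 2"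
    by (rule Maclaurin) (use D0 D1 in \<open>auto simp: less_Suc_eq numeral_2_eq_2\<close>)
  then obtain t where t: "0 < t" "t < 1" "g 0 1 = g 0 0 + g 1 0 + g 2 t / 2"
    by (auto simp: numeral_2_eq_2)
  show ?thesis
    by (rule bexI[OF _ c_in[of t]]) (use t in \<open>auto simp: g_def c_def v_def\<close>)
qed

text \<open>
  The segment between two points of \<open>K\<close> may leave \<open>S\<close>; the quartic term absorbs all pairs that
  are not close to each other.
\<close>

lemma Taylor2_quartic_remainder:
  fixes y :: "real^'n \<Rightarrow> real"
  assumes S: "open S" and y: "C2_on S y" and K: "compact K" "K \<subseteq> S" and e: "e > 0"
  shows "\<exists>C\<ge>0. \<forall>x\<in>K. \<forall>z\<in>K. \<bar>y z - y x - gradient y x \<bullet> (z - x) - 1/2 * ((z - x) \<bullet> (hessian y x *v (z - x)))\<bar>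
            \<le> e * (norm (z - x))\<^sup>2 + C * norm (z - x) ^ 4"
proof (cases "K = {}")
  case False
  define R where "R x z = y z - y x - gradient y x \<bullet> (z - x) - 1/2 * ((z - x) \<bullet> (hessian y x *v (z - x)))" for x z
  obtain r where r: "r > 0" "(\<Union>x\<in>K. cball x r) \<subseteq> S"
    using compact_subset_open_imp_cball_epsilon_subset[OF K(1) S K(2)] by auto
  \<comment> \<open>The closed \<open>r\<close>-neighbourhood of \<open>K\<close>, written as a sum
    of compact sets so that its compactness is immediate. It lies in \<open>S\<close> and contains
    every segment between points of \<open>K\<close> at distance less than \<open>r\<close>.\<close>
  define N where "N = {x + u | x u. x \<in> K \<and> u \<in> cball 0 r}"
  have N_eq: "N = (\<Union>x\<in>K. cball x r)"
    unfolding N_def by (auto simp: dist_norm) (metis add_diff_cancel_left' diff_add_cancel norm_minus_commute add.commute)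
  have "compact N" unfolding N_def by (intro compact_sums K compact_cball)
  then have "uniformly_continuous_on N (hessian y)"
    using continuous_on_subset[OF C2_on_continuous(3)[OF y]] r N_eq by (intro compact_uniformly_continuous) auto
  then obtain d where d: "d > 0" "\<And>x w. x \<in> N \<Longrightarrow> w \<in> N \<Longrightarrow> dist w x < d \<Longrightarrow> norm (hessian y w - hessian y x) < e"
    unfolding uniformly_continuous_on_def dist_norm using e by metis
  define \<delta> where "\<delta> = min d r"
  have \<delta>: "\<delta> > 0" using d r by (simp add: \<delta>_def)
  have near: "\<bar>R x z\<bar> \<le> e * (norm (z - x))\<^sup>2" if xz: "x \<in> K" "z \<in> K" "norm (z - x) < \<delta>" for x z
  proof -
    have seg: "closed_segment x z \<subseteq> ball x \<delta>"
      using xz \<delta> by (intro closed_segment_subset) (auto simp: dist_norm norm_minus_commute)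
    have "ball x \<delta> \<subseteq> N" using xz by (auto simp: N_eq \<delta>_def)
    moreover have "N \<subseteq> S" using r N_eq by simp
    ultimately obtain w where w: "w \<in> closed_segment x z"
       "y z = y x + gradient y x \<bullet> (z - x) + 1/2 * ((z - x) \<bullet> (hessian y w *v (z - x)))"
      using Taylor2_on_segment[OF y, of x z] seg by blast
    have "norm (hessian y w - hessian y x) \<le> e"
      using d(2)[of x w] w seg \<open>ball x \<delta> \<subseteq> N\<close> xz \<delta> by (force simp: \<delta>_def dist_commute)
    have "R x z = 1/2 * ((z - x) \<bullet> ((hessian y w - hessian y x) *v (z - x)))"
      by (simp add: R_def w(2) matrix_vector_mult_diff_rdistrib inner_diff_right algebra_simps)
    also have "\<bar>\<dots>\<bar> \<le> \<bar>(z - x) \<bullet> ((hessian y w - hessian y x) *v (z - x))\<bar>"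
      by simp
    also have "\<dots> \<le> norm (z - x) * norm ((hessian y w - hessian y x) *v (z - x))"
      by (rule Cauchy_Schwarz_ineq2)
    also have "\<dots> \<le> norm (z - x) * (norm (hessian y w - hessian y x) * norm (z - x))"
      by (intro mult_left_mono norm_matrix_vector_mult_le) auto
    also have "\<dots> \<le> norm (z - x) * (e * norm (z - x))"
      using \<open>norm (hessian y w - hessian y x) \<le> e\<close> by (intro mult_left_mono mult_right_mono) auto
    finally show ?thesis by (simp add: power2_eq_square mult_ac)
  qed
  have "continuous_on (K \<times> K) (\<lambda>(x, z). R x z)"
  proof -
    have y': "continuous_on K y" "continuous_on K (gradient y)" "continuous_on K (hessian y)"
      using C2_on_continuous[OF y, THEN continuous_on_subset, OF K(2)] by auto
    note f = continuous_on_comp_fst[OF _ subset_refl] continuous_on_comp_snd[OF _ subset_refl]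
    have "continuous_on (K \<times> K) (\<lambda>p. hessian y (fst p) *v (snd p - fst p))"
      by (intro continuous_intros continuous_on_matrix_mult f y')
    then show ?thesis
      unfolding R_def case_prod_unfold by (intro continuous_intros f y')
  qed
  then have "bounded ((\<lambda>(x, z). R x z) ` (K \<times> K))"
    by (intro compact_imp_bounded compact_continuous_image compact_Times K)
  then obtain B where B: "B > 0" "\<And>x z. x \<in> K \<Longrightarrow> z \<in> K \<Longrightarrow> \<bar>R x z\<bar> \<le> B"
    unfolding bounded_pos by (auto simp: image_iff)
  show ?thesis
  \<comment> \<open>At distance at least \<open>\<delta>\<close> the factor
    \<open>norm (z - x) ^ 4 / \<delta>^4\<close> is at least \<open>1\<close>, so the uniform bound
    \<open>B\<close> of the remainder over \<open>K \<times> K\<close> yields this constant.\<close>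
  proof (intro exI[of _ "B / \<delta>^4"] conjI ballI)
    show "0 \<le> B / \<delta>^4" using B \<delta> by simp
    fix x z assume xz: "x \<in> K" "z \<in> K"
    have "\<bar>R x z\<bar> \<le> e * (norm (z - x))\<^sup>2 + B / \<delta>^4 * norm (z - x) ^ 4"
    proof (cases "norm (z - x) < \<delta>")
      case True
      then show ?thesis using near[OF xz True] B \<delta> by (simp add: add_increasing2)
    next
      case False
      then have "\<delta>^4 \<le> norm (z - x) ^ 4" using \<delta> by (intro power_mono) auto
      then have "B \<le> B / \<delta>^4 * norm (z - x) ^ 4"
        using B \<delta> by (simp add: field_simps)
      then show ?thesis using B(2)[OF xz] e by (smt (verit) mult_nonneg_nonneg zero_le_power2)
    qed
    then show "\<bar>y z - y x - gradient y x \<bullet> (z - x) - 1/2 * ((z - x) \<bullet> (hessian y x *v (z - x)))\<bar>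
            \<le> e * (norm (z - x))\<^sup>2 + B / \<delta>^4 * norm (z - x) ^ 4"
      by (simp add: R_def)
  qed
qed auto

text \<open>Meant for the generator with derivatives at \<open>x\<close> and coefficients at
  \<open>z\<close>, where the barrier inequality controls only the diagonal. Near the diagonal
  uniform continuity leaves at most \<open>e\<close>; away from it the bound of \<open>Q\<close> on
  \<open>K \<times> K\<close> is paid by the quadratic term.\<close>

lemma diagonal_nonpos_quadratic_bound:
  fixes Q :: "'a::real_normed_vector \<Rightarrow> 'a \<Rightarrow> real"
  assumes K: "compact K" and Q: "continuous_on (K \<times> K) (\<lambda>(x, z). Q x z)"
    and diag: "\<And>x. x \<in> K \<Longrightarrow> Q x x \<le> 0" and e: "e > 0"
  shows "\<exists>C\<ge>0. \<forall>x\<in>K. \<forall>z\<in>K. Q x z \<le> e + C * (norm (z - x))\<^sup>2"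
proof -
  have cKK: "compact (K \<times> K)" using K by (intro compact_Times)
  obtain d where d: "d > 0"
     "\<And>p q. p \<in> K \<times> K \<Longrightarrow> q \<in> K \<times> K \<Longrightarrow> dist q p < d \<Longrightarrow> dist (case_prod Q q) (case_prod Q p) < e"
    using compact_uniformly_continuous[OF Q cKK] e unfolding uniformly_continuous_on_def by metis
  have "bounded ((\<lambda>(x, z). Q x z) ` (K \<times> K))"
    by (intro compact_imp_bounded compact_continuous_image cKK Q)
  then obtain B where B: "B > 0" "\<And>x z. x \<in> K \<Longrightarrow> z \<in> K \<Longrightarrow> \<bar>Q x z\<bar> \<le> B"
    unfolding bounded_pos by (auto simp: image_iff)
  show ?thesis
  proof (intro exI[of _ "B / d\<^sup>2"] conjI ballI)
    show "0 \<le> B / d\<^sup>2" using B by simp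
    fix x z assume xz: "x \<in> K" "z \<in> K"
    show "Q x z \<le> e + B / d\<^sup>2 * (norm (z - x))\<^sup>2"
    proof (cases "norm (z - x) < d")
      case True
      then have "dist (case_prod Q (x, z)) (case_prod Q (x, x)) < e"
        using xz by (intro d) (auto simp: dist_Pair_Pair dist_norm)
      then have "Q x z \<le> e" using diag[OF xz(1)] by (simp add: dist_real_def)
      then show ?thesis using B by (smt (verit) zero_le_divide_iff zero_le_mult_iff zero_le_power2)
    next
      case False
      then have "d\<^sup>2 \<le> (norm (z - x))\<^sup>2" using d by (intro power_mono) auto
      then have "B \<le> B / d\<^sup>2 * (norm (z - x))\<^sup>2"
        using B d by (simp add: field_simps)
      then show ?thesis using B(2)[OF xz] e by linarith
    qed
  qed
qed

text \<open>Over \<open>N\<close> equal steps the growth factors multiply to at most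
  \<open>exp (\<gamma> * l)\<close>, and the errors add up to at most \<open>e * l\<close> times
  that factor. As the admissible step length may depend on \<open>e\<close>, the partition is chosen
  after \<open>e\<close>, and only then does \<open>e\<close> tend to \<open>0\<close>.\<close>

lemma discrete_Gronwall:
  fixes u :: "real \<Rightarrow> real"
  assumes l: "0 \<le> l" and \<gamma>: "0 \<le> \<gamma>" and u0: "0 \<le> u 0"
    and step: "\<And>e. e > 0 \<Longrightarrow> \<exists>d>0. \<forall>s t. 0 \<le> s \<and> s < t \<and> t \<le> l \<and> t - s \<le> d \<longrightarrow>
                 u t \<le> u s * (1 + \<gamma> * (t - s)) + e * (t - s)"
  shows "u l \<le> exp (\<gamma> * l) * u 0"
proof (cases "l = 0")
  case False
  with l have l: "l > 0" by simp
  have bound: "u l \<le> exp (\<gamma> * l) * (u 0 + e * l)" if e: "e > 0" for e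
  proof -
    obtain d where d: "d > 0" "\<And>s t. 0 \<le> s \<Longrightarrow> s < t \<Longrightarrow> t \<le> l \<Longrightarrow> t - s \<le> d \<Longrightarrow>
                 u t \<le> u s * (1 + \<gamma> * (t - s)) + e * (t - s)"
      using step[OF e] by metis
    obtain N :: nat where N: "l / d < real N" using reals_Archimedean2 by blast
    have N0: "N > 0" using N l d by (cases N) (auto simp: divide_less_0_iff)
    define \<delta> where "\<delta> = l / N"
    have \<delta>: "0 < \<delta>" "\<delta> \<le> d" "real N * \<delta> = l" using N N0 l d by (auto simp: \<delta>_def field_simps)
    \<comment> \<open>The accumulated error stands inside the bracket, multiplied by a growth factor
      of at least \<open>1\<close>; in this form the induction closes.\<close>
    have *: "u (real k * \<delta>) \<le> (1 + \<gamma> * \<delta>)^k * (u 0 + e * (real k * \<delta>))" if "k \<le> N" for k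
      using that
    proof (induction k)
      case (Suc k)
      have le: "real (Suc k) * \<delta> \<le> l"
        using Suc.prems \<delta>(1) by (subst \<delta>(3)[symmetric], intro mult_right_mono) auto
      have "u (real (Suc k) * \<delta>) \<le> u (real k * \<delta>) * (1 + \<gamma> * \<delta>) + e * \<delta>"
        using d(2)[of "real k * \<delta>" "real (Suc k) * \<delta>"] \<delta> le by (auto simp: algebra_simps)
      also have "\<dots> \<le> (1 + \<gamma> * \<delta>)^k * (u 0 + e * (real k * \<delta>)) * (1 + \<gamma> * \<delta>) + e * \<delta>"
        using Suc \<gamma> \<delta> by (intro add_right_mono mult_right_mono) auto
      also have "\<dots> \<le> (1 + \<gamma> * \<delta>)^k * (u 0 + e * (real k * \<delta>)) * (1 + \<gamma> * \<delta>) + (1 + \<gamma> * \<delta>)^Suc k * (e * \<delta>)"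
        using \<gamma> \<delta> e mult_right_mono[of 1 "(1 + \<gamma> * \<delta>)^Suc k" "e * \<delta>"]
          one_le_power[of "1 + \<gamma> * \<delta>" "Suc k"] by (intro add_left_mono) auto
      also have "\<dots> = (1 + \<gamma> * \<delta>)^Suc k * (u 0 + e * (real (Suc k) * \<delta>))"
        by (simp add: algebra_simps)
      finally show ?case .
    qed auto
    have "u l \<le> (1 + \<gamma> * \<delta>)^N * (u 0 + e * l)" using *[of N] \<delta> by simp
    moreover have "(1 + \<gamma> * \<delta>)^N \<le> exp (\<gamma> * \<delta>)^N"
      using \<gamma> \<delta> by (intro power_mono exp_ge_add_one_self) auto
    then have "(1 + \<gamma> * \<delta>)^N \<le> exp (\<gamma> * l)"
      by (simp add: exp_of_nat_mult[symmetric] \<delta>(3)[symmetric] mult_ac)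
    ultimately show ?thesis
      using u0 e l by (meson add_nonneg_nonneg less_imp_le mult_nonneg_nonneg mult_right_mono order_trans)
  qed
  have "((\<lambda>e. exp (\<gamma> * l) * (u 0 + e * l)) \<longlongrightarrow> exp (\<gamma> * l) * (u 0 + 0 * l)) (at_right 0)"
    by (intro tendsto_intros)
  then have "u l \<le> exp (\<gamma> * l) * (u 0 + 0 * l)"
    by (rule tendsto_lowerbound) (auto simp: eventually_at_right_less bound intro!: eventually_at_rightI[of 0 1])
  then show ?thesis by simp
qed auto

section \<open>Increments of the Wiener process\<close>

locale wiener_setup =
  fixes M :: "'w measure" and F :: "real \<Rightarrow> 'w measure" and W :: "real \<Rightarrow> 'w \<Rightarrow> real^'d"
  assumes filtered: "filtered_prob_space M F" and wiener: "wiener_process M F W"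

sublocale wiener_setup \<subseteq> prob_space M
  using filtered by (simp add: filtered_prob_space_def)

context wiener_setup
begin

lemma space_F[simp]: "space (F t) = space M"
  using filtered by (simp add: filtered_prob_space_def filtration_def)

lemma sets_F_mono: "s \<le> t \<Longrightarrow> sets (F s) \<subseteq> sets (F t)"
  using filtered by (auto simp: filtered_prob_space_def filtration_def)

lemma sets_F_M: "sets (F t) \<subseteq> sets M"
  using filtered by (auto simp: filtered_prob_space_def subalgebra_def)

lemma measurable_F_mono:
  assumes "X \<in> measurable (F s) N" "s \<le> t" shows "X \<in> measurable (F t) N"
  using measurable_mono[of N N "F s" "F t"] sets_F_mono[OF assms(2)] assms(1) by auto

lemma measurable_F_M:
  assumes "X \<in> measurable (F s) N" shows "X \<in> measurable M N"
  using measurable_mono[of N N "F s" M] sets_F_M assms(1) by auto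

lemma W_measurable_F: "0 \<le> s \<Longrightarrow> s \<le> t \<Longrightarrow> W s \<in> borel_measurable (F t)"
  using wiener measurable_F_mono[of "W s" s borel t] by (simp add: wiener_process_def)

lemma W_measurable: "0 \<le> s \<Longrightarrow> W s \<in> borel_measurable M"
  using W_measurable_F[of s s] measurable_F_M by blast

lemma W_diff_measurable: "0 \<le> s \<Longrightarrow> s \<le> t \<Longrightarrow> (\<lambda>\<omega>. W t \<omega> - W s \<omega>) \<in> borel_measurable M"
  using W_measurable by (intro borel_measurable_diff) auto

lemma W_diff_nth_measurable_F:
  "0 \<le> s \<Longrightarrow> s \<le> t \<Longrightarrow> t \<le> u \<Longrightarrow> (\<lambda>\<omega>. (W t \<omega> - W s \<omega>) $ i) \<in> borel_measurable (F u)"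
  using W_measurable_F by (intro measurable_compose[OF _ borel_measurable_nth] borel_measurable_diff) auto

text \<open>Both random variables must have the same type in \<^const>\<open>indep_var\<close>, hence the map \<open>v\<close>.\<close>

lemma increment_indep:
  assumes X: "X \<in> measurable (F s) N" and v: "v \<in> measurable borel N'" and st: "0 \<le> s" "s < t"
  shows "indep_var N X N' (\<lambda>\<omega>. v (W t \<omega> - W s \<omega>))"
proof -
  let ?D = "\<lambda>\<omega>. W t \<omega> - W s \<omega>"
  have XM: "X \<in> measurable M N" using measurable_F_M[OF X] .
  have dW: "?D \<in> borel_measurable M" using st by (intro W_diff_measurable) auto
  have vM: "(\<lambda>\<omega>. v (?D \<omega>)) \<in> measurable M N'" using measurable_compose[OF dW v] .
  have ind: "indep_set (sets (F s)) {?D -` A \<inter> space M | A. A \<in> sets borel}"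
    using wiener st by (simp add: wiener_process_def)
  have s1: "sigma_sets (space M) {X -` A \<inter> space M | A. A \<in> sets N} \<subseteq> sets (F s)"
  proof -
    have "{X -` A \<inter> space M | A. A \<in> sets N} \<subseteq> sets (F s)"
      using measurable_sets[OF X] by auto
    from sets.sigma_sets_subset[OF this] show ?thesis by simp
  qed
  \<comment> \<open>Preimages of Borel sets already form a sigma-algebra, so generating from them
    adds nothing and the independence assumed for the Wiener process applies directly.\<close>
  have eq: "sets (vimage_algebra (space M) ?D borel) = {?D -` A \<inter> space M | A. A \<in> sets borel}"
    by (intro sets_vimage_algebra2) auto
  have "{(\<lambda>\<omega>. v (?D \<omega>)) -` A \<inter> space M | A. A \<in> sets N'} \<subseteq> {?D -` A \<inter> space M | A. A \<in> sets borel}"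
  proof safe
    fix A assume "A \<in> sets N'"
    then have "v -` A \<in> sets borel" using measurable_sets[OF v] by simp
    then show "\<exists>B. (\<lambda>\<omega>. v (?D \<omega>)) -` A \<inter> space M = ?D -` B \<inter> space M \<and> B \<in> sets borel"
      by (intro exI[of _ "v -` A"]) auto
  qed
  then have s2: "sigma_sets (space M) {(\<lambda>\<omega>. v (?D \<omega>)) -` A \<inter> space M | A. A \<in> sets N'}
      \<subseteq> {?D -` A \<inter> space M | A. A \<in> sets borel}"
    unfolding eq[symmetric] by (drule_tac sets.sigma_sets_subset) simp
  show ?thesis
    unfolding indep_var_eq
  proof (intro conjI XM vM)
    show "indep_set (sigma_sets (space M) {X -` A \<inter> space M | A. A \<in> sets N})
      (sigma_sets (space M) {(\<lambda>\<omega>. v (?D \<omega>)) -` A \<inter> space M | A. A \<in> sets N'})"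
      using ind unfolding indep_set_def
      by (rule indep_sets_mono_sets) (use s1 s2 in \<open>simp split: bool.split\<close>)
  qed
qed

text \<open>Independence of the increment from \<open>F s\<close> factors the expectation. In the
  applications \<open>v\<close> picks a coordinate, or a product of two coordinates, of the
  increment.\<close>

lemma increment_mult:
  assumes U: "U \<in> borel_measurable (F s)" "integrable M U" and st: "0 \<le> s" "s < t"
    and v: "v \<in> borel_measurable borel" "has_bochner_integral M (\<lambda>\<omega>. v (W t \<omega> - W s \<omega>)) c"
  shows "has_bochner_integral M (\<lambda>\<omega>. U \<omega> * v (W t \<omega> - W s \<omega>)) (expectation U * (c::real))"
proof -
  note ind = increment_indep[OF U(1) v(1) st]
  have iv: "integrable M (\<lambda>\<omega>. v (W t \<omega> - W s \<omega>))" using v by (simp add: has_bochner_integral_iff)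
  show ?thesis
    using indep_var_lebesgue_integral[OF ind U(2) iv] indep_var_integrable[OF ind U(2) iv] v
    by (simp add: has_bochner_integral_iff)
qed

lemma increment_distributed:
  "0 \<le> s \<Longrightarrow> s < t \<Longrightarrow>
    distributed M lborel (\<lambda>\<omega>. (W t \<omega> - W s \<omega>) $ i) (normal_density 0 (sqrt (t - s)))"
  "0 \<le> s \<Longrightarrow> s < t \<Longrightarrow> indep_vars (\<lambda>_. borel) (\<lambda>i \<omega>. (W t \<omega> - W s \<omega>) $ i) UNIV"
  using wiener by (simp_all add: wiener_process_def)

lemma increment_mean:
  assumes st: "0 \<le> s" "s < t"
  shows "has_bochner_integral M (\<lambda>\<omega>. (W t \<omega> - W s \<omega>) $ i) 0"
proof -
  have pos: "sqrt (t - s) > 0" using st by simp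
  note D = increment_distributed(1)[OF st, of i]
  have "integrable M (\<lambda>\<omega>. (W t \<omega> - W s \<omega>) $ i)"
    using distributed_integrable_var[OF D] integrable_normal_moment_nz_1[OF pos] by auto
  then show ?thesis using normal_distributed_expectation[OF pos D] by (simp add: has_bochner_integral_iff)
qed

lemma increment_second_moment:
  assumes st: "0 \<le> s" "s < t"
  shows "has_bochner_integral M (\<lambda>\<omega>. (W t \<omega> - W s \<omega>) $ i * (W t \<omega> - W s \<omega>) $ j) (if i = j then t - s else 0)"
proof (cases "i = j")
  case True
  have pos: "sqrt (t - s) > 0" using st by simp
  note D = increment_distributed(1)[OF st, of i]
  have *: "has_bochner_integral lborel (\<lambda>x. normal_density 0 (sqrt (t - s)) x * (x - 0)\<^sup>2) (t - s)"
    using normal_moment_even[OF pos, of 0 1] st by (simp add: fact_numeral diff_divide_distrib)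
  have "integrable M (\<lambda>\<omega>. ((W t \<omega> - W s \<omega>) $ i)\<^sup>2)"
    using distributed_integrable[OF D, of power2] * by (auto simp: has_bochner_integral_iff)
  moreover have "(\<integral>\<omega>. ((W t \<omega> - W s \<omega>) $ i)\<^sup>2 \<partial>M) = t - s"
    using distributed_integral[OF D, of power2] * by (auto simp: has_bochner_integral_iff)
  ultimately show ?thesis using True by (simp add: has_bochner_integral_iff power2_eq_square)
next
  case False
  let ?X = "\<lambda>i \<omega>. (W t \<omega> - W s \<omega>) $ i"
  have "indep_vars (\<lambda>_. borel) ?X {i, j}"
    using increment_distributed(2)[OF st] by (rule indep_vars_subset) auto
  from indep_vars_lebesgue_integral[OF _ this] indep_vars_integrable[OF _ this] increment_mean[OF st]
  show ?thesis using False by (simp add: has_bochner_integral_iff)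
qed

lemma increment_zero:
  assumes U: "U \<in> borel_measurable (F s)" "integrable M U" and st: "0 \<le> s" "s \<le> t"
  shows "has_bochner_integral M (\<lambda>\<omega>. U \<omega> * (W t \<omega> - W s \<omega>) $ j) (0::real)"
proof (cases "s < t")
  case True
  show ?thesis using increment_mult[OF U st(1) True, of "\<lambda>x. x $ j" 0] increment_mean[OF st(1) True] by simp
next
  case False then show ?thesis using st by (simp add: has_bochner_integral_zero)
qed

lemma increment_quadratic:
  assumes U: "U \<in> borel_measurable (F s)" "integrable M U" and st: "0 \<le> s" "s \<le> t"
  shows "has_bochner_integral M (\<lambda>\<omega>. U \<omega> * (W t \<omega> - W s \<omega>) $ i * (W t \<omega> - W s \<omega>) $ j)
           ((if i = j then t - s else 0) * expectation U)"
proof (cases "s < t")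
  case True
  show ?thesis using increment_mult[OF U st(1) True, of "\<lambda>x. x $ i * x $ j", OF _ increment_second_moment[OF st(1) True]]
    by (auto simp: mult_ac)
next
  case False then show ?thesis using st by (simp add: has_bochner_integral_zero)
qed

lemma integrable_bounded_mult:
  fixes X Y :: "'w \<Rightarrow> real"
  assumes "X \<in> borel_measurable M" "bounded (X ` space M)" "integrable M Y"
  shows "integrable M (\<lambda>\<omega>. X \<omega> * Y \<omega>)"
proof -
  obtain c where c: "\<And>\<omega>. \<omega> \<in> space M \<Longrightarrow> \<bar>X \<omega>\<bar> \<le> c" using assms(2) by (auto simp: bounded_iff)
  show ?thesis
    by (rule Bochner_Integration.integrable_bound[where f="\<lambda>\<omega>. c * Y \<omega>"])
       (use assms c in \<open>auto intro!: AE_I2 mult_right_mono simp: abs_mult intro: order_trans[OF c abs_ge_self]\<close>)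
qed

lemma integrable_bounded:
  fixes X :: "'w \<Rightarrow> real"
  assumes "X \<in> borel_measurable M" "bounded (X ` space M)"
  shows "integrable M X"
  using integrable_bounded_mult[OF assms, of "\<lambda>_. 1"] by simp

lemma integrable_increment: "0 \<le> s \<Longrightarrow> s \<le> t \<Longrightarrow> integrable M (\<lambda>\<omega>. (W t \<omega> - W s \<omega>) $ i)"
  using increment_mean[of s t i] by (cases "s = t") (auto simp: has_bochner_integral_iff)

text \<open>\<open>W b' - W a\<close> is split at \<open>b\<close>. The part after \<open>b\<close>
  has mean zero given \<open>F b\<close>, where the rest of the product is measurable; the part up
  to \<open>b\<close> contributes the variance.\<close>

lemma increment_same_start:
  assumes X: "X \<in> borel_measurable (F a)" "bounded (X ` space M)" and ab: "0 \<le> a" "a \<le> b" "b \<le> b'"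
  shows "has_bochner_integral M (\<lambda>\<omega>. X \<omega> * (W b \<omega> - W a \<omega>) $ i * (W b' \<omega> - W a \<omega>) $ j)
     ((if i = j then b - a else 0) * expectation X)"
proof -
  have Xi: "integrable M X" using X measurable_F_M by (intro integrable_bounded) auto
  let ?U = "\<lambda>\<omega>. X \<omega> * (W b \<omega> - W a \<omega>) $ i"
  have Um: "?U \<in> borel_measurable (F b)"
    using measurable_F_mono[OF X(1) ab(2)] ab by (intro borel_measurable_times W_diff_nth_measurable_F) auto
  have "integrable M ?U"
    using X measurable_F_M ab by (intro integrable_bounded_mult integrable_increment) auto
  from increment_zero[OF Um this _ ab(3), of j] increment_quadratic[OF X(1) Xi ab(1,2), of i j] ab
  have "has_bochner_integral M (\<lambda>\<omega>. X \<omega> * (W b \<omega> - W a \<omega>) $ i * (W b \<omega> - W a \<omega>) $ j +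
      ?U \<omega> * (W b' \<omega> - W b \<omega>) $ j) ((if i = j then b - a else 0) * expectation X + 0)"
    by (intro has_bochner_integral_add) auto
  then show ?thesis by (simp add: algebra_simps)
qed

lemma bounded_mult_image:
  fixes X Y :: "'b \<Rightarrow> real"
  assumes "bounded (X ` S)" "bounded (Y ` S)" shows "bounded ((\<lambda>\<omega>. X \<omega> * Y \<omega>) ` S)"
proof -
  obtain c d where c: "\<And>\<omega>. \<omega> \<in> S \<Longrightarrow> \<bar>X \<omega>\<bar> \<le> c" and d: "\<And>\<omega>. \<omega> \<in> S \<Longrightarrow> \<bar>Y \<omega>\<bar> \<le> d"
    using assms by (auto simp: bounded_iff)
  have "\<bar>X \<omega> * Y \<omega>\<bar> \<le> c * d" if "\<omega> \<in> S" for \<omega>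
    unfolding abs_mult using c[OF that] d[OF that] by (intro mult_mono) auto
  then show ?thesis by (auto simp: bounded_iff)
qed

text \<open>\<open>max 0 (min b b' - max a a')\<close> is the length of the overlap of the two
  intervals, and only the overlap contributes. Whatever is known at time \<open>a'\<close> is
  annihilated by the increment that starts there, so the first increment is split at
  \<open>a'\<close> if it reaches beyond.\<close>

lemma increment_cross_ordered:
  assumes X: "X \<in> borel_measurable (F a)" "bounded (X ` space M)"
    and Y: "Y \<in> borel_measurable (F a')" "bounded (Y ` space M)"
    and ab: "0 \<le> a" "a \<le> b" "a' \<le> b'" "a \<le> a'"
  shows "has_bochner_integral M (\<lambda>\<omega>. X \<omega> * Y \<omega> * (W b \<omega> - W a \<omega>) $ i * (W b' \<omega> - W a' \<omega>) $ j)
     ((if i = j then max 0 (min b b' - max a a') else 0) * expectation (\<lambda>\<omega>. X \<omega> * Y \<omega>))"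
proof -
  have XY: "(\<lambda>\<omega>. X \<omega> * Y \<omega>) \<in> borel_measurable (F a')" "bounded ((\<lambda>\<omega>. X \<omega> * Y \<omega>) ` space M)"
    using measurable_F_mono[OF X(1) ab(4)] Y bounded_mult_image[OF X(2) Y(2)] by auto
  have early: "has_bochner_integral M (\<lambda>\<omega>. X \<omega> * Y \<omega> * (W c \<omega> - W a \<omega>) $ i * (W b' \<omega> - W a' \<omega>) $ j) 0"
    if c: "a \<le> c" "c \<le> a'" for c
  proof (rule increment_zero)
    show "(\<lambda>\<omega>. X \<omega> * Y \<omega> * (W c \<omega> - W a \<omega>) $ i) \<in> borel_measurable (F a')"
      using ab c by (intro borel_measurable_times[OF XY(1)] W_diff_nth_measurable_F) auto
    show "integrable M (\<lambda>\<omega>. X \<omega> * Y \<omega> * (W c \<omega> - W a \<omega>) $ i)"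
      using XY measurable_F_M ab c by (intro integrable_bounded_mult integrable_increment) auto
  qed (use ab in auto)
  show ?thesis
  proof (cases "b \<le> a'")
    case True
    then have "max 0 (min b b' - max a a') = 0" using ab by auto
    with early[OF ab(2) True] show ?thesis by (cases "i = j") simp_all
  next
    case False
    then have a'b: "a' \<le> b" by simp
    have len: "max 0 (min b b' - max a a') = min b b' - a'" using ab a'b by auto
    have late: "has_bochner_integral M (\<lambda>\<omega>. X \<omega> * Y \<omega> * (W b \<omega> - W a' \<omega>) $ i * (W b' \<omega> - W a' \<omega>) $ j)
     ((if i = j then min b b' - a' else 0) * expectation (\<lambda>\<omega>. X \<omega> * Y \<omega>))"
    proof (cases "b \<le> b'")
      case True
      then show ?thesis using increment_same_start[OF XY, of b b' i j] ab a'b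
        by (cases "i = j") (simp_all add: min_absorb1)
    next
      case False
      then show ?thesis using increment_same_start[OF XY, of b' b j i] ab a'b
        by (cases "i = j") (simp_all add: mult_ac min_absorb2)
    qed
    have "has_bochner_integral M (\<lambda>\<omega>. X \<omega> * Y \<omega> * (W a' \<omega> - W a \<omega>) $ i * (W b' \<omega> - W a' \<omega>) $ j +
        X \<omega> * Y \<omega> * (W b \<omega> - W a' \<omega>) $ i * (W b' \<omega> - W a' \<omega>) $ j)
      (0 + (if i = j then min b b' - a' else 0) * expectation (\<lambda>\<omega>. X \<omega> * Y \<omega>))"
      using ab by (intro has_bochner_integral_add early late) auto
    then show ?thesis unfolding len by (simp add: algebra_simps)
  qed
qed

lemma increment_cross:
  assumes X: "X \<in> borel_measurable (F a)" "bounded (X ` space M)"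
    and Y: "Y \<in> borel_measurable (F a')" "bounded (Y ` space M)"
    and ab: "0 \<le> a" "a \<le> b" "0 \<le> a'" "a' \<le> b'"
  shows "has_bochner_integral M (\<lambda>\<omega>. X \<omega> * Y \<omega> * (W b \<omega> - W a \<omega>) $ i * (W b' \<omega> - W a' \<omega>) $ j)
     ((if i = j then max 0 (min b b' - max a a') else 0) * expectation (\<lambda>\<omega>. X \<omega> * Y \<omega>))"
proof (cases "a \<le> a'")
  case True
  then show ?thesis by (intro increment_cross_ordered[OF X Y ab(1,2,4)])
next
  case False
  then have "has_bochner_integral M (\<lambda>\<omega>. Y \<omega> * X \<omega> * (W b' \<omega> - W a' \<omega>) $ j * (W b \<omega> - W a \<omega>) $ i)
     ((if j = i then max 0 (min b' b - max a' a) else 0) * expectation (\<lambda>\<omega>. Y \<omega> * X \<omega>))"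
    by (intro increment_cross_ordered[OF Y X ab(3,4,2)]) simp
  then show ?thesis
    by (cases "i = j") (simp_all add: mult_ac min.commute max.commute)
qed

section \<open>Exponential moments of increments\<close>

lemma increment_exp:
  fixes z :: "real^'d"
  assumes st: "0 \<le> s" "s \<le> t"
  shows "(\<integral>\<^sup>+\<omega>. ennreal (exp (z \<bullet> (W t \<omega> - W s \<omega>))) \<partial>M) = ennreal (exp ((norm z)\<^sup>2 * (t - s) / 2))"
proof (cases "s < t")
  case True
  have pos: "sqrt (t - s) > 0" using True by simp
  let ?X = "\<lambda>i \<omega>. (W t \<omega> - W s \<omega>) $ i"
  have one: "(\<integral>\<^sup>+\<omega>. ennreal (exp (c * ?X i \<omega>)) \<partial>M) = ennreal (exp (c\<^sup>2 * (t - s) / 2))" for c i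
  proof -
    note D = increment_distributed(1)[OF st(1) True, of i]
    have "(\<integral>\<^sup>+\<omega>. ennreal (exp (c * ?X i \<omega>)) \<partial>M)
       = (\<integral>\<^sup>+x. ennreal (normal_density 0 (sqrt (t - s)) x) * ennreal (exp (c * x)) \<partial>lborel)"
      by (rule distributed_nn_integral[OF D, symmetric]) simp
    also have "\<dots> = (\<integral>\<^sup>+x. ennreal (exp (c\<^sup>2 * (t - s) / 2)) * ennreal (normal_density (c * (t - s)) (sqrt (t - s)) x) \<partial>lborel)"
    proof (intro nn_integral_cong)
      fix x
      \<comment> \<open>Completing the square turns the tilted normal density into
        \<open>exp (c\<^sup>2 * (t - s) / 2)\<close> times the normal density with mean
        \<open>c * (t - s)\<close>.\<close>
      have "- ((x - 0)\<^sup>2) / (2 * (t - s)) + c * x = c\<^sup>2 * (t - s) / 2 + - ((x - c * (t - s))\<^sup>2) / (2 * (t - s))"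
        using True by (simp add: field_simps power2_eq_square)
      then have "exp (- ((x - 0)\<^sup>2) / (2 * (t - s))) * exp (c * x) = exp (c\<^sup>2 * (t - s) / 2) * exp (- ((x - c * (t - s))\<^sup>2) / (2 * (t - s)))"
        by (simp only: exp_add[symmetric])
      then show "ennreal (normal_density 0 (sqrt (t - s)) x) * ennreal (exp (c * x))
         = ennreal (exp (c\<^sup>2 * (t - s) / 2)) * ennreal (normal_density (c * (t - s)) (sqrt (t - s)) x)"
        using True by (simp add: normal_density_def ennreal_mult[symmetric])
    qed
    also have "\<dots> = ennreal (exp (c\<^sup>2 * (t - s) / 2)) * (\<integral>\<^sup>+x. ennreal (normal_density (c * (t - s)) (sqrt (t - s)) x) \<partial>lborel)"
      by (rule nn_integral_cmult) simp
    also have "(\<integral>\<^sup>+x. ennreal (normal_density (c * (t - s)) (sqrt (t - s)) x) \<partial>lborel) = 1"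
      using pos by (subst nn_integral_eq_integral) auto
    finally show ?thesis by simp
  qed
  have ind: "indep_vars (\<lambda>_. borel) (\<lambda>i \<omega>. ennreal (exp (z $ i * ?X i \<omega>))) UNIV"
    using indep_vars_compose2[OF increment_distributed(2)[OF st(1) True], of "\<lambda>i x. ennreal (exp (z $ i * x))" "\<lambda>_. borel"]
    by simp
  have "(\<integral>\<^sup>+\<omega>. ennreal (exp (z \<bullet> (W t \<omega> - W s \<omega>))) \<partial>M) = (\<integral>\<^sup>+\<omega>. (\<Prod>i\<in>UNIV. ennreal (exp (z $ i * ?X i \<omega>))) \<partial>M)"
    by (intro nn_integral_cong) (simp add: inner_vec_def exp_sum prod_ennreal)
  also have "\<dots> = (\<Prod>i\<in>UNIV. ennreal (exp ((z $ i)\<^sup>2 * (t - s) / 2)))"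
    using one by (subst indep_vars_nn_integral[OF _ ind]) auto
  also have "\<dots> = ennreal (exp ((norm z)\<^sup>2 * (t - s) / 2))"
  proof -
    have "(\<Sum>i\<in>UNIV. (z $ i)\<^sup>2 * (t - s) / 2) = (norm z)\<^sup>2 * (t - s) / 2"
      by (simp add: power2_norm_eq_inner inner_vec_def power2_eq_square[of "z $ _"]
          sum_distrib_right[symmetric] sum_divide_distrib[symmetric])
    then show ?thesis by (simp add: prod_ennreal exp_sum flip: \<open>_ = (norm z)\<^sup>2 * (t - s) / 2\<close>)
  qed
  finally show ?thesis .
next
  case False
  then show ?thesis using st emeasure_space_1 by simp
qed

text \<open>Given \<open>F s\<close>, the exponent \<open>\<theta>\<close> acts as a constant: the
  joint law of the past and the increment is a product, so the increment is integrated out first,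
  with \<open>Y\<close> and \<open>\<theta>\<close> frozen. Nonnegative integrals avoid
  integrability conditions on \<open>Y\<close>.\<close>

lemma increment_exp_freeze:
  assumes Y: "Y \<in> borel_measurable (F s)" and \<theta>: "\<theta> \<in> borel_measurable (F s)" and st: "0 \<le> s" "s \<le> t"
  shows "(\<integral>\<^sup>+\<omega>. Y \<omega> * ennreal (exp (\<theta> \<omega> \<bullet> (W t \<omega> - W s \<omega>))) \<partial>M)
       = (\<integral>\<^sup>+\<omega>. Y \<omega> * ennreal (exp ((norm (\<theta> \<omega>))\<^sup>2 * (t - s) / 2)) \<partial>M)"
proof (cases "s < t")
  case True
  let ?P = "\<lambda>\<omega>. (Y \<omega>, \<theta> \<omega>)" and ?D = "\<lambda>\<omega>. W t \<omega> - W s \<omega>"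
  let ?B = "borel \<Otimes>\<^sub>M borel :: (ennreal \<times> (real^'d)) measure"
  have Pm: "?P \<in> measurable (F s) ?B" using Y \<theta> by measurable
  have PM[measurable]: "?P \<in> measurable M ?B" using measurable_F_M[OF Pm] .
  have DM[measurable]: "?D \<in> borel_measurable M" using st W_measurable by (intro borel_measurable_diff) auto
  \<comment> \<open>The dummy component gives the increment the same type as the pair
    \<open>?P\<close>.\<close>
  let ?D' = "\<lambda>\<omega>. (0, ?D \<omega>)"
  have vm: "(\<lambda>d. (0, d)) \<in> measurable borel ?B" by measurable
  have D'M[measurable]: "?D' \<in> measurable M ?B" by measurable
  have eq: "distr M ?B ?P \<Otimes>\<^sub>M distr M ?B ?D' = distr M (?B \<Otimes>\<^sub>M ?B) (\<lambda>\<omega>. (?P \<omega>, ?D' \<omega>))"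
    using increment_indep[OF Pm vm st(1) True] indep_var_distribution_eq by blast
  interpret PD: prob_space "distr M ?B ?D'" by (rule prob_space_distr) measurable
  let ?f = "\<lambda>(p, d). fst p * ennreal (exp (snd p \<bullet> snd d))"
  have fm[measurable]: "?f \<in> borel_measurable (?B \<Otimes>\<^sub>M ?B)" by measurable
  have fm'[measurable]: "?f \<in> borel_measurable (distr M ?B ?P \<Otimes>\<^sub>M distr M ?B ?D')"
    using fm unfolding measurable_cong_sets[OF sets_pair_measure_cong[OF sets_distr sets_distr] refl] .
  have "(\<integral>\<^sup>+\<omega>. Y \<omega> * ennreal (exp (\<theta> \<omega> \<bullet> ?D \<omega>)) \<partial>M) = (\<integral>\<^sup>+z. ?f z \<partial>distr M (?B \<Otimes>\<^sub>M ?B) (\<lambda>\<omega>. (?P \<omega>, ?D' \<omega>)))"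
    by (subst nn_integral_distr) auto
  also have "\<dots> = (\<integral>\<^sup>+p. (\<integral>\<^sup>+d. ?f (p, d) \<partial>distr M ?B ?D') \<partial>distr M ?B ?P)"
    unfolding eq[symmetric] by (rule PD.nn_integral_fst[symmetric]) (rule fm')
  also have "\<dots> = (\<integral>\<^sup>+p. fst p * ennreal (exp ((norm (snd p))\<^sup>2 * (t - s) / 2)) \<partial>distr M ?B ?P)"
  proof (intro nn_integral_cong)
    fix p :: "ennreal \<times> (real^'d)"
    have "(\<integral>\<^sup>+d. ?f (p, d) \<partial>distr M ?B ?D') = (\<integral>\<^sup>+\<omega>. fst p * ennreal (exp (snd p \<bullet> ?D \<omega>)) \<partial>M)"
      by (subst nn_integral_distr) auto
    also have "\<dots> = fst p * (\<integral>\<^sup>+\<omega>. ennreal (exp (snd p \<bullet> ?D \<omega>)) \<partial>M)"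
      by (rule nn_integral_cmult) measurable
    also have "\<dots> = fst p * ennreal (exp ((norm (snd p))\<^sup>2 * (t - s) / 2))" by (simp add: increment_exp[OF st])
    finally show "(\<integral>\<^sup>+d. ?f (p, d) \<partial>distr M ?B ?D') = fst p * ennreal (exp ((norm (snd p))\<^sup>2 * (t - s) / 2))" .
  qed
  also have "\<dots> = (\<integral>\<^sup>+\<omega>. Y \<omega> * ennreal (exp ((norm (\<theta> \<omega>))\<^sup>2 * (t - s) / 2)) \<partial>M)"
    by (subst nn_integral_distr) auto
  finally show ?thesis .
next
  case False
  then show ?thesis using st by (simp add: has_bochner_integral_zero)
qed

end

section \<open>Elementary integrals\<close>

context wiener_setup
begin

text \<open>
  Elementary integrals over a finite family of possibly overlapping intervals, so that
  differences of integrals over different partitions need no common refinement.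
\<close>

definition elementary :: "'i set \<Rightarrow> ('i \<Rightarrow> real) \<Rightarrow> ('i \<Rightarrow> real) \<Rightarrow> ('i \<Rightarrow> 'w \<Rightarrow> real^'d^'n) \<Rightarrow> bool" where
  "elementary I a b \<xi> \<longleftrightarrow> finite I \<and> (\<forall>i\<in>I. 0 \<le> a i \<and> a i \<le> b i \<and>
     \<xi> i \<in> borel_measurable (F (a i)) \<and> bounded (\<xi> i ` space M))"

definition elem_integral :: "'i set \<Rightarrow> ('i \<Rightarrow> real) \<Rightarrow> ('i \<Rightarrow> real) \<Rightarrow> ('i \<Rightarrow> 'w \<Rightarrow> real^'d^'n) \<Rightarrow> 'w \<Rightarrow> real^'n" where
  "elem_integral I a b \<xi> \<omega> = (\<Sum>i\<in>I. \<xi> i \<omega> *v (W (b i) \<omega> - W (a i) \<omega>))"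

definition elem_process :: "'i set \<Rightarrow> ('i \<Rightarrow> real) \<Rightarrow> ('i \<Rightarrow> real) \<Rightarrow> ('i \<Rightarrow> 'w \<Rightarrow> real^'d^'n) \<Rightarrow> real \<Rightarrow> 'w \<Rightarrow> real^'d^'n" where
  "elem_process I a b \<xi> s \<omega> = (\<Sum>i\<in>I. indicator {a i<..b i} s *\<^sub>R \<xi> i \<omega>)"

lemma elementaryD:
  assumes "elementary I a b \<xi>"
  shows "finite I" "i \<in> I \<Longrightarrow> 0 \<le> a i" "i \<in> I \<Longrightarrow> a i \<le> b i" "i \<in> I \<Longrightarrow> \<xi> i \<in> borel_measurable (F (a i))"
    "i \<in> I \<Longrightarrow> bounded (\<xi> i ` space M)" "i \<in> I \<Longrightarrow> \<xi> i \<in> borel_measurable M"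
proof -
  show *: "finite I" "i \<in> I \<Longrightarrow> 0 \<le> a i" "i \<in> I \<Longrightarrow> a i \<le> b i" "i \<in> I \<Longrightarrow> \<xi> i \<in> borel_measurable (F (a i))"
    "i \<in> I \<Longrightarrow> bounded (\<xi> i ` space M)"
    using assms by (auto simp: elementary_def)
  show "i \<in> I \<Longrightarrow> \<xi> i \<in> borel_measurable M" using measurable_F_M[OF *(4)] .
qed

lemma elem_integral_measurable_wrt:
  assumes "\<And>i. i \<in> I \<Longrightarrow> \<xi> i \<in> borel_measurable N"
    and "\<And>i. i \<in> I \<Longrightarrow> (\<lambda>\<omega>. W (b i) \<omega> - W (a i) \<omega>) \<in> borel_measurable N"
  shows "elem_integral I a b \<xi> \<in> borel_measurable N"
proof -
  have "continuous_on UNIV (\<lambda>z :: (real^'d^'n) \<times> (real^'d). fst z *v snd z)"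
    by (intro continuous_intros continuous_on_matrix_mult)
  from borel_measurable_continuous_Pair[OF _ _ this] show ?thesis
    unfolding elem_integral_def[abs_def] using assms by (intro borel_measurable_sum) blast
qed

lemma elem_integral_measurable: "elementary I a b \<xi> \<Longrightarrow> elem_integral I a b \<xi> \<in> borel_measurable M"
  by (intro elem_integral_measurable_wrt W_diff_measurable) (auto dest: elementaryD)

lemma elem_integral_measurable_F:
  assumes x: "elementary I a b \<xi>" and c: "\<And>i. i \<in> I \<Longrightarrow> b i \<le> c" shows "elem_integral I a b \<xi> \<in> borel_measurable (F c)"
proof (rule elem_integral_measurable_wrt)
  fix i assume i: "i \<in> I"
  show "\<xi> i \<in> borel_measurable (F c)"
    using elementaryD(3)[OF x i] c[OF i] by (intro measurable_F_mono[OF elementaryD(4)[OF x i]]) auto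
  show "(\<lambda>\<omega>. W (b i) \<omega> - W (a i) \<omega>) \<in> borel_measurable (F c)"
    using elementaryD(2,3)[OF x i] c[OF i] by (intro borel_measurable_diff W_measurable_F) auto
qed

lemma bounded_component_image:
  fixes X :: "'b \<Rightarrow> real^'d^'n"
  assumes "bounded (X ` S)" shows "bounded ((\<lambda>\<omega>. X \<omega> $ n $ e) ` S)"
proof -
  obtain c where c: "\<And>\<omega>. \<omega> \<in> S \<Longrightarrow> norm (X \<omega>) \<le> c" using assms by (auto simp: bounded_iff)
  have "norm (X \<omega> $ n $ e) \<le> c" if "\<omega> \<in> S" for \<omega>
    using c[OF that] Finite_Cartesian_Product.norm_nth_le[of "X \<omega>" n] Finite_Cartesian_Product.norm_nth_le[of "X \<omega> $ n" e] by linarith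
  then show ?thesis by (auto simp: bounded_iff)
qed

text \<open>Two half-open intervals meet in an interval whose length is the overlap that also
  governs the covariance in \<open>increment_cross\<close>; this coincidence is the source of the
  isometry.\<close>

lemma elem_process_inner_integral:
  assumes "elementary I a b \<xi>" "elementary I a b \<zeta>"
  shows "has_bochner_integral lborel (\<lambda>s. elem_process I a b \<xi> s \<omega> \<bullet> elem_process I a b \<zeta> s \<omega>)
    (\<Sum>i\<in>I. \<Sum>j\<in>I. max 0 (min (b i) (b j) - max (a i) (a j)) * (\<xi> i \<omega> \<bullet> \<zeta> j \<omega>))"
proof -
  have eq: "(\<lambda>s. elem_process I a b \<xi> s \<omega> \<bullet> elem_process I a b \<zeta> s \<omega>) =
     (\<lambda>s. \<Sum>i\<in>I. \<Sum>j\<in>I. indicator {max (a i) (a j)<..min (b i) (b j)} s *\<^sub>R (\<xi> i \<omega> \<bullet> \<zeta> j \<omega>))"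
    unfolding elem_process_def inner_sum_left inner_sum_right
    by (subst sum.swap) (auto intro!: ext sum.cong simp: indicator_def)
  have *: "has_bochner_integral lborel (\<lambda>s. indicator {max (a i) (a j)<..min (b i) (b j)} s *\<^sub>R (\<xi> i \<omega> \<bullet> \<zeta> j \<omega>))
     (max 0 (min (b i) (b j) - max (a i) (a j)) * (\<xi> i \<omega> \<bullet> \<zeta> j \<omega>))" for i j
  proof -
    have "measure lborel {max (a i) (a j)<..min (b i) (b j)} = max 0 (min (b i) (b j) - max (a i) (a j))"
      by (cases "max (a i) (a j) \<le> min (b i) (b j)") auto
    moreover have "has_bochner_integral lborel (\<lambda>s. indicator {max (a i) (a j)<..min (b i) (b j)} s *\<^sub>R (\<xi> i \<omega> \<bullet> \<zeta> j \<omega>))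
      (measure lborel {max (a i) (a j)<..min (b i) (b j)} *\<^sub>R (\<xi> i \<omega> \<bullet> \<zeta> j \<omega>))"
      by (intro has_bochner_integral_indicator)
         (cases "max (a i) (a j) \<le> min (b i) (b j)"; auto)+
    ultimately show ?thesis by simp
  qed
  show ?thesis unfolding eq by (intro has_bochner_integral_sum *)
qed

text \<open>Both sides expand into the same sum \<open>?S\<close> over pairs of intervals, weighted
  by their overlap. The bilinear form serves quadratic forms later, where \<open>\<zeta>\<close> is
  a matrix multiple of \<open>\<xi>\<close>.\<close>

lemma elem_isometry:
  assumes x: "elementary I a b \<xi>" and z: "elementary I a b \<zeta>"
  shows "integrable M (\<lambda>\<omega>. elem_integral I a b \<xi> \<omega> \<bullet> elem_integral I a b \<zeta> \<omega>)"
    and "integrable M (\<lambda>\<omega>. LINT s|lborel. elem_process I a b \<xi> s \<omega> \<bullet> elem_process I a b \<zeta> s \<omega>)"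
    and "expectation (\<lambda>\<omega>. elem_integral I a b \<xi> \<omega> \<bullet> elem_integral I a b \<zeta> \<omega>)
       = expectation (\<lambda>\<omega>. LINT s|lborel. elem_process I a b \<xi> s \<omega> \<bullet> elem_process I a b \<zeta> s \<omega>)"
proof -
  let ?len = "\<lambda>i j. max 0 (min (b i) (b j) - max (a i) (a j))"
  let ?D = "\<lambda>i \<omega>. W (b i) \<omega> - W (a i) \<omega>"
  let ?S = "\<Sum>i\<in>I. \<Sum>j\<in>I. \<Sum>n\<in>UNIV. \<Sum>e\<in>UNIV. ?len i j * expectation (\<lambda>\<omega>. \<xi> i \<omega> $ n $ e * \<zeta> j \<omega> $ n $ e)"
  have comp: "(\<lambda>\<omega>. X i \<omega> $ n $ e) \<in> borel_measurable (F (a i))"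
     "bounded ((\<lambda>\<omega>. X i \<omega> $ n $ e) ` space M)" if "elementary I a b X" "i \<in> I" for X i n e
    by (rule borel_measurable_continuous_on[OF _ elementaryD(4)[OF that]], intro continuous_intros)
       (rule bounded_component_image[OF elementaryD(5)[OF that]])
  have eq: "(\<lambda>\<omega>. elem_integral I a b \<xi> \<omega> \<bullet> elem_integral I a b \<zeta> \<omega>) = (\<lambda>\<omega>. \<Sum>i\<in>I. \<Sum>j\<in>I. \<Sum>n\<in>UNIV. \<Sum>e\<in>UNIV. \<Sum>e'\<in>UNIV.
       \<xi> i \<omega> $ n $ e * \<zeta> j \<omega> $ n $ e' * ?D i \<omega> $ e * ?D j \<omega> $ e')"
  proof
    fix \<omega>
    have 1: "elem_integral I a b \<xi> \<omega> \<bullet> elem_integral I a b \<zeta> \<omega> = (\<Sum>i\<in>I. \<Sum>j\<in>I. (\<xi> i \<omega> *v ?D i \<omega>) \<bullet> (\<zeta> j \<omega> *v ?D j \<omega>))"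
      unfolding elem_integral_def inner_sum_left inner_sum_right by (rule sum.swap)
    have 2: "(\<xi> i \<omega> *v ?D i \<omega>) \<bullet> (\<zeta> j \<omega> *v ?D j \<omega>) = (\<Sum>n\<in>UNIV. \<Sum>e\<in>UNIV. \<Sum>e'\<in>UNIV.
       \<xi> i \<omega> $ n $ e * \<zeta> j \<omega> $ n $ e' * ?D i \<omega> $ e * ?D j \<omega> $ e')" for i j
      unfolding inner_vec_def matrix_vector_mult_def by (simp add: sum_product mult_ac)
    show "elem_integral I a b \<xi> \<omega> \<bullet> elem_integral I a b \<zeta> \<omega> = (\<Sum>i\<in>I. \<Sum>j\<in>I. \<Sum>n\<in>UNIV. \<Sum>e\<in>UNIV. \<Sum>e'\<in>UNIV.
       \<xi> i \<omega> $ n $ e * \<zeta> j \<omega> $ n $ e' * ?D i \<omega> $ e * ?D j \<omega> $ e')" unfolding 1 2 ..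
  qed
  have "has_bochner_integral M (\<lambda>\<omega>. elem_integral I a b \<xi> \<omega> \<bullet> elem_integral I a b \<zeta> \<omega>)
    (\<Sum>i\<in>I. \<Sum>j\<in>I. \<Sum>n\<in>UNIV. \<Sum>e\<in>UNIV. \<Sum>e'\<in>UNIV.
       (if e = e' then ?len i j else 0) * expectation (\<lambda>\<omega>. \<xi> i \<omega> $ n $ e * \<zeta> j \<omega> $ n $ e'))"
    unfolding eq
    by (intro has_bochner_integral_sum increment_cross comp x z elementaryD(2,3)[OF x] elementaryD(2,3)[OF z])
  also have "(\<Sum>i\<in>I. \<Sum>j\<in>I. \<Sum>n\<in>UNIV. \<Sum>e\<in>UNIV. \<Sum>e'\<in>UNIV.
       (if e = e' then ?len i j else 0) * expectation (\<lambda>\<omega>. \<xi> i \<omega> $ n $ e * \<zeta> j \<omega> $ n $ e')) = ?S"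
    by (intro sum.cong refl) (simp add: if_distrib[of "\<lambda>u. u * _"] cong: if_cong)
  finally have A: "has_bochner_integral M (\<lambda>\<omega>. elem_integral I a b \<xi> \<omega> \<bullet> elem_integral I a b \<zeta> \<omega>) ?S" .
  have int: "integrable M (\<lambda>\<omega>. \<xi> i \<omega> $ n $ e * \<zeta> j \<omega> $ n $ e)" if "i \<in> I" "j \<in> I" for i j n e
    using comp[OF x that(1)] comp[OF z that(2)]
    by (intro integrable_bounded_mult integrable_bounded measurable_F_M[OF comp(1)] x z that) auto
  have B: "has_bochner_integral M (\<lambda>\<omega>. LINT s|lborel. elem_process I a b \<xi> s \<omega> \<bullet> elem_process I a b \<zeta> s \<omega>) ?S"
  proof -
    have "(\<lambda>\<omega>. LINT s|lborel. elem_process I a b \<xi> s \<omega> \<bullet> elem_process I a b \<zeta> s \<omega>) = (\<lambda>\<omega>. \<Sum>i\<in>I. \<Sum>j\<in>I. \<Sum>n\<in>UNIV. \<Sum>e\<in>UNIV.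
       ?len i j * (\<xi> i \<omega> $ n $ e * \<zeta> j \<omega> $ n $ e))"
      unfolding has_bochner_integral_integral_eq[OF elem_process_inner_integral[OF x z]]
      by (simp add: inner_vec_def sum_distrib_left)
    then show ?thesis
      by (simp only:) (intro has_bochner_integral_sum has_bochner_integral_mult_right has_bochner_integral_integrable int)
  qed
  show "integrable M (\<lambda>\<omega>. elem_integral I a b \<xi> \<omega> \<bullet> elem_integral I a b \<zeta> \<omega>)"
    "integrable M (\<lambda>\<omega>. LINT s|lborel. elem_process I a b \<xi> s \<omega> \<bullet> elem_process I a b \<zeta> s \<omega>)"
    "expectation (\<lambda>\<omega>. elem_integral I a b \<xi> \<omega> \<bullet> elem_integral I a b \<zeta> \<omega>)
       = expectation (\<lambda>\<omega>. LINT s|lborel. elem_process I a b \<xi> s \<omega> \<bullet> elem_process I a b \<zeta> s \<omega>)"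
    using A B by (auto simp: has_bochner_integral_iff)
qed

lemma elem_process_nn_integral:
  assumes "elementary I a b \<xi>"
  shows "(\<integral>\<^sup>+s. ennreal ((norm (elem_process I a b \<xi> s \<omega>))\<^sup>2) \<partial>lborel) =
     ennreal (LINT s|lborel. elem_process I a b \<xi> s \<omega> \<bullet> elem_process I a b \<xi> s \<omega>)"
  using elem_process_inner_integral[OF assms assms, of \<omega>]
  by (subst nn_integral_eq_integral) (auto simp: power2_norm_eq_inner has_bochner_integral_iff)

lemma elem_isometry_nn:
  assumes "elementary I a b \<xi>"
  shows "(\<integral>\<^sup>+\<omega>. ennreal ((norm (elem_integral I a b \<xi> \<omega>))\<^sup>2) \<partial>M)
    = (\<integral>\<^sup>+\<omega>. (\<integral>\<^sup>+s. ennreal ((norm (elem_process I a b \<xi> s \<omega>))\<^sup>2) \<partial>lborel) \<partial>M)"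
proof -
  note i = elem_isometry[OF assms assms]
  have "(\<integral>\<^sup>+\<omega>. ennreal ((norm (elem_integral I a b \<xi> \<omega>))\<^sup>2) \<partial>M) = ennreal (expectation (\<lambda>\<omega>. elem_integral I a b \<xi> \<omega> \<bullet> elem_integral I a b \<xi> \<omega>))"
    using i(1) by (subst nn_integral_eq_integral) (auto simp: power2_norm_eq_inner)
  also have "\<dots> = (\<integral>\<^sup>+\<omega>. ennreal (LINT s|lborel. elem_process I a b \<xi> s \<omega> \<bullet> elem_process I a b \<xi> s \<omega>) \<partial>M)"
    unfolding i(3) using i(2) by (subst nn_integral_eq_integral) auto
  finally show ?thesis using elem_process_nn_integral[OF assms] by simp
qed

lemma matrix_vector_mult_uminus_left: "(- A :: real^'e^'n) *v x = - (A *v x)"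
  by (simp add: matrix_vector_mult_def vec_eq_iff sum_negf)

text \<open>The difference is itself elementary over the disjoint sum of the index sets, with the
  second family negated.\<close>

lemma elem_diff_isometry_nn:
  assumes x: "elementary I a b \<xi>" and z: "elementary J c d \<zeta>"
  shows "(\<integral>\<^sup>+\<omega>. ennreal ((norm (elem_integral I a b \<xi> \<omega> - elem_integral J c d \<zeta> \<omega>))\<^sup>2) \<partial>M)
    = (\<integral>\<^sup>+\<omega>. (\<integral>\<^sup>+s. ennreal ((norm (elem_process I a b \<xi> s \<omega> - elem_process J c d \<zeta> s \<omega>))\<^sup>2) \<partial>lborel) \<partial>M)"
proof -
  let ?a = "case_sum a c" and ?b = "case_sum b d" and ?x = "case_sum \<xi> (\<lambda>j \<omega>. - \<zeta> j \<omega>)"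
  have elementary: "elementary (I <+> J) ?a ?b ?x"
    using elementaryD[OF x] elementaryD[OF z] by (auto simp: elementary_def image_image[symmetric] bounded_uminus intro: elementaryD)
  have "elem_integral (I <+> J) ?a ?b ?x \<omega> = elem_integral I a b \<xi> \<omega> - elem_integral J c d \<zeta> \<omega>" for \<omega>
    using elementaryD(1)[OF x] elementaryD(1)[OF z]
    by (simp add: elem_integral_def sum.Plus sum_negf matrix_vector_mult_uminus_left comp_def)
  moreover have "elem_process (I <+> J) ?a ?b ?x s \<omega> = elem_process I a b \<xi> s \<omega> - elem_process J c d \<zeta> s \<omega>" for s \<omega>
    using elementaryD(1)[OF x] elementaryD(1)[OF z] by (simp only: elem_process_def sum.Plus comp_def sum.case scaleR_minus_right sum_negf add_uminus_conv_diff)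
  ultimately show ?thesis using elem_isometry_nn[OF elementary] by simp
qed

end

section \<open>Simple integrands as elementary integrals\<close>

lemma simple_integrandD:
  assumes "simple_integrand M F k p \<xi>"
  shows "i < k \<Longrightarrow> p i \<le> p (Suc i)" "i \<le> j \<Longrightarrow> j \<le> k \<Longrightarrow> p i \<le> p j" "i \<le> k \<Longrightarrow> 0 \<le> p i"
    "i < k \<Longrightarrow> \<xi> i \<in> borel_measurable (F (p i))" "i < k \<Longrightarrow> bounded (\<xi> i ` space M)"
proof -
  show mono: "i \<le> j \<Longrightarrow> j \<le> k \<Longrightarrow> p i \<le> p j" for i j
  proof (induction j)
    case (Suc j)
    have "p j \<le> p (Suc j)" using assms Suc.prems by (simp add: simple_integrand_def)
    then show ?case using Suc by (cases "i = Suc j") auto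
  qed simp
  show "i \<le> k \<Longrightarrow> 0 \<le> p i" using mono[of 0 i] assms by (simp add: simple_integrand_def)
qed (use assms in \<open>auto simp: simple_integrand_def\<close>)

text \<open>For \<open>s \<le> t\<close> the nearest point of \<open>[s, t]\<close>. Clipping the
  partition points restricts a simple integral to a time window; intervals outside the window
  collapse to a point.\<close>

definition clip :: "real \<Rightarrow> real \<Rightarrow> real \<Rightarrow> real" where "clip s t x = max s (min t x)"

text \<open>At any time at most one interval of the partition is active. The alternative is settled
  before \<open>\<xi>\<close> and \<open>\<omega>\<close> are chosen, so two coefficient families
  over one partition can be compared term by term.\<close>

lemma simple_process_cases:
  assumes "\<And>i j. i \<le> j \<Longrightarrow> j \<le> k \<Longrightarrow> p i \<le> (p j :: real)"
  shows "(\<forall>(\<xi> :: nat \<Rightarrow> 'w \<Rightarrow> real^'d^'n) \<omega>. simple_process k p \<xi> s \<omega> = 0) \<or>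
    (\<exists>i<k. \<forall>(\<xi> :: nat \<Rightarrow> 'w \<Rightarrow> real^'d^'n) \<omega>. simple_process k p \<xi> s \<omega> = \<xi> i \<omega>)"
proof (cases "\<exists>i<k. p i < s \<and> s \<le> p (Suc i)")
  case True
  then obtain i where i: "i < k" "p i < s" "s \<le> p (Suc i)" by blast
  have uniq: "j = i" if "j < k" "p j < s" "s \<le> p (Suc j)" for j
    using assms[of "Suc i" j] assms[of "Suc j" i] i that by (cases i j rule: linorder_cases) auto
  have "indicator {p j<..p (Suc j)} s = (if j = i then 1 else (0::real))" if "j < k" for j
  proof (cases "j = i")
    case False
    then have "s \<notin> {p j<..p (Suc j)}" using uniq[OF that] by auto
    then show ?thesis using False by simp
  qed (use i in simp)
  then have "simple_process k p \<xi> s \<omega> = (\<Sum>j<k. (if j = i then 1 else 0) *\<^sub>R \<xi> j \<omega>)"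
    for \<xi> :: "nat \<Rightarrow> 'w \<Rightarrow> real^'d^'n" and \<omega>
    unfolding simple_process_def by (intro sum.cong) auto
  then show ?thesis using i by (intro disjI2 exI[of _ i]) (simp add: if_distrib[of "\<lambda>u. u *\<^sub>R _"] cong: if_cong)
next
  case False
  have "indicator {p j<..p (Suc j)} s = (0::real)" if "j < k" for j
    using False that by (auto simp: indicator_def)
  then show ?thesis unfolding simple_process_def by (intro disjI1 allI sum.neutral) simp
qed

context wiener_setup
begin

text \<open>Clipping moves a partition point beyond \<open>t\<close> down to \<open>t\<close>, where
  its coefficient need not be measurable yet. Therefore \<open>\<xi>'\<close> sets such coefficients
  to \<open>0\<close>, which is harmless because their intervals have become empty.\<close>

lemma simple_increment:
  assumes G: "simple_integrand M F k p \<xi>" and st: "0 \<le> s" "s \<le> t"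
  defines "a \<equiv> \<lambda>i. clip s t (p i)" and "b \<equiv> \<lambda>i. clip s t (p (Suc i))"
    and "\<xi>' \<equiv> \<lambda>i \<omega>. if p i < t then \<xi> i \<omega> else 0"
  shows "elementary {..<k} a b \<xi>'"
    "simple_integral W k p \<xi> t \<omega> - simple_integral W k p \<xi> s \<omega> = elem_integral {..<k} a b \<xi>' \<omega>"
    "elem_process {..<k} a b \<xi>' u \<omega> = indicator {s<..t} u *\<^sub>R simple_process k p \<xi> u \<omega>"
proof -
  note D = simple_integrandD[OF G]
  show "elementary {..<k} a b \<xi>'"
    unfolding elementary_def
  proof (intro conjI ballI)
    fix i assume "i \<in> {..<k}"
    then have i: "i < k" by simp
    show "0 \<le> a i" "a i \<le> b i" using st D(1)[OF i] by (auto simp: a_def b_def clip_def)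
    show "bounded (\<xi>' i ` space M)" using D(5)[OF i] by (cases "p i < t") (auto simp: \<xi>'_def bounded_iff)
    show "\<xi>' i \<in> borel_measurable (F (a i))"
    proof (cases "p i < t")
      case True
      then have "p i \<le> a i" by (auto simp: a_def clip_def)
      with measurable_F_mono[OF D(4)[OF i] this] True show ?thesis by (simp add: \<xi>'_def)
    qed (simp add: \<xi>'_def)
  qed simp
  have inc: "W (min t x) \<omega> - W (min s x) \<omega> = W (clip s t x) \<omega> - W s \<omega>" for x
    using st by (auto simp: clip_def min_def max_def)
  have "simple_integral W k p \<xi> t \<omega> - simple_integral W k p \<xi> s \<omega>
     = (\<Sum>i<k. \<xi> i \<omega> *v ((W (min t (p (Suc i))) \<omega> - W (min t (p i)) \<omega>) - (W (min s (p (Suc i))) \<omega> - W (min s (p i)) \<omega>)))"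
    unfolding simple_integral_def by (simp add: sum_subtractf matrix_vector_mult_diff_distrib)
  also have "\<dots> = elem_integral {..<k} a b \<xi>' \<omega>"
    unfolding elem_integral_def
  proof (intro sum.cong refl)
    fix i assume "i \<in> {..<k}"
    then have i: "i < k" by simp
    have "(W (min t (p (Suc i))) \<omega> - W (min t (p i)) \<omega>) - (W (min s (p (Suc i))) \<omega> - W (min s (p i)) \<omega>) = W (b i) \<omega> - W (a i) \<omega>"
    proof -
      have "(W (min t (p (Suc i))) \<omega> - W (min t (p i)) \<omega>) - (W (min s (p (Suc i))) \<omega> - W (min s (p i)) \<omega>)
        = (W (min t (p (Suc i))) \<omega> - W (min s (p (Suc i))) \<omega>) - (W (min t (p i)) \<omega> - W (min s (p i)) \<omega>)"
        by simp
      then show ?thesis unfolding inc by (simp add: a_def b_def)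
    qed
    moreover have "b i = a i" if "\<not> p i < t" using that D(1)[OF i] st by (auto simp: a_def b_def clip_def)
    ultimately show "\<xi> i \<omega> *v ((W (min t (p (Suc i))) \<omega> - W (min t (p i)) \<omega>) - (W (min s (p (Suc i))) \<omega> - W (min s (p i)) \<omega>))
      = \<xi>' i \<omega> *v (W (b i) \<omega> - W (a i) \<omega>)"
      by (auto simp: \<xi>'_def)
  qed
  finally show "simple_integral W k p \<xi> t \<omega> - simple_integral W k p \<xi> s \<omega> = elem_integral {..<k} a b \<xi>' \<omega>" .
  show "elem_process {..<k} a b \<xi>' u \<omega> = indicator {s<..t} u *\<^sub>R simple_process k p \<xi> u \<omega>"
    unfolding elem_process_def simple_process_def scaleR_sum_right
  proof (intro sum.cong refl)
    fix i assume "i \<in> {..<k}"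
    then have i: "i < k" by simp
    show "indicator {a i<..b i} u *\<^sub>R \<xi>' i \<omega> = indicator {s<..t} u *\<^sub>R indicator {p i<..p (Suc i)} u *\<^sub>R \<xi> i \<omega>"
      using D(1)[OF i] st by (auto simp: a_def b_def \<xi>'_def clip_def indicator_def min_def max_def split: if_splits)
  qed
qed

lemma simple_integral_zero:
  assumes "simple_integrand M F k p \<xi>" shows "simple_integral W k p \<xi> 0 \<omega> = 0"
proof -
  have *: "min 0 (p i) = 0" if "i \<le> k" for i using simple_integrandD(3)[OF assms that] by simp
  show ?thesis
    unfolding simple_integral_def
  proof (rule sum.neutral, rule ballI)
    fix i assume "i \<in> {..<k}"
    then have i: "i \<le> k" "Suc i \<le> k" by auto
    show "\<xi> i \<omega> *v (W (min 0 (p (Suc i))) \<omega> - W (min 0 (p i)) \<omega>) = 0"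
      unfolding *[OF i(1)] *[OF i(2)] by simp
  qed
qed

end

section \<open>Inequalities for tail and moment bounds\<close>

lemma clip_mono: "x \<le> y \<Longrightarrow> clip s t x \<le> clip s t y"
  by (auto simp: clip_def)

lemma clip_bounds: "s \<le> t \<Longrightarrow> s \<le> clip s t x" "s \<le> t \<Longrightarrow> clip s t x \<le> t"
  by (auto simp: clip_def)

text \<open>Induction on \<open>k\<close>: the last term is kept only if the full sum up to it is at
  most \<open>\<eta>\<close>, and then that sum bounds everything; otherwise the term is
  \<open>0\<close>.\<close>

lemma truncated_sum_le:
  fixes c :: "nat \<Rightarrow> real"
  assumes "\<And>i. 0 \<le> c i" "0 \<le> \<eta>"
  shows "(\<Sum>i<k. if (\<Sum>j\<le>i. c j) \<le> \<eta> then c i else 0) \<le> \<eta>"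
proof (induction k)
  case (Suc k)
  have "(\<Sum>i<k. if (\<Sum>j\<le>i. c j) \<le> \<eta> then c i else 0) \<le> (\<Sum>i<k. c i)"
    using assms by (intro sum_mono) auto
  then show ?case using Suc by (auto simp: lessThan_Suc_atMost[symmetric])
qed (use assms in simp)

text \<open>Testing \<open>v v* A\<close> against itself moves the matrix to the other factor, where
  the bound for \<open>*v\<close> applies.\<close>

lemma norm_vector_matrix_mult_le:
  fixes A :: "real^'d^'n" shows "norm (v v* A) \<le> norm A * norm v"
proof -
  have "norm (v v* A) * norm (v v* A) = v \<bullet> (A *v (v v* A))"
    by (simp add: dot_lmul_matrix[symmetric] power2_norm_eq_inner[symmetric] power2_eq_square)
  also have "\<dots> \<le> norm v * norm (A *v (v v* A))" by (rule norm_cauchy_schwarz)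
  also have "\<dots> \<le> norm v * (norm A * norm (v v* A))"
    by (intro mult_left_mono norm_matrix_vector_mult_le) auto
  finally show ?thesis by (cases "v v* A = 0") (auto simp: mult_ac)
qed

lemma norm_power4_le:
  fixes x :: "real^'n" shows "norm x ^ 4 \<le> real CARD('n) * (\<Sum>i\<in>UNIV. (x $ i) ^ 4)"
proof -
  have "norm x ^ 4 = ((norm x)\<^sup>2)\<^sup>2" by simp
  also have "(norm x)\<^sup>2 = (\<Sum>i\<in>UNIV. (x $ i)\<^sup>2)"
    unfolding power2_norm_eq_inner inner_vec_def by (simp add: power2_eq_square)
  also have "(\<dots>)\<^sup>2 \<le> (\<Sum>i\<in>UNIV. ((x $ i)\<^sup>2)\<^sup>2) * CARD('n)"
    by (rule sum_squared_le_sum_of_squares)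
  finally show ?thesis by (simp add: mult.commute)
qed

text \<open>The term of degree four in the exponential series, with \<open>24 = 4!\<close>; the two
  exponentials cover both signs of \<open>y\<close>.\<close>

lemma power4_le_exp:
  fixes y :: real shows "y ^ 4 \<le> 24 * (exp y + exp (- y))"
proof -
  have *: "y ^ 4 \<le> 24 * exp y" if "0 \<le> y" for y :: real
  proof -
    have "(\<Sum>k<5. y ^ k / fact k) \<le> exp y"
    proof -
      have "(\<Sum>k<5. y ^ k /\<^sub>R fact k) \<le> (\<Sum>k. y ^ k /\<^sub>R fact k)"
        by (rule sum_le_suminf[OF summable_exp_generic]) (use that in auto)
      then show ?thesis by (simp add: exp_def divide_inverse mult.commute)
    qed
    moreover have "y ^ 4 / fact 4 \<le> (\<Sum>k<5. y ^ k / fact k)"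
      by (rule member_le_sum) (use that in auto)
    ultimately show ?thesis by (simp add: fact_numeral)
  qed
  show ?thesis
    using *[of y] *[of "-y"] exp_ge_zero[of y] exp_ge_zero[of "-y"]
    by (cases "0 \<le> y") (auto simp: algebra_simps intro: order_trans)
qed

section \<open>Convergence in probability\<close>

context prob_space
begin

text \<open>Bounded convergence: \<open>Z r\<close> is at most \<open>e\<close> except on an event
  of small probability, where it is at most \<open>B\<close>.\<close>

lemma tendsto_in_prob_nn_integral:
  assumes Z[measurable]: "\<And>r. Z r \<in> borel_measurable M" and B: "\<And>r \<omega>. \<omega> \<in> space M \<Longrightarrow> Z r \<omega> \<le> ennreal B" "B \<ge> 0"
    and lim: "tendsto_in_prob M Z"
  shows "(\<lambda>r. \<integral>\<^sup>+\<omega>. Z r \<omega> \<partial>M) \<longlonglongrightarrow> 0"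
proof -
  have le: "(\<integral>\<^sup>+\<omega>. Z r \<omega> \<partial>M) \<le> ennreal (e + B * measure M {\<omega>\<in>space M. ennreal e < Z r \<omega>})" if "e > 0" for e r
  proof -
    have "(\<integral>\<^sup>+\<omega>. Z r \<omega> \<partial>M) \<le> (\<integral>\<^sup>+\<omega>. ennreal e + ennreal B * indicator {\<omega>\<in>space M. ennreal e < Z r \<omega>} \<omega> \<partial>M)"
      using B by (intro nn_integral_mono) (auto simp: indicator_def not_less intro: add_increasing)
    also have "\<dots> = ennreal e + ennreal B * emeasure M {\<omega>\<in>space M. ennreal e < Z r \<omega>}"
      by (subst nn_integral_add) (auto simp: nn_integral_cmult_indicator emeasure_space_1)
    also have "\<dots> = ennreal (e + B * measure M {\<omega>\<in>space M. ennreal e < Z r \<omega>})"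
      using that B by (simp add: emeasure_eq_measure ennreal_mult ennreal_plus)
    finally show ?thesis .
  qed
  show ?thesis
  proof (rule order_tendstoI)
    fix a :: ennreal assume "0 < a"
    then obtain e' where "0 < e'" "e' < a" using dense by blast
    then have "e' < top" using top.extremum_strict by (metis less_le_trans top_greatest)
    define e where "e = enn2real e'"
    have e: "e > 0" "ennreal e < a" using \<open>0 < e'\<close> \<open>e' < a\<close> \<open>e' < top\<close> by (auto simp: e_def enn2real_positive_iff)
    have "(\<lambda>r. e / 2 + B * measure M {\<omega>\<in>space M. ennreal (e / 2) < Z r \<omega>}) \<longlonglongrightarrow> e / 2 + B * 0"
      using lim e by (intro tendsto_intros) (auto simp: tendsto_in_prob_def)
    then have "\<forall>\<^sub>F r in sequentially. e / 2 + B * measure M {\<omega>\<in>space M. ennreal (e / 2) < Z r \<omega>} < e"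
      by (rule order_tendstoD(2)) (use e in simp)
    then show "\<forall>\<^sub>F r in sequentially. (\<integral>\<^sup>+\<omega>. Z r \<omega> \<partial>M) < a"
    proof eventually_elim
      case (elim r)
      have "(\<integral>\<^sup>+\<omega>. Z r \<omega> \<partial>M) \<le> ennreal (e / 2 + B * measure M {\<omega>\<in>space M. ennreal (e / 2) < Z r \<omega>})"
        using e by (intro le) auto
      also have "\<dots> \<le> ennreal e" using elim by (intro ennreal_leI) auto
      finally show ?case using e by simp
    qed
  qed simp
qed

text \<open>Cutting the norm off at \<open>1\<close> turns convergence in probability into
  convergence of means, which has an almost surely convergent subsequence; below \<open>1\<close>
  the cut-off is invisible.\<close>

lemma tendsto_in_prob_AE_subseq:
  fixes D :: "nat \<Rightarrow> 'a \<Rightarrow> 'b::euclidean_space"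
  assumes D[measurable]: "\<And>r. D r \<in> borel_measurable M"
    and lim: "tendsto_in_prob M (\<lambda>r \<omega>. ennreal (norm (D r \<omega>)))"
  shows "\<exists>q. strict_mono q \<and> (AE \<omega> in M. (\<lambda>r. D (q r) \<omega>) \<longlonglongrightarrow> 0)"
proof -
  let ?u = "\<lambda>r \<omega>. min 1 (norm (D r \<omega>))"
  have "tendsto_in_prob M (\<lambda>r \<omega>. ennreal (?u r \<omega>))"
    unfolding tendsto_in_prob_def
  proof (intro allI impI)
    fix e :: real assume e: "0 < e"
    have le: "measure M {\<omega> \<in> space M. ennreal e < ennreal (?u r \<omega>)} \<le> measure M {\<omega> \<in> space M. ennreal e < ennreal (norm (D r \<omega>))}" for r
      using e by (intro finite_measure_mono) (auto simp: ennreal_less_iff)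
    have lim': "(\<lambda>r. measure M {\<omega> \<in> space M. ennreal e < ennreal (norm (D r \<omega>))}) \<longlonglongrightarrow> 0"
      using lim e unfolding tendsto_in_prob_def by blast
    show "(\<lambda>r. measure M {\<omega> \<in> space M. ennreal e < ennreal (?u r \<omega>)}) \<longlonglongrightarrow> 0"
      by (rule tendsto_sandwich[OF _ _ tendsto_const lim']) (auto simp: le)
  qed
  then have *: "(\<lambda>r. \<integral>\<^sup>+\<omega>. ennreal (?u r \<omega>) \<partial>M) \<longlonglongrightarrow> 0"
    by (intro tendsto_in_prob_nn_integral[where B=1]) (auto intro!: ennreal_leI)
  have int: "integrable M (?u r)" for r
    by (rule integrable_const_bound[where B=1]) auto
  have "(\<lambda>r. ennreal (\<integral>\<omega>. norm (?u r \<omega>) \<partial>M)) \<longlonglongrightarrow> ennreal 0"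
    using * int by (subst (asm) nn_integral_eq_integral) auto
  then have "(\<lambda>r. \<integral>\<omega>. norm (?u r \<omega>) \<partial>M) \<longlonglongrightarrow> 0"
    by (subst (asm) tendsto_ennreal_iff) auto
  from tendsto_L1_AE_subseq[OF int this] obtain q where q: "strict_mono q" "AE \<omega> in M. (\<lambda>r. ?u (q r) \<omega>) \<longlonglongrightarrow> 0"
    by auto
  from q(2) have "AE \<omega> in M. (\<lambda>r. D (q r) \<omega>) \<longlonglongrightarrow> 0"
  proof eventually_elim
    case (elim \<omega>)
    then have "\<forall>\<^sub>F r in sequentially. ?u (q r) \<omega> < 1" by (rule order_tendstoD) simp
    then have "\<forall>\<^sub>F r in sequentially. ?u (q r) \<omega> = norm (D (q r) \<omega>)" by eventually_elim auto
    from Lim_transform_eventually[OF elim this] show ?case by (simp add: tendsto_norm_zero_iff)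
  qed
  with q(1) show ?thesis by blast
qed

text \<open>Chebyshev's inequality, with the second moment as a nonnegative integral because the
  isometry delivers it in that form.\<close>

lemma norm_tail_le_second_moment:
  fixes X :: "'a \<Rightarrow> 'b::euclidean_space"
  assumes X[measurable]: "X \<in> borel_measurable M" and m: "(\<integral>\<^sup>+\<omega>. ennreal ((norm (X \<omega>))\<^sup>2) \<partial>M) \<le> ennreal \<eta>"
    and pos: "\<delta> > 0" "\<eta> \<ge> 0"
  shows "measure M {\<omega>\<in>space M. \<delta> < norm (X \<omega>)} \<le> \<eta> / \<delta>\<^sup>2"
proof -
  have "ennreal (\<delta>\<^sup>2) * emeasure M {\<omega>\<in>space M. \<delta> < norm (X \<omega>)} = (\<integral>\<^sup>+\<omega>. ennreal (\<delta>\<^sup>2) * indicator {\<omega>\<in>space M. \<delta> < norm (X \<omega>)} \<omega> \<partial>M)"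
    by (subst nn_integral_cmult_indicator) auto
  also have "\<dots> \<le> (\<integral>\<^sup>+\<omega>. ennreal ((norm (X \<omega>))\<^sup>2) \<partial>M)"
    using pos by (intro nn_integral_mono) (auto simp: indicator_def intro!: ennreal_leI power_mono)
  also note m
  finally have "ennreal (\<delta>\<^sup>2 * measure M {\<omega>\<in>space M. \<delta> < norm (X \<omega>)}) \<le> ennreal \<eta>"
    by (simp add: emeasure_eq_measure ennreal_mult)
  then have "\<delta>\<^sup>2 * measure M {\<omega>\<in>space M. \<delta> < norm (X \<omega>)} \<le> \<eta>"
    using pos(2) by (simp only: ennreal_le_iff)
  then show ?thesis using pos(1) by (simp only: pos_le_divide_eq zero_less_power mult.commute)
qed

end

section \<open>Integrals over disjoint intervals: tails and fourth moments\<close>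

context wiener_setup
begin

lemma elem_process_disjoint_integral:
  fixes k :: nat
  assumes x: "elementary {..<k} a b \<xi>" and dis: "\<And>i j. i < j \<Longrightarrow> j < k \<Longrightarrow> b i \<le> a j"
  shows "(LINT s|lborel. elem_process {..<k} a b \<xi> s \<omega> \<bullet> elem_process {..<k} a b \<xi> s \<omega>) = (\<Sum>i<k. (norm (\<xi> i \<omega>))\<^sup>2 * (b i - a i))"
proof -
  have "max 0 (min (b i) (b j) - max (a i) (a j)) = (if i = j then b i - a i else 0)" if "i < k" "j < k" for i j
    using dis[of i j] dis[of j i] elementaryD(3)[OF x, of i] that by (cases i j rule: linorder_cases) auto
  then have "(\<Sum>i<k. \<Sum>j<k. max 0 (min (b i) (b j) - max (a i) (a j)) * (\<xi> i \<omega> \<bullet> \<xi> j \<omega>))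
    = (\<Sum>i<k. \<Sum>j<k. (if i = j then b i - a i else 0) * (\<xi> i \<omega> \<bullet> \<xi> j \<omega>))"
    by (intro sum.cong refl) auto
  also have "\<dots> = (\<Sum>i<k. (norm (\<xi> i \<omega>))\<^sup>2 * (b i - a i))"
    by (intro sum.cong refl) (simp add: if_distrib[of "\<lambda>u. u * _"] power2_norm_eq_inner cong: if_cong)
  finally show ?thesis
    unfolding has_bochner_integral_integral_eq[OF elem_process_inner_integral[OF x x]] .
qed

text \<open>
  The coefficients are set to \<open>0\<close> from the first index on at which the energy exceeds \<open>\<eta>\<close>; this
  keeps them adapted, and the isometry bounds the second moment of the new integral by \<open>\<eta>\<close>.
\<close>

lemma elem_tail:
  fixes k :: nat
  assumes x: "elementary {..<k} a b \<xi>" and dis: "\<And>i j. i < j \<Longrightarrow> j < k \<Longrightarrow> b i \<le> a j" and pos: "\<delta> > 0" "\<eta> \<ge> 0"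
  shows "measure M {\<omega>\<in>space M. \<delta> < norm (elem_integral {..<k} a b \<xi> \<omega>)}
     \<le> measure M {\<omega>\<in>space M. ennreal \<eta> < (\<integral>\<^sup>+s. ennreal ((norm (elem_process {..<k} a b \<xi> s \<omega>))\<^sup>2) \<partial>lborel)} + \<eta> / \<delta>\<^sup>2"
proof -
  define c where "c i \<omega> = (if i < k then (norm (\<xi> i \<omega>))\<^sup>2 * (b i - a i) else 0)" for i \<omega>
  have c0: "0 \<le> c i \<omega>" for i \<omega> using elementaryD(3)[OF x, of i] by (auto simp: c_def)
  have cm: "c j \<in> borel_measurable (F (a i))" if "j \<le> i" "i < k" for i j
  proof -
    have "a j \<le> a i" using dis[of j i] elementaryD(3)[OF x, of j] that by (cases "j = i") force+
    then have "\<xi> j \<in> borel_measurable (F (a i))" using that by (intro measurable_F_mono[OF elementaryD(4)[OF x, of j]]) auto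
    then show ?thesis using that unfolding c_def[abs_def] by simp
  qed
  \<comment> \<open>The energy test includes the \<open>i\<close>-th interval itself. It is still
    decided at time \<open>a i\<close>, when \<open>\<xi> i\<close> is known, and it guarantees that
    the kept energy never exceeds \<open>\<eta>\<close>.\<close>
  define \<zeta> where "\<zeta> i \<omega> = (if (\<Sum>j\<le>i. c j \<omega>) \<le> \<eta> then \<xi> i \<omega> else 0)" for i \<omega>
  have z: "elementary {..<k} a b \<zeta>"
    unfolding elementary_def
  proof (intro conjI ballI)
    fix i assume "i \<in> {..<k}"
    then have i: "i < k" "i \<in> {..<k}" by auto
    show "0 \<le> a i" "a i \<le> b i" using elementaryD(2,3)[OF x i(2)] by auto
    have "(\<lambda>\<omega>. \<Sum>j\<le>i. c j \<omega>) \<in> borel_measurable (F (a i))"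
      using cm i by (intro borel_measurable_sum) auto
    then have "{\<omega> \<in> space (F (a i)). (\<Sum>j\<le>i. c j \<omega>) \<le> \<eta>} \<in> sets (F (a i))" by (intro borel_measurable_le) auto
    then show "\<zeta> i \<in> borel_measurable (F (a i))"
      unfolding \<zeta>_def[abs_def] using elementaryD(4)[OF x i(2)] by (intro measurable_If) auto
    obtain C where "\<forall>y\<in>\<xi> i ` space M. norm y \<le> C" using elementaryD(5)[OF x i(2)] by (auto simp: bounded_iff)
    then show "bounded (\<zeta> i ` space M)" unfolding bounded_iff
      by (intro exI[of _ "max C 0"]) (auto simp: \<zeta>_def)
  qed simp
  have E\<zeta>: "(\<integral>\<^sup>+\<omega>. ennreal ((norm (elem_integral {..<k} a b \<zeta> \<omega>))\<^sup>2) \<partial>M) \<le> ennreal \<eta>"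
  proof -
    have "(\<Sum>i<k. (norm (\<zeta> i \<omega>))\<^sup>2 * (b i - a i)) \<le> \<eta>" for \<omega>
    proof -
      have "(\<Sum>i<k. (norm (\<zeta> i \<omega>))\<^sup>2 * (b i - a i)) = (\<Sum>i<k. if (\<Sum>j\<le>i. c j \<omega>) \<le> \<eta> then c i \<omega> else 0)"
        by (intro sum.cong) (auto simp: \<zeta>_def c_def)
      also have "\<dots> \<le> \<eta>" by (rule truncated_sum_le) (use c0 pos in auto)
      finally show ?thesis .
    qed
    then have "(\<integral>\<^sup>+\<omega>. (\<integral>\<^sup>+s. ennreal ((norm (elem_process {..<k} a b \<zeta> s \<omega>))\<^sup>2) \<partial>lborel) \<partial>M) \<le> (\<integral>\<^sup>+\<omega>. ennreal \<eta> \<partial>M)"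
      by (intro nn_integral_mono) (simp add: elem_process_nn_integral[OF z] elem_process_disjoint_integral[OF z dis] ennreal_leI)
    then show ?thesis by (simp add: elem_isometry_nn[OF z] emeasure_space_1)
  qed
  have meas: "(\<lambda>\<omega>. \<integral>\<^sup>+s. ennreal ((norm (elem_process {..<k} a b \<xi> s \<omega>))\<^sup>2) \<partial>lborel) \<in> borel_measurable M"
    unfolding elem_process_nn_integral[OF x] using elem_isometry(2)[OF x x] by measurable
  \<comment> \<open>On paths with total energy at most \<open>\<eta>\<close> no coefficient is cut,
    so the two integrals agree; all other paths are charged to the first probability.\<close>
  have same: "elem_integral {..<k} a b \<xi> \<omega> = elem_integral {..<k} a b \<zeta> \<omega>"
    if "(\<integral>\<^sup>+s. ennreal ((norm (elem_process {..<k} a b \<xi> s \<omega>))\<^sup>2) \<partial>lborel) \<le> ennreal \<eta>" for \<omega>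
  proof -
    have "(\<Sum>i<k. (norm (\<xi> i \<omega>))\<^sup>2 * (b i - a i)) \<le> \<eta>"
      using that pos elem_process_disjoint_integral[OF x dis] by (simp add: elem_process_nn_integral[OF x])
    then have tot: "(\<Sum>i<k. c i \<omega>) \<le> \<eta>" by (simp add: c_def)
    have "(\<Sum>j\<le>i. c j \<omega>) \<le> \<eta>" if "i < k" for i
      using that c0 by (intro order_trans[OF sum_mono2 tot]) auto
    then have "\<zeta> i \<omega> = \<xi> i \<omega>" if "i < k" for i using that by (simp add: \<zeta>_def)
    then show ?thesis unfolding elem_integral_def by (intro sum.cong) auto
  qed
  note ez = elem_integral_measurable[OF z]
  have "{\<omega>\<in>space M. \<delta> < norm (elem_integral {..<k} a b \<xi> \<omega>)} \<subseteq>
      {\<omega>\<in>space M. ennreal \<eta> < (\<integral>\<^sup>+s. ennreal ((norm (elem_process {..<k} a b \<xi> s \<omega>))\<^sup>2) \<partial>lborel)}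
      \<union> {\<omega>\<in>space M. \<delta> < norm (elem_integral {..<k} a b \<zeta> \<omega>)}" (is "_ \<subseteq> ?A \<union> ?B")
    by (rule subsetI) (use same in \<open>metis (mono_tags, lifting) UnCI mem_Collect_eq not_less\<close>)
  moreover have sets: "?A \<in> sets M" "?B \<in> sets M"
    using meas measurable_compose[OF ez borel_measurable_norm] by (intro borel_measurable_less; simp)+
  ultimately have "measure M {\<omega>\<in>space M. \<delta> < norm (elem_integral {..<k} a b \<xi> \<omega>)} \<le> measure M (?A \<union> ?B)"
    by (intro finite_measure_mono) auto
  also have "\<dots> \<le> measure M ?A + measure M ?B"
    using sets by (intro measure_Un_le)
  also have "measure M ?B \<le> \<eta> / \<delta>\<^sup>2"
    by (rule norm_tail_le_second_moment[OF ez E\<zeta> pos])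
  finally show ?thesis by simp
qed

text \<open>The last interval is split off: given \<open>F (a m)\<close>, its contribution is
  Gaussian and produces the exponential of half a conditional variance, for which \<open>C\<close>
  gives a deterministic bound. That factor leaves the integral, and the lengths add up in the
  exponent.\<close>

lemma elem_exp_moment:
  fixes v :: "real^'n" and k :: nat
  assumes x: "elementary {..<k} a b \<xi>" and dis: "\<And>i j. i < j \<Longrightarrow> j < k \<Longrightarrow> b i \<le> a j"
    and C: "\<And>i \<omega>. i < k \<Longrightarrow> \<omega> \<in> space M \<Longrightarrow> norm (\<xi> i \<omega>) \<le> C" and m: "m \<le> k"
  shows "(\<integral>\<^sup>+\<omega>. ennreal (exp (v \<bullet> elem_integral {..<m} a b \<xi> \<omega>)) \<partial>M) \<le> ennreal (exp ((C * norm v)\<^sup>2 / 2 * (\<Sum>i<m. b i - a i)))"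
  using m
proof (induction m)
  case 0
  then show ?case by (simp add: elem_integral_def emeasure_space_1)
next
  case (Suc m)
  have mk: "m < k" "m \<in> {..<k}" using Suc.prems by auto
  have sub: "elementary {..<m} a b \<xi>" using x mk by (auto simp: elementary_def)
  let ?D = "\<lambda>\<omega>. W (b m) \<omega> - W (a m) \<omega>"
  have E: "elem_integral {..<m} a b \<xi> \<in> borel_measurable (F (a m))"
    by (rule elem_integral_measurable_F[OF sub]) (use dis mk in auto)
  have "(\<integral>\<^sup>+\<omega>. ennreal (exp (v \<bullet> elem_integral {..<Suc m} a b \<xi> \<omega>)) \<partial>M)
     = (\<integral>\<^sup>+\<omega>. ennreal (exp (v \<bullet> elem_integral {..<m} a b \<xi> \<omega>)) * ennreal (exp ((v v* \<xi> m \<omega>) \<bullet> ?D \<omega>)) \<partial>M)"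
    by (intro nn_integral_cong) (simp add: elem_integral_def inner_add_right exp_add ennreal_mult dot_lmul_matrix)
  also have "\<dots> = (\<integral>\<^sup>+\<omega>. ennreal (exp (v \<bullet> elem_integral {..<m} a b \<xi> \<omega>)) * ennreal (exp ((norm (v v* \<xi> m \<omega>))\<^sup>2 * (b m - a m) / 2)) \<partial>M)"
  proof (rule increment_exp_freeze)
    show "(\<lambda>\<omega>. ennreal (exp (v \<bullet> elem_integral {..<m} a b \<xi> \<omega>))) \<in> borel_measurable (F (a m))" using E by measurable
    have "continuous_on UNIV (\<lambda>A :: real^'d^'n. v v* A)"
      by (intro continuous_intros continuous_on_matrix_mult)
    from borel_measurable_continuous_on[OF this elementaryD(4)[OF x mk(2)]]
    show "(\<lambda>\<omega>. v v* \<xi> m \<omega>) \<in> borel_measurable (F (a m))" .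
  qed (use elementaryD(2,3)[OF x mk(2)] in auto)
  also have "\<dots> \<le> (\<integral>\<^sup>+\<omega>. ennreal (exp (v \<bullet> elem_integral {..<m} a b \<xi> \<omega>)) * ennreal (exp ((C * norm v)\<^sup>2 / 2 * (b m - a m))) \<partial>M)"
  proof (intro nn_integral_mono mult_left_mono ennreal_leI)
    fix \<omega> assume w: "\<omega> \<in> space M"
    have "norm (v v* \<xi> m \<omega>) \<le> C * norm v"
      using norm_vector_matrix_mult_le[of v "\<xi> m \<omega>"] mult_right_mono[OF C[OF mk(1) w], of "norm v"] by auto
    then have "(norm (v v* \<xi> m \<omega>))\<^sup>2 * (b m - a m) \<le> (C * norm v)\<^sup>2 * (b m - a m)"
      using elementaryD(3)[OF x mk(2)] by (intro mult_right_mono power_mono) auto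
    then show "exp ((norm (v v* \<xi> m \<omega>))\<^sup>2 * (b m - a m) / 2) \<le> exp ((C * norm v)\<^sup>2 / 2 * (b m - a m))" by simp
  qed simp
  also have "\<dots> = (\<integral>\<^sup>+\<omega>. ennreal (exp (v \<bullet> elem_integral {..<m} a b \<xi> \<omega>)) \<partial>M) * ennreal (exp ((C * norm v)\<^sup>2 / 2 * (b m - a m)))"
    by (rule nn_integral_multc) (use measurable_F_M[OF E] in measurable)
  also have "\<dots> \<le> ennreal (exp ((C * norm v)\<^sup>2 / 2 * (\<Sum>i<m. b i - a i))) * ennreal (exp ((C * norm v)\<^sup>2 / 2 * (b m - a m)))"
    using Suc by (intro mult_right_mono) auto
  also have "\<dots> = ennreal (exp ((C * norm v)\<^sup>2 / 2 * (\<Sum>i<Suc m. b i - a i)))"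
    by (simp add: ennreal_mult[symmetric] exp_add[symmetric] distrib_left)
  finally show ?case .
qed

text \<open>Coordinates are rescaled by \<open>r = sqrt \<delta>\<close>. At that scale the
  exponential moments are at most \<open>exp (C\<^sup>2 / 2)\<close>, independently of
  \<open>\<delta>\<close>, and undoing the scale in the fourth power yields
  \<open>\<delta>\<^sup>2\<close>. The factor \<open>48\<close> is twice the \<open>24\<close> of
  \<open>power4_le_exp\<close>; one factor \<open>CARD('n)\<close> comes from
  \<open>norm_power4_le\<close>, the other from summing over the coordinates.\<close>

lemma elem_fourth_moment:
  fixes \<xi> :: "nat \<Rightarrow> 'w \<Rightarrow> real^'d^'n"
  assumes x: "elementary {..<k} a b \<xi>" and dis: "\<And>i j. i < j \<Longrightarrow> j < k \<Longrightarrow> b i \<le> a j"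
    and C: "\<And>i \<omega>. i < k \<Longrightarrow> \<omega> \<in> space M \<Longrightarrow> norm (\<xi> i \<omega>) \<le> C"
    and len: "(\<Sum>i<k. b i - a i) \<le> \<delta>" and \<delta>: "\<delta> > 0"
  shows "(\<integral>\<^sup>+\<omega>. ennreal (norm (elem_integral {..<k} a b \<xi> \<omega>) ^ 4) \<partial>M) \<le> ennreal (48 * (real CARD('n))\<^sup>2 * exp (C\<^sup>2 / 2) * \<delta>\<^sup>2)"
proof -
  let ?E = "elem_integral {..<k} a b \<xi>"
  have [measurable]: "?E \<in> borel_measurable M" by (rule elem_integral_measurable[OF x])
  define r where "r = sqrt \<delta>"
  have r: "r > 0" "r\<^sup>2 = \<delta>" using \<delta> by (auto simp: r_def)
  have exp: "(\<integral>\<^sup>+\<omega>. ennreal (exp (v \<bullet> ?E \<omega>)) \<partial>M) \<le> ennreal (exp (C\<^sup>2 / 2))" if "norm v = 1 / r" for v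
  proof -
    have "(C * norm v)\<^sup>2 / 2 * (\<Sum>i<k. b i - a i) \<le> (C * norm v)\<^sup>2 / 2 * \<delta>" by (intro mult_left_mono len) auto
    also have "\<dots> = C\<^sup>2 / 2" using r \<delta> by (simp add: that power_mult_distrib power_divide)
    finally have "exp ((C * norm v)\<^sup>2 / 2 * (\<Sum>i<k. b i - a i)) \<le> exp (C\<^sup>2 / 2)" by simp
    then show ?thesis using elem_exp_moment[OF x dis C order_refl, of v] by (meson ennreal_leI order_trans)
  qed
  have comp: "(\<integral>\<^sup>+\<omega>. ennreal ((?E \<omega> $ n) ^ 4) \<partial>M) \<le> ennreal (48 * exp (C\<^sup>2 / 2) * \<delta>\<^sup>2)" for n
  proof -
    have bd: "(?E \<omega> $ n) ^ 4 \<le> 24 * \<delta>\<^sup>2 * (exp (((1 / r) *\<^sub>R axis n 1) \<bullet> ?E \<omega>) + exp ((- ((1 / r) *\<^sub>R axis n 1)) \<bullet> ?E \<omega>))" for \<omega>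
    proof -
      have "(?E \<omega> $ n) ^ 4 = \<delta>\<^sup>2 * (?E \<omega> $ n / r) ^ 4"
        using r by (simp add: r(2)[symmetric] power_divide power_mult[symmetric])
      also have "\<dots> \<le> \<delta>\<^sup>2 * (24 * (exp (?E \<omega> $ n / r) + exp (- (?E \<omega> $ n / r))))"
        by (intro mult_left_mono power4_le_exp) auto
      finally show ?thesis by (simp add: cart_eq_inner_axis inner_commute mult_ac)
    qed
    have "(\<integral>\<^sup>+\<omega>. ennreal ((?E \<omega> $ n) ^ 4) \<partial>M)
      \<le> (\<integral>\<^sup>+\<omega>. ennreal (24 * \<delta>\<^sup>2) * (ennreal (exp (((1 / r) *\<^sub>R axis n 1) \<bullet> ?E \<omega>)) + ennreal (exp ((- ((1 / r) *\<^sub>R axis n 1)) \<bullet> ?E \<omega>))) \<partial>M)"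
      using bd by (intro nn_integral_mono) (simp add: ennreal_mult[symmetric] ennreal_plus[symmetric] ennreal_leI del: ennreal_plus)
    also have "\<dots> = ennreal (24 * \<delta>\<^sup>2) * ((\<integral>\<^sup>+\<omega>. ennreal (exp (((1 / r) *\<^sub>R axis n 1) \<bullet> ?E \<omega>)) \<partial>M) + (\<integral>\<^sup>+\<omega>. ennreal (exp ((- ((1 / r) *\<^sub>R axis n 1)) \<bullet> ?E \<omega>)) \<partial>M))"
      by (simp add: nn_integral_cmult nn_integral_add)
    also have "\<dots> \<le> ennreal (24 * \<delta>\<^sup>2) * (ennreal (exp (C\<^sup>2 / 2)) + ennreal (exp (C\<^sup>2 / 2)))"
      using r by (intro mult_left_mono add_mono exp) (auto simp: norm_axis_1)
    also have "\<dots> = ennreal (48 * exp (C\<^sup>2 / 2) * \<delta>\<^sup>2)"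
      by (simp add: ennreal_mult[symmetric] ennreal_plus[symmetric] mult_ac del: ennreal_plus)
    finally show ?thesis .
  qed
  have Em: "(\<lambda>\<omega>. ennreal ((?E \<omega> $ n) ^ 4)) \<in> borel_measurable M" for n
    using measurable_compose[OF elem_integral_measurable[OF x] borel_measurable_nth] by (intro measurable_compose[OF _ measurable_ennreal] borel_measurable_power)
  have "(\<integral>\<^sup>+\<omega>. ennreal (norm (?E \<omega>) ^ 4) \<partial>M) \<le> (\<integral>\<^sup>+\<omega>. ennreal (real CARD('n)) * (\<Sum>n\<in>UNIV. ennreal ((?E \<omega> $ n) ^ 4)) \<partial>M)"
    using norm_power4_le by (intro nn_integral_mono) (simp add: sum_ennreal ennreal_mult[symmetric] sum_nonneg ennreal_leI)
  also have "\<dots> = ennreal (real CARD('n)) * (\<Sum>n\<in>UNIV. \<integral>\<^sup>+\<omega>. ennreal ((?E \<omega> $ n) ^ 4) \<partial>M)"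
    by (simp add: nn_integral_cmult[OF borel_measurable_sum[OF Em]] nn_integral_sum[OF Em] del: sum_ennreal)
  also have "\<dots> \<le> ennreal (real CARD('n)) * (\<Sum>n\<in>(UNIV :: 'n set). ennreal (48 * exp (C\<^sup>2 / 2) * \<delta>\<^sup>2))"
    by (intro mult_left_mono sum_mono comp) auto
  also have "\<dots> = ennreal (48 * (real CARD('n))\<^sup>2 * exp (C\<^sup>2 / 2) * \<delta>\<^sup>2)"
    using \<delta> by (simp add: ennreal_of_nat_eq_real_of_nat ennreal_mult[symmetric] power2_eq_square mult_ac)
  finally show ?thesis .
qed

end

section \<open>Ito integrals of bounded integrands\<close>

text \<open>Squared distance in \<open>L\<^sup>2\<close> over time along one path. Time
  \<open>0\<close> is left out, as in the intervals of a simple integrand.\<close>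

definition sqdist :: "real \<Rightarrow> (real \<Rightarrow> 'w \<Rightarrow> real^'d^'n) \<Rightarrow> (real \<Rightarrow> 'w \<Rightarrow> real^'d^'n) \<Rightarrow> 'w \<Rightarrow> ennreal" where
  "sqdist t G H \<omega> = (\<integral>\<^sup>+u. ennreal ((norm (G u \<omega> - H u \<omega>))\<^sup>2) * indicator {0<..t} u \<partial>lborel)"

text \<open>The path comes before the time in the product, so that integrating out time is an
  integral over the second factor and leaves a random variable.\<close>

abbreviation jointly_measurable :: "'w measure \<Rightarrow> (real \<Rightarrow> 'w \<Rightarrow> 'b::topological_space) \<Rightarrow> bool" where
  "jointly_measurable M G \<equiv> (\<lambda>z. G (snd z) (fst z)) \<in> borel_measurable (M \<Otimes>\<^sub>M lborel)"

lemma jointly_measurable_section: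
  assumes "jointly_measurable M G" "\<omega> \<in> space M"
  shows "(\<lambda>u. G u \<omega>) \<in> borel_measurable lborel"
  using measurable_compose[OF measurable_Pair1'[OF assms(2)] assms(1)] by simp

lemma sqdist_measurable:
  assumes "jointly_measurable M G" "jointly_measurable M H"
  shows "sqdist t G H \<in> borel_measurable M"
proof -
  have "(\<lambda>z. ennreal ((norm (G (snd z) (fst z) - H (snd z) (fst z)))\<^sup>2) * indicator {0<..t} (snd z)) \<in> borel_measurable (M \<Otimes>\<^sub>M lborel)"
    using assms by measurable
  from lborel.borel_measurable_nn_integral_fst[OF this] show ?thesis
    unfolding sqdist_def[abs_def] by simp
qed

lemma sum_squares_le: "(norm (x - z :: 'a::real_normed_vector))\<^sup>2 \<le> 2 * (norm (x - y))\<^sup>2 + 2 * (norm (y - z))\<^sup>2"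
proof -
  have "(norm (x - z))\<^sup>2 \<le> (norm (x - y) + norm (y - z))\<^sup>2"
    using norm_triangle_ineq[of "x - y" "y - z"] by (intro power_mono) auto
  also have "\<dots> \<le> 2 * (norm (x - y))\<^sup>2 + 2 * (norm (y - z))\<^sup>2"
    using sum_squares_bound[of "norm (x - y)" "norm (y - z)"] by (simp add: power2_sum)
  finally show ?thesis .
qed

lemma sqdist_triangle:
  assumes "jointly_measurable M G" "jointly_measurable M H" "jointly_measurable M K" "\<omega> \<in> space M"
  shows "sqdist t G K \<omega> \<le> 2 * sqdist t G H \<omega> + 2 * sqdist t H K \<omega>"
proof -
  note [measurable] = jointly_measurable_section[OF assms(1,4)] jointly_measurable_section[OF assms(2,4)]
    jointly_measurable_section[OF assms(3,4)]
  let ?i = "\<lambda>u. indicator {0<..t} u :: ennreal"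
  have "sqdist t G K \<omega> \<le> (\<integral>\<^sup>+u. 2 * (ennreal ((norm (G u \<omega> - H u \<omega>))\<^sup>2) * ?i u) + 2 * (ennreal ((norm (H u \<omega> - K u \<omega>))\<^sup>2) * ?i u) \<partial>lborel)"
    unfolding sqdist_def
  proof (intro nn_integral_mono)
    fix u
    have "ennreal ((norm (G u \<omega> - K u \<omega>))\<^sup>2) \<le> ennreal (2 * (norm (G u \<omega> - H u \<omega>))\<^sup>2 + 2 * (norm (H u \<omega> - K u \<omega>))\<^sup>2)"
      by (intro ennreal_leI sum_squares_le)
    also have "\<dots> = 2 * ennreal ((norm (G u \<omega> - H u \<omega>))\<^sup>2) + 2 * ennreal ((norm (H u \<omega> - K u \<omega>))\<^sup>2)"
      by (simp add: ennreal_plus ennreal_mult)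
    finally show "ennreal ((norm (G u \<omega> - K u \<omega>))\<^sup>2) * ?i u \<le> 2 * (ennreal ((norm (G u \<omega> - H u \<omega>))\<^sup>2) * ?i u) + 2 * (ennreal ((norm (H u \<omega> - K u \<omega>))\<^sup>2) * ?i u)"
      by (simp split: split_indicator)
  qed
  also have "\<dots> = 2 * sqdist t G H \<omega> + 2 * sqdist t H K \<omega>"
    unfolding sqdist_def by (subst nn_integral_add, measurable) (subst nn_integral_cmult, measurable)+
  finally show ?thesis .
qed

lemma sqdist_mono_time: "s \<le> t \<Longrightarrow> sqdist s G H \<omega> \<le> sqdist t G H \<omega>"
  unfolding sqdist_def by (intro nn_integral_mono) (auto split: split_indicator)

lemma sqdist_bound:
  fixes G H :: "real \<Rightarrow> 'w \<Rightarrow> real^'d^'n"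
  assumes "\<And>u. norm (G u \<omega>) \<le> C" "\<And>u. norm (H u \<omega>) \<le> C" "0 \<le> t"
  shows "sqdist t G H \<omega> \<le> ennreal ((2 * C)\<^sup>2 * t)"
proof -
  have "norm (G u \<omega> - H u \<omega>) \<le> 2 * C" for u
    using norm_triangle_ineq4[of "G u \<omega>" "H u \<omega>"] assms(1,2)[of u] by linarith
  then have "sqdist t G H \<omega> \<le> (\<integral>\<^sup>+u. ennreal ((2 * C)\<^sup>2) * indicator {0<..t} u \<partial>lborel)"
    unfolding sqdist_def by (intro nn_integral_mono mult_right_mono ennreal_leI power_mono) auto
  also have "\<dots> = ennreal ((2 * C)\<^sup>2 * t)" using assms by (simp add: nn_integral_cmult_indicator ennreal_mult)
  finally show ?thesis .
qed

lemma simple_integral_diff: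
  "simple_integral W k p (\<lambda>i \<omega>. \<xi> i \<omega> - \<zeta> i \<omega>) t \<omega> = simple_integral W k p \<xi> t \<omega> - simple_integral W k p \<zeta> t \<omega>"
  by (simp add: simple_integral_def matrix_vector_mult_diff_rdistrib sum_subtractf)

lemma simple_process_diff:
  "simple_process k p (\<lambda>i \<omega>. \<xi> i \<omega> - \<zeta> i \<omega>) t \<omega> = simple_process k p \<xi> t \<omega> - simple_process k p \<zeta> t \<omega>"
  by (simp add: simple_process_def scaleR_diff_right sum_subtractf)

section \<open>Approximation of the Ito integral in mean square\<close>

context wiener_setup
begin

lemma simple_process_jointly_measurable:
  assumes "simple_integrand M F k p \<xi>"
  shows "jointly_measurable M (simple_process k p \<xi>)"
  unfolding simple_process_def
proof (intro borel_measurable_sum borel_measurable_scaleR)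
  fix i assume "i \<in> {..<k}"
  then show "(\<lambda>z. \<xi> i (fst z)) \<in> borel_measurable (M \<Otimes>\<^sub>M lborel)"
    using measurable_F_M[OF simple_integrandD(4)[OF assms]] by (intro measurable_compose[OF measurable_fst]) auto
qed measurable

lemma simple_integral_elem:
  assumes G: "simple_integrand M F k p \<xi>" and t: "0 \<le> t"
  defines "a \<equiv> \<lambda>i. clip 0 t (p i)" and "b \<equiv> \<lambda>i. clip 0 t (p (Suc i))"
    and "\<xi>' \<equiv> \<lambda>i \<omega>. if p i < t then \<xi> i \<omega> else 0"
  shows "elementary {..<k} a b \<xi>'" "simple_integral W k p \<xi> t \<omega> = elem_integral {..<k} a b \<xi>' \<omega>"
    "elem_process {..<k} a b \<xi>' u \<omega> = indicator {0<..t} u *\<^sub>R simple_process k p \<xi> u \<omega>"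
proof -
  show "elementary {..<k} a b \<xi>'"
    unfolding a_def b_def \<xi>'_def by (rule simple_increment(1)[OF G order_refl t])
  show "simple_integral W k p \<xi> t \<omega> = elem_integral {..<k} a b \<xi>' \<omega>"
    using simple_increment(2)[OF G order_refl t, of \<omega>]
    unfolding a_def b_def \<xi>'_def simple_integral_zero[OF G] diff_zero .
  show "elem_process {..<k} a b \<xi>' u \<omega> = indicator {0<..t} u *\<^sub>R simple_process k p \<xi> u \<omega>"
    unfolding a_def b_def \<xi>'_def by (rule simple_increment(3)[OF G order_refl t])
qed

lemma simple_integral_measurable:
  assumes G: "simple_integrand M F k p \<xi>" and t: "0 \<le> t"
  shows "simple_integral W k p \<xi> t \<in> borel_measurable M"
  by (subst ext[OF simple_integral_elem(2)[OF assms]]) (rule elem_integral_measurable[OF simple_integral_elem(1)[OF assms]])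

lemma norm_indicator_sq: "ennreal ((norm (indicator A u *\<^sub>R x - indicator A u *\<^sub>R y))\<^sup>2) = ennreal ((norm (x - y))\<^sup>2) * indicator A u"
  by (simp split: split_indicator)

lemma simple_integral_isometry:
  assumes G: "simple_integrand M F k p \<xi>" and G': "simple_integrand M F k' p' \<xi>'" and t: "0 \<le> t"
  shows "(\<integral>\<^sup>+\<omega>. ennreal ((norm (simple_integral W k p \<xi> t \<omega> - simple_integral W k' p' \<xi>' t \<omega>))\<^sup>2) \<partial>M)
    = (\<integral>\<^sup>+\<omega>. sqdist t (simple_process k p \<xi>) (simple_process k' p' \<xi>') \<omega> \<partial>M)"
  unfolding simple_integral_elem(2)[OF G t] simple_integral_elem(2)[OF G' t]
    elem_diff_isometry_nn[OF simple_integral_elem(1)[OF G t] simple_integral_elem(1)[OF G' t]]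
    simple_integral_elem(3)[OF G t] simple_integral_elem(3)[OF G' t] sqdist_def norm_indicator_sq ..

lemma clip_disjoint:
  assumes G: "simple_integrand M F k p \<xi>" and ij: "i < j" "j < k"
  shows "clip s t (p (Suc i)) \<le> clip s t (p j)"
  using simple_integrandD(2)[OF G, of "Suc i" j] ij by (intro clip_mono) auto

lemma simple_integral_tail:
  assumes G: "simple_integrand M F k p \<xi>" and t: "0 \<le> t" and pos: "\<delta> > 0" "\<eta> \<ge> 0"
  shows "measure M {\<omega>\<in>space M. \<delta> < norm (simple_integral W k p \<xi> t \<omega>)}
     \<le> measure M {\<omega>\<in>space M. ennreal \<eta> < sqdist t (simple_process k p \<xi>) (\<lambda>_ _. 0) \<omega>} + \<eta> / \<delta>\<^sup>2"
proof -
  have eq: "(\<integral>\<^sup>+u. ennreal ((norm (indicator {0<..t} u *\<^sub>R simple_process k p \<xi> u \<omega>))\<^sup>2) \<partial>lborel)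
    = sqdist t (simple_process k p \<xi>) (\<lambda>_ _. 0) \<omega>" for \<omega>
    unfolding sqdist_def by (intro nn_integral_cong) (simp split: split_indicator)
  show ?thesis
    using elem_tail[OF simple_integral_elem(1)[OF G t] clip_disjoint[OF G] pos]
    unfolding simple_integral_elem(2)[OF G t, symmetric] simple_integral_elem(3)[OF G t] eq .
qed

text \<open>Nearest-point projection onto the ball of radius \<open>C\<close> does not increase
  distances to points of the ball, and it is continuous, hence keeps adaptedness. As at most one
  coefficient is active at a time, projecting the coefficients projects the process.\<close>

lemma truncation_exists:
  fixes \<xi> :: "nat \<Rightarrow> 'w \<Rightarrow> real^'d^'n"
  assumes G: "simple_integrand M F k p \<xi>" and C: "C \<ge> 0"
  obtains \<zeta> where "simple_integrand M F k p \<zeta>" "\<And>i \<omega>. norm (\<zeta> i \<omega>) \<le> C"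
    "\<And>y u \<omega>. norm y \<le> C \<Longrightarrow> norm (simple_process k p \<zeta> u \<omega> - y) \<le> norm (simple_process k p \<xi> u \<omega> - y)"
proof -
  let ?S = "cball (0::real^'d^'n) C"
  have S: "convex ?S" "closed ?S" "?S \<noteq> {}" using C by auto
  define \<zeta> where "\<zeta> i \<omega> = closest_point ?S (\<xi> i \<omega>)" for i \<omega>
  have bound: "norm (\<zeta> i \<omega>) \<le> C" for i \<omega>
    using closest_point_in_set[OF S(2,3), of "\<xi> i \<omega>"] by (simp add: \<zeta>_def)
  have "simple_integrand M F k p \<zeta>"
    unfolding simple_integrand_def
  proof (intro conjI allI impI)
    fix i assume i: "i < k"
    show "\<zeta> i \<in> borel_measurable (F (p i))"
      using borel_measurable_continuous_on[OF continuous_on_closest_point[OF S] simple_integrandD(4)[OF G i]]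
      by (simp add: \<zeta>_def[abs_def])
    show "bounded (\<zeta> i ` space M)" using bound by (auto simp: bounded_iff)
  qed (use G in \<open>auto simp: simple_integrand_def\<close>)
  moreover note bound
  moreover have "norm (simple_process k p \<zeta> u \<omega> - y) \<le> norm (simple_process k p \<xi> u \<omega> - y)" if y: "norm y \<le> C" for y u \<omega>
  proof -
    have lip: "norm (closest_point ?S x - y) \<le> norm (x - y)" for x
      using closest_point_lipschitz[OF S, of x y] y by (simp add: closest_point_self dist_norm)
    consider "simple_process k p \<zeta> u \<omega> = 0" "simple_process k p \<xi> u \<omega> = 0"
      | i where "simple_process k p \<zeta> u \<omega> = \<zeta> i \<omega>" "simple_process k p \<xi> u \<omega> = \<xi> i \<omega>"
      using simple_process_cases[of k p u, OF simple_integrandD(2)[OF G]] by metis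
    then show ?thesis by cases (simp_all add: \<zeta>_def lip)
  qed
  ultimately show ?thesis by (rule that)
qed

text \<open>Progressive measurability up to \<open>t\<close> says nothing about times outside
  \<open>[0, t]\<close>, so time is clamped to that interval.\<close>

lemma progressive_jointly_measurable:
  assumes P: "progressive_upto F t H" and t: "0 \<le> t"
  shows "jointly_measurable M (\<lambda>u. H (max 0 (min t u)))"
proof -
  have H: "(\<lambda>(s, \<omega>). H s \<omega>) \<in> borel_measurable (restrict_space borel {0..t} \<Otimes>\<^sub>M F t)"
    using P t by (auto simp: progressive_upto_def)
  have id: "(\<lambda>\<omega>. \<omega>) \<in> measurable M (F t)"
    using sets_F_M[of t] by (intro measurableI) (auto simp: Int_absorb2 sets.sets_into_space subset_iff)
  have "(\<lambda>z. (max 0 (min t (snd z)), fst z)) \<in> measurable (M \<Otimes>\<^sub>M lborel) (restrict_space borel {0..t} \<Otimes>\<^sub>M F t)"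
  proof (rule measurable_Pair)
    show "(\<lambda>z. max 0 (min t (snd z))) \<in> measurable (M \<Otimes>\<^sub>M lborel) (restrict_space borel {0..t})"
      using t by (intro measurable_restrict_space2) auto
    show "(\<lambda>z. fst z) \<in> measurable (M \<Otimes>\<^sub>M lborel) (F t)"
      by (rule measurable_compose[OF measurable_fst id])
  qed
  from measurable_compose[OF this H] show ?thesis by simp
qed

text \<open>For a bounded version \<open>Hm\<close> of the integrand, the convergence in probability
  of the definition improves to mean square. The last clause covers arbitrary simple integrands, not
  only the sequence obtained here: integrals at two times come with unrelated approximating
  sequences, and this clause lets one sequence serve both.\<close>

lemma ito_approximation:
  fixes H Hm :: "real \<Rightarrow> 'w \<Rightarrow> real^'d^'n" and J :: "'w \<Rightarrow> real^'n"
  assumes ito: "has_ito_integral M F W H t J" and t: "0 \<le> t"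
    and Hm: "jointly_measurable M Hm" and C: "C \<ge> 0" "\<And>u \<omega>. \<omega> \<in> space M \<Longrightarrow> norm (Hm u \<omega>) \<le> C"
    and eq: "AE \<omega> in M. \<forall>u\<in>{0<..t}. H u \<omega> = Hm u \<omega>"
  obtains k p \<zeta> where "\<And>r::nat. simple_integrand M F (k r) (p r) (\<zeta> r)" "\<And>r i \<omega>. norm (\<zeta> r i \<omega>) \<le> C"
    "(\<lambda>r. \<integral>\<^sup>+\<omega>. sqdist t (simple_process (k r) (p r) (\<zeta> r)) Hm \<omega> \<partial>M) \<longlonglongrightarrow> 0"
    "\<And>k' p' \<xi>'. simple_integrand M F k' p' \<xi>' \<Longrightarrow>
        (\<integral>\<^sup>+\<omega>. ennreal ((norm (simple_integral W k' p' \<xi>' t \<omega> - J \<omega>))\<^sup>2) \<partial>M)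
          \<le> 2 * (\<integral>\<^sup>+\<omega>. sqdist t (simple_process k' p' \<xi>') Hm \<omega> \<partial>M)"
proof -
  from ito obtain k p \<xi> where prog: "progressive_upto F t H" and J[measurable]: "J \<in> borel_measurable M"
    and S: "\<And>r. simple_integrand M F (k r) (p r) (\<xi> r)"
    and L1: "tendsto_in_prob M (\<lambda>r \<omega>. \<integral>\<^sup>+ s\<in>{0..t}.
          ennreal ((norm (simple_process (k r) (p r) (\<xi> r) s \<omega> - H s \<omega>))\<^sup>2) \<partial>lborel)"
    and L2: "tendsto_in_prob M (\<lambda>r \<omega>. ennreal (norm (simple_integral W (k r) (p r) (\<xi> r) t \<omega> - J \<omega>)))"
    unfolding has_ito_integral_def by blast
  have "\<exists>\<zeta>. simple_integrand M F (k r) (p r) \<zeta> \<and> (\<forall>i \<omega>. norm (\<zeta> i \<omega>) \<le> C) \<and>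
    (\<forall>y u \<omega>. norm y \<le> C \<longrightarrow> norm (simple_process (k r) (p r) \<zeta> u \<omega> - y) \<le> norm (simple_process (k r) (p r) (\<xi> r) u \<omega> - y))" for r
    using truncation_exists[OF S[of r] C(1)] by metis
  then obtain \<zeta> where Z: "\<And>r. simple_integrand M F (k r) (p r) (\<zeta> r)" "\<And>r i \<omega>. norm (\<zeta> r i \<omega>) \<le> C"
    "\<And>r y u \<omega>. norm y \<le> C \<Longrightarrow> norm (simple_process (k r) (p r) (\<zeta> r) u \<omega> - y) \<le> norm (simple_process (k r) (p r) (\<xi> r) u \<omega> - y)"
    by metis
  let ?X = "\<lambda>r. simple_process (k r) (p r) (\<xi> r)" and ?Z = "\<lambda>r. simple_process (k r) (p r) (\<zeta> r)"
  note jX = simple_process_jointly_measurable[OF S] and jZ = simple_process_jointly_measurable[OF Z(1)]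
  note [measurable] = sqdist_measurable[OF jX Hm] sqdist_measurable[OF jZ Hm]
    simple_integral_measurable[OF S t] simple_integral_measurable[OF Z(1) t]
  \<comment> \<open>\<open>H\<close> may be replaced by \<open>Hm\<close> because they agree on
    \<open>(0, t]\<close> for almost every path, and time \<open>0\<close> is a null set.\<close>
  have A: "tendsto_in_prob M (\<lambda>r. sqdist t (?X r) Hm)"
  proof -
    let ?N = "\<lambda>r \<omega>. \<integral>\<^sup>+ s\<in>{0..t}. ennreal ((norm (?X r s \<omega> - H s \<omega>))\<^sup>2) \<partial>lborel"
    have Nm: "?N r \<in> borel_measurable M" for r
    proof -
      have "(\<lambda>z. ennreal ((norm (?X r (snd z) (fst z) - H (max 0 (min t (snd z))) (fst z)))\<^sup>2) * indicator {0..t} (snd z))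
         \<in> borel_measurable (M \<Otimes>\<^sub>M lborel)"
        using jX[of r] progressive_jointly_measurable[OF prog t] by measurable
      from lborel.borel_measurable_nn_integral_fst[OF this]
      have "(\<lambda>\<omega>. \<integral>\<^sup>+u. ennreal ((norm (?X r u \<omega> - H (max 0 (min t u)) \<omega>))\<^sup>2) * indicator {0..t} u \<partial>lborel) \<in> borel_measurable M"
        by simp
      also have "(\<lambda>\<omega>. \<integral>\<^sup>+u. ennreal ((norm (?X r u \<omega> - H (max 0 (min t u)) \<omega>))\<^sup>2) * indicator {0..t} u \<partial>lborel) = ?N r"
        by (intro ext nn_integral_cong) (auto split: split_indicator)
      finally show ?thesis .
    qed
    have aeq: "AE \<omega> in M. ?N r \<omega> = sqdist t (?X r) Hm \<omega>" for r
      using eq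
    proof eventually_elim
      case (elim \<omega>)
      have "AE u in lborel. ennreal ((norm (?X r u \<omega> - H u \<omega>))\<^sup>2) * indicator {0..t} u
          = ennreal ((norm (?X r u \<omega> - Hm u \<omega>))\<^sup>2) * indicator {0<..t} u"
        using AE_lborel_singleton[of "0::real"]
        by (rule eventually_mono) (use elim in \<open>auto split: split_indicator\<close>)
      then show ?case unfolding sqdist_def by (rule nn_integral_cong_AE)
    qed
    have "measure M {\<omega>\<in>space M. ennreal e < ?N r \<omega>} = measure M {\<omega>\<in>space M. ennreal e < sqdist t (?X r) Hm \<omega>}" for e r
    proof (rule measure_eq_AE)
      show "AE \<omega> in M. (\<omega> \<in> {\<omega>\<in>space M. ennreal e < ?N r \<omega>}) = (\<omega> \<in> {\<omega>\<in>space M. ennreal e < sqdist t (?X r) Hm \<omega>})"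
        using aeq[of r] by (rule eventually_mono) simp
      show "{\<omega>\<in>space M. ennreal e < ?N r \<omega>} \<in> sets M"
        by (rule borel_measurable_less[OF _ Nm]) simp
      show "{\<omega>\<in>space M. ennreal e < sqdist t (?X r) Hm \<omega>} \<in> sets M"
        by (rule borel_measurable_less[OF _ sqdist_measurable[OF jX Hm]]) simp
    qed
    then show ?thesis using L1 unfolding tendsto_in_prob_def by simp
  qed
  have ZX: "sqdist t (?Z r) Hm \<omega> \<le> sqdist t (?X r) Hm \<omega>" if "\<omega> \<in> space M" for r \<omega>
    unfolding sqdist_def using Z(3) C(2)[OF that]
    by (intro nn_integral_mono mult_right_mono ennreal_leI power_mono) auto
  have ZC: "norm (?Z r u \<omega>) \<le> C" for r u \<omega>
    using simple_process_cases[of "k r" "p r" u, OF simple_integrandD(2)[OF Z(1)]] Z(2) C(1) by (metis norm_zero)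
  have Zbound: "sqdist t (?Z r) Hm \<omega> \<le> ennreal ((2 * C)\<^sup>2 * t)" if "\<omega> \<in> space M" for r \<omega>
    by (intro sqdist_bound ZC C(2) that t)
  have AZ: "tendsto_in_prob M (\<lambda>r. sqdist t (?Z r) Hm)"
    unfolding tendsto_in_prob_def
  proof (intro allI impI)
    fix e :: real assume "0 < e"
    then have lim: "(\<lambda>r. measure M {\<omega>\<in>space M. ennreal e < sqdist t (?X r) Hm \<omega>}) \<longlonglongrightarrow> 0"
      using A by (simp add: tendsto_in_prob_def)
    have "measure M {\<omega>\<in>space M. ennreal e < sqdist t (?Z r) Hm \<omega>} \<le> measure M {\<omega>\<in>space M. ennreal e < sqdist t (?X r) Hm \<omega>}" for r
      using ZX by (intro finite_measure_mono) (auto intro: less_le_trans)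
    then show "(\<lambda>r. measure M {\<omega>\<in>space M. ennreal e < sqdist t (?Z r) Hm \<omega>}) \<longlonglongrightarrow> 0"
      by (intro tendsto_sandwich[OF _ _ tendsto_const lim]) auto
  qed
  have EZ: "(\<lambda>r. \<integral>\<^sup>+\<omega>. sqdist t (?Z r) Hm \<omega> \<partial>M) \<longlonglongrightarrow> 0"
    by (rule tendsto_in_prob_nn_integral[OF _ Zbound _ AZ]) (use t in auto)
  let ?IX = "\<lambda>r. simple_integral W (k r) (p r) (\<xi> r) t" and ?IZ = "\<lambda>r. simple_integral W (k r) (p r) (\<zeta> r) t"
  \<comment> \<open>The truncated integrals have the same limit in probability: the difference is
    the integral of a simple integrand whose energy is at most four times the distance of the
    original one from \<open>Hm\<close>, so the tail estimate applies.\<close>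
  have XZ: "(\<lambda>r. measure M {\<omega>\<in>space M. \<delta> < norm (?IX r \<omega> - ?IZ r \<omega>)}) \<longlonglongrightarrow> 0" if \<delta>: "\<delta> > 0" for \<delta>
  proof -
    have le: "measure M {\<omega>\<in>space M. \<delta> < norm (?IX r \<omega> - ?IZ r \<omega>)}
       \<le> measure M {\<omega>\<in>space M. ennreal \<eta> < sqdist t (?X r) Hm \<omega>} + 4 * \<eta> / \<delta>\<^sup>2" if \<eta>: "\<eta> > 0" for \<eta> r
    proof -
      have D: "simple_integrand M F (k r) (p r) (\<lambda>i \<omega>. \<xi> r i \<omega> - \<zeta> r i \<omega>)"
        unfolding simple_integrand_def
      proof (intro conjI allI impI)
        fix i assume i: "i < k r"
        show "(\<lambda>\<omega>. \<xi> r i \<omega> - \<zeta> r i \<omega>) \<in> borel_measurable (F (p r i))"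
          using simple_integrandD(4)[OF S i] simple_integrandD(4)[OF Z(1) i] by measurable
        show "bounded ((\<lambda>\<omega>. \<xi> r i \<omega> - \<zeta> r i \<omega>) ` space M)"
          using simple_integrandD(5)[OF S i] simple_integrandD(5)[OF Z(1) i] by (rule bounded_minus_comp)
      qed (use S[of r] in \<open>auto simp: simple_integrand_def\<close>)
      have "sqdist t (simple_process (k r) (p r) (\<lambda>i \<omega>. \<xi> r i \<omega> - \<zeta> r i \<omega>)) (\<lambda>_ _. 0) \<omega> \<le> 4 * sqdist t (?X r) Hm \<omega>"
        if w: "\<omega> \<in> space M" for \<omega>
      proof -
        have "sqdist t (simple_process (k r) (p r) (\<lambda>i \<omega>. \<xi> r i \<omega> - \<zeta> r i \<omega>)) (\<lambda>_ _. 0) \<omega> = sqdist t (?X r) (?Z r) \<omega>"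
          by (simp add: sqdist_def simple_process_diff)
        also have "\<dots> \<le> 2 * sqdist t (?X r) Hm \<omega> + 2 * sqdist t Hm (?Z r) \<omega>"
          by (rule sqdist_triangle[OF jX Hm jZ w])
        also have "sqdist t Hm (?Z r) \<omega> = sqdist t (?Z r) Hm \<omega>" by (simp add: sqdist_def norm_minus_commute)
        also have "2 * sqdist t (?X r) Hm \<omega> + 2 * \<dots> \<le> 2 * sqdist t (?X r) Hm \<omega> + 2 * sqdist t (?X r) Hm \<omega>"
          by (intro add_left_mono mult_left_mono ZX w) auto
        also have "\<dots> = 4 * sqdist t (?X r) Hm \<omega>" by (simp flip: distrib_right)
        finally show ?thesis .
      qed
      moreover have "ennreal (4 * \<eta>) = 4 * ennreal \<eta>" using \<eta> by (simp add: ennreal_mult)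
      ultimately have sub: "{\<omega>\<in>space M. ennreal (4 * \<eta>) < sqdist t (simple_process (k r) (p r) (\<lambda>i \<omega>. \<xi> r i \<omega> - \<zeta> r i \<omega>)) (\<lambda>_ _. 0) \<omega>}
         \<subseteq> {\<omega>\<in>space M. ennreal \<eta> < sqdist t (?X r) Hm \<omega>}"
        by (smt (verit, best) Collect_mono_iff ennreal_mult_left_cong leD le_less_trans linorder_not_le mult_left_mono zero_le)
      have "measure M {\<omega>\<in>space M. \<delta> < norm (?IX r \<omega> - ?IZ r \<omega>)} \<le>
         measure M {\<omega>\<in>space M. ennreal (4 * \<eta>) < sqdist t (simple_process (k r) (p r) (\<lambda>i \<omega>. \<xi> r i \<omega> - \<zeta> r i \<omega>)) (\<lambda>_ _. 0) \<omega>} + 4 * \<eta> / \<delta>\<^sup>2"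
        using simple_integral_tail[OF D t \<delta>, of "4 * \<eta>"] \<eta> by (simp add: simple_integral_diff)
      also have "\<dots> \<le> measure M {\<omega>\<in>space M. ennreal \<eta> < sqdist t (?X r) Hm \<omega>} + 4 * \<eta> / \<delta>\<^sup>2"
        by (intro add_right_mono finite_measure_mono sub) measurable
      finally show ?thesis .
    qed
    show ?thesis
    proof (rule LIMSEQ_I)
      fix e :: real assume e: "0 < e"
      \<comment> \<open>Chosen such that the deterministic part
        \<open>4 * \<eta> / \<delta>\<^sup>2\<close> of the tail bound is half of the
        tolerance.\<close>
      define \<eta> where "\<eta> = e * \<delta>\<^sup>2 / 8"
      have \<eta>: "\<eta> > 0" "4 * \<eta> / \<delta>\<^sup>2 = e / 2" using e \<delta> by (auto simp: \<eta>_def)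
      have "(\<lambda>r. measure M {\<omega>\<in>space M. ennreal \<eta> < sqdist t (?X r) Hm \<omega>}) \<longlonglongrightarrow> 0"
        using A \<eta>(1) by (simp add: tendsto_in_prob_def)
      from LIMSEQ_D[OF this, of "e / 2"] e obtain n0 where n0: "\<And>r. r \<ge> n0 \<Longrightarrow> measure M {\<omega>\<in>space M. ennreal \<eta> < sqdist t (?X r) Hm \<omega>} < e / 2"
        by auto
      show "\<exists>n0. \<forall>r\<ge>n0. norm (measure M {\<omega>\<in>space M. \<delta> < norm (?IX r \<omega> - ?IZ r \<omega>)} - 0) < e"
      proof (intro exI[of _ n0] allI impI)
        fix r assume r: "n0 \<le> r"
        show "norm (measure M {\<omega>\<in>space M. \<delta> < norm (?IX r \<omega> - ?IZ r \<omega>)} - 0) < e"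
          using le[OF \<eta>(1), of r] n0[OF r] \<eta>(2) by simp
      qed
    qed
  qed
  have "tendsto_in_prob M (\<lambda>r \<omega>. ennreal (norm (?IZ r \<omega> - J \<omega>)))"
    unfolding tendsto_in_prob_def
  proof (intro allI impI)
    fix e :: real assume e: "0 < e"
    have eq1: "{\<omega>\<in>space M. ennreal c < ennreal (norm (Y \<omega>))} = {\<omega>\<in>space M. c < norm (Y \<omega>)}" if "0 < c" for c and Y :: "'w \<Rightarrow> real^'n"
      using that by (auto simp: ennreal_less_iff)
    have l2: "(\<lambda>r. measure M {\<omega>\<in>space M. e / 2 < norm (?IX r \<omega> - J \<omega>)}) \<longlonglongrightarrow> 0"
    proof -
      have "(\<lambda>r. measure M {\<omega>\<in>space M. ennreal (e / 2) < ennreal (norm (?IX r \<omega> - J \<omega>))}) \<longlonglongrightarrow> 0"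
        using L2[unfolded tendsto_in_prob_def, rule_format, of "e / 2"] e by simp
      then show ?thesis unfolding eq1[OF half_gt_zero[OF e]] .
    qed
    have lim: "(\<lambda>r. measure M {\<omega>\<in>space M. e / 2 < norm (?IX r \<omega> - J \<omega>)} + measure M {\<omega>\<in>space M. e / 2 < norm (?IX r \<omega> - ?IZ r \<omega>)}) \<longlonglongrightarrow> 0"
      using tendsto_add[OF l2 XZ[of "e / 2"]] e by simp
    have "measure M {\<omega>\<in>space M. e < norm (?IZ r \<omega> - J \<omega>)} \<le>
       measure M {\<omega>\<in>space M. e / 2 < norm (?IX r \<omega> - J \<omega>)} + measure M {\<omega>\<in>space M. e / 2 < norm (?IX r \<omega> - ?IZ r \<omega>)}" for r
    proof -
      have tri: "e / 2 < norm (?IX r \<omega> - J \<omega>) \<or> e / 2 < norm (?IX r \<omega> - ?IZ r \<omega>)"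
        if "e < norm (?IZ r \<omega> - J \<omega>)" for \<omega>
      proof -
        have "norm (?IZ r \<omega> - J \<omega>) \<le> norm (?IX r \<omega> - J \<omega>) + norm (?IX r \<omega> - ?IZ r \<omega>)"
          using norm_triangle_ineq4[of "?IX r \<omega> - J \<omega>" "?IX r \<omega> - ?IZ r \<omega>"] by simp
        then show ?thesis using that by linarith
      qed
      have "measure M {\<omega>\<in>space M. e < norm (?IZ r \<omega> - J \<omega>)} \<le>
         measure M ({\<omega>\<in>space M. e / 2 < norm (?IX r \<omega> - J \<omega>)} \<union> {\<omega>\<in>space M. e / 2 < norm (?IX r \<omega> - ?IZ r \<omega>)})"
      proof (rule finite_measure_mono)
        show "{\<omega>\<in>space M. e < norm (?IZ r \<omega> - J \<omega>)} \<subseteq> {\<omega>\<in>space M. e / 2 < norm (?IX r \<omega> - J \<omega>)} \<union> {\<omega>\<in>space M. e / 2 < norm (?IX r \<omega> - ?IZ r \<omega>)}"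
          using tri by blast
      qed measurable
      also have "\<dots> \<le> measure M {\<omega>\<in>space M. e / 2 < norm (?IX r \<omega> - J \<omega>)} + measure M {\<omega>\<in>space M. e / 2 < norm (?IX r \<omega> - ?IZ r \<omega>)}"
        by (intro measure_Un_le) measurable
      finally show ?thesis .
    qed
    then show "(\<lambda>r. measure M {\<omega>\<in>space M. ennreal e < ennreal (norm (?IZ r \<omega> - J \<omega>))}) \<longlonglongrightarrow> 0"
      unfolding eq1[OF e] by (intro tendsto_sandwich[OF _ _ tendsto_const lim]) auto
  qed
  from tendsto_in_prob_AE_subseq[OF _ this] obtain q where q: "strict_mono q" "AE \<omega> in M. (\<lambda>r. ?IZ (q r) \<omega> - J \<omega>) \<longlonglongrightarrow> 0"
    by auto
  show ?thesis
  proof (rule that[of k p \<zeta>, OF Z(1,2) EZ])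
    fix k' p' and \<xi>' :: "nat \<Rightarrow> 'w \<Rightarrow> real^'d^'n" assume G: "simple_integrand M F k' p' \<xi>'"
    let ?I = "simple_integral W k' p' \<xi>' t" and ?G = "simple_process k' p' \<xi>'"
    note jG = simple_process_jointly_measurable[OF G]
    note [measurable] = simple_integral_measurable[OF G t] sqdist_measurable[OF jG Hm]
    \<comment> \<open>Fatou's lemma along the almost surely convergent subsequence. The isometry
      gives the exact distance to each truncated integral; the triangle inequality through
      \<open>Hm\<close> leaves the factor \<open>2\<close>, and its second term vanishes in the
      limit.\<close>
    have "(\<integral>\<^sup>+\<omega>. ennreal ((norm (?I \<omega> - J \<omega>))\<^sup>2) \<partial>M) = (\<integral>\<^sup>+\<omega>. liminf (\<lambda>r. ennreal ((norm (?I \<omega> - ?IZ (q r) \<omega>))\<^sup>2)) \<partial>M)"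
      using q(2)
    proof (intro nn_integral_cong_AE, eventually_elim)
      case (elim \<omega>)
      then have "(\<lambda>r. ?IZ (q r) \<omega>) \<longlonglongrightarrow> J \<omega>" by (simp add: LIM_zero_iff)
      then have "(\<lambda>r. ennreal ((norm (?I \<omega> - ?IZ (q r) \<omega>))\<^sup>2)) \<longlonglongrightarrow> ennreal ((norm (?I \<omega> - J \<omega>))\<^sup>2)"
        by (intro tendsto_ennrealI tendsto_intros)
      from lim_imp_Liminf[OF _ this] show ?case by (metis trivial_limit_sequentially)
    qed
    also have "\<dots> \<le> liminf (\<lambda>r. \<integral>\<^sup>+\<omega>. ennreal ((norm (?I \<omega> - ?IZ (q r) \<omega>))\<^sup>2) \<partial>M)"
      by (rule nn_integral_liminf) measurable
    also have "\<dots> \<le> liminf (\<lambda>r. 2 * (\<integral>\<^sup>+\<omega>. sqdist t ?G Hm \<omega> \<partial>M) + 2 * (\<integral>\<^sup>+\<omega>. sqdist t (?Z (q r)) Hm \<omega> \<partial>M))"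
    proof (intro Liminf_mono always_eventually allI)
      fix r
      have "(\<integral>\<^sup>+\<omega>. ennreal ((norm (?I \<omega> - ?IZ (q r) \<omega>))\<^sup>2) \<partial>M) = (\<integral>\<^sup>+\<omega>. sqdist t ?G (?Z (q r)) \<omega> \<partial>M)"
        by (rule simple_integral_isometry[OF G Z(1) t])
      also have "\<dots> \<le> (\<integral>\<^sup>+\<omega>. 2 * sqdist t ?G Hm \<omega> + 2 * sqdist t (?Z (q r)) Hm \<omega> \<partial>M)"
        using sqdist_triangle[OF jG Hm jZ]
        by (intro nn_integral_mono) (simp add: sqdist_def norm_minus_commute)
      also have "\<dots> = 2 * (\<integral>\<^sup>+\<omega>. sqdist t ?G Hm \<omega> \<partial>M) + 2 * (\<integral>\<^sup>+\<omega>. sqdist t (?Z (q r)) Hm \<omega> \<partial>M)"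
        by (simp add: nn_integral_add nn_integral_cmult)
      finally show "(\<integral>\<^sup>+\<omega>. ennreal ((norm (?I \<omega> - ?IZ (q r) \<omega>))\<^sup>2) \<partial>M) \<le> 2 * (\<integral>\<^sup>+\<omega>. sqdist t ?G Hm \<omega> \<partial>M) + 2 * (\<integral>\<^sup>+\<omega>. sqdist t (?Z (q r)) Hm \<omega> \<partial>M)" .
    qed
    also have "\<dots> = 2 * (\<integral>\<^sup>+\<omega>. sqdist t ?G Hm \<omega> \<partial>M)"
    proof (rule lim_imp_Liminf)
      have "(\<lambda>r. 2 * (\<integral>\<^sup>+\<omega>. sqdist t (?Z (q r)) Hm \<omega> \<partial>M)) \<longlonglongrightarrow> 2 * 0"
        using LIMSEQ_subseq_LIMSEQ[OF EZ q(1)] by (intro ennreal_tendsto_cmult) (auto simp: comp_def)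
      from tendsto_add[OF tendsto_const this]
      show "(\<lambda>r. 2 * (\<integral>\<^sup>+\<omega>. sqdist t ?G Hm \<omega> \<partial>M) + 2 * (\<integral>\<^sup>+\<omega>. sqdist t (?Z (q r)) Hm \<omega> \<partial>M)) \<longlonglongrightarrow> 2 * (\<integral>\<^sup>+\<omega>. sqdist t ?G Hm \<omega> \<partial>M)"
        by simp
    qed simp
    finally show "(\<integral>\<^sup>+\<omega>. ennreal ((norm (?I \<omega> - J \<omega>))\<^sup>2) \<partial>M) \<le> 2 * (\<integral>\<^sup>+\<omega>. sqdist t ?G Hm \<omega> \<partial>M)" .
  qed
qed

end

section \<open>Limits of quadratic functionals\<close>

lemma norm_matrix_matrix_mult_le:
  fixes A :: "real^'m^'n" and B :: "real^'d^'m" shows "norm (A ** B) \<le> norm A * norm B"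
proof -
  have row: "(A ** B) $ i = A $ i v* B" for i
    by (simp add: vec_eq_iff matrix_matrix_mult_def vector_matrix_mult_def mult.commute)
  have "norm (A ** B) \<le> L2_set (\<lambda>i. norm (A $ i) * norm B) UNIV"
    unfolding norm_vec_def[of "A ** B"] row
    by (intro L2_set_mono) (auto simp: mult.commute intro: norm_vector_matrix_mult_le)
  then show ?thesis by (simp add: norm_vec_def[of A] L2_set_left_distrib)
qed

lemma linear_matrix_mult: "linear (\<lambda>X :: real^'d^'m. (A :: real^'m^'n) ** X)"
proof (rule linearI)
  show "A ** (c *\<^sub>R X) = c *\<^sub>R (A ** X)" for c and X :: "real^'d^'m"
    by (simp add: vec_eq_iff matrix_matrix_mult_def sum_distrib_left mult_ac)
qed (rule matrix_add_ldistrib)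

text \<open>Polarisation, with \<open>norm x\<close> replaced by
  \<open>norm y + norm (y - x)\<close> so that the growth is measured by \<open>y\<close> alone. The
  summand \<open>1\<close> puts the bound into a format that linear functionals share.\<close>

lemma quadratic_form_diff_le:
  fixes x y :: "'v::real_inner"
  assumes "linear B" and B: "\<And>z. norm (B z) \<le> c * norm z" and c: "0 \<le> c"
  shows "\<bar>y \<bullet> B y - x \<bullet> B x\<bar> \<le> 2 * c * ((1 + norm y) * norm (y - x) + (norm (y - x))\<^sup>2)"
proof -
  have "y \<bullet> B y - x \<bullet> B x = (y - x) \<bullet> B y + x \<bullet> B (y - x)"
    by (simp add: linear_diff[OF assms(1)] inner_diff_left inner_diff_right)
  also have "\<bar>\<dots>\<bar> \<le> norm (y - x) * (c * norm y) + norm x * (c * norm (y - x))"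
    using Cauchy_Schwarz_ineq2[of "y - x" "B y"] Cauchy_Schwarz_ineq2[of x "B (y - x)"]
      mult_left_mono[OF B[of y], of "norm (y - x)"] mult_left_mono[OF B[of "y - x"], of "norm x"] by auto
  also have "\<dots> \<le> norm (y - x) * (c * norm y) + (norm y + norm (y - x)) * (c * norm (y - x))"
    using c norm_triangle_sub[of x y] by (intro add_left_mono mult_right_mono) (auto simp: norm_minus_commute)
  also have "\<dots> \<le> 2 * c * ((1 + norm y) * norm (y - x) + (norm (y - x))\<^sup>2)"
    using c by (simp add: algebra_simps power2_eq_square)
  finally show ?thesis .
qed

text \<open>Young's inequality with weight \<open>\<kappa>\<close> splits the mixed term into a
  small multiple of the uniformly bounded second moments and a large multiple of the vanishing mean
  square distance. It is stated for finite measures because it is applied both to the probability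
  space and to its product with a time interval.\<close>

lemma (in finite_measure) quadratic_functional_tendsto:
  fixes a :: "'a \<Rightarrow> 'v::euclidean_space" and b :: "nat \<Rightarrow> 'a \<Rightarrow> 'v" and \<Phi>a :: "'a \<Rightarrow> real"
  assumes [measurable]: "a \<in> borel_measurable M" "\<And>r. b r \<in> borel_measurable M"
    and lim: "(\<lambda>r. \<integral>\<^sup>+x. ennreal ((norm (b r x - a x))\<^sup>2) \<partial>M) \<longlonglongrightarrow> 0"
    and V: "\<And>r. (\<integral>\<^sup>+x. ennreal ((1 + norm (b r x))\<^sup>2) \<partial>M) \<le> ennreal V" and V0: "0 \<le> V" and c: "0 \<le> c"
    and int: "integrable M \<Phi>a" "\<And>r. integrable M (\<Phi>b r)"
    and le: "\<And>r x. x \<in> space M \<Longrightarrow> \<bar>\<Phi>b r x - \<Phi>a x\<bar> \<le> c * ((1 + norm (b r x)) * norm (b r x - a x) + (norm (b r x - a x))\<^sup>2)"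
  shows "(\<lambda>r. \<integral>x. \<Phi>b r x \<partial>M) \<longlonglongrightarrow> (\<integral>x. \<Phi>a x \<partial>M)"
proof (rule LIMSEQ_I)
  fix e :: real assume e: "0 < e"
  \<comment> \<open>The added \<open>1\<close> keeps the denominator positive when
    \<open>c * V = 0\<close>; the choice makes the contribution of the second moments at most
    \<open>e / 2\<close>.\<close>
  define \<kappa> where "\<kappa> = e / (c * V + 1)"
  have cV: "c * V + 1 > 0" using c V0 by (simp add: add_nonneg_pos)
  then have \<kappa>: "\<kappa> > 0" using e by (simp add: \<kappa>_def)
  have "c * V * \<kappa> \<le> e" using e cV c V0 by (simp add: \<kappa>_def field_simps)
  then have half: "c * \<kappa> / 2 * V \<le> e / 2" by (simp add: mult_ac)
  let ?k = "c * (1 + 1 / (2 * \<kappa>))"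
  let ?E = "\<lambda>r. \<integral>\<^sup>+x. ennreal ((norm (b r x - a x))\<^sup>2) \<partial>M"
  have bound: "ennreal \<bar>(\<integral>x. \<Phi>b r x \<partial>M) - (\<integral>x. \<Phi>a x \<partial>M)\<bar> \<le> ennreal (e / 2) + ennreal ?k * ?E r" for r
  proof -
    have "ennreal \<bar>(\<integral>x. \<Phi>b r x \<partial>M) - (\<integral>x. \<Phi>a x \<partial>M)\<bar> = ennreal (norm (\<integral>x. \<Phi>b r x - \<Phi>a x \<partial>M))"
      using int by simp
    also have "\<dots> \<le> (\<integral>\<^sup>+x. ennreal (norm (\<Phi>b r x - \<Phi>a x)) \<partial>M)"
      using int by (intro integral_norm_bound_ennreal) auto
    also have "\<dots> \<le> (\<integral>\<^sup>+x. ennreal (c * \<kappa> / 2) * ennreal ((1 + norm (b r x))\<^sup>2) + ennreal ?k * ennreal ((norm (b r x - a x))\<^sup>2) \<partial>M)"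
    proof (intro nn_integral_mono)
      fix x assume x: "x \<in> space M"
      let ?y = "1 + norm (b r x)" and ?d = "norm (b r x - a x)"
      have "0 \<le> (\<kappa> * ?y - ?d)\<^sup>2 / (2 * \<kappa>)" using \<kappa> by simp
      also have "\<dots> = \<kappa> / 2 * ?y\<^sup>2 + 1 / (2 * \<kappa>) * ?d\<^sup>2 - ?y * ?d"
        using \<kappa> by (simp add: power2_eq_square field_simps)
      finally have "?y * ?d + ?d\<^sup>2 \<le> \<kappa> / 2 * ?y\<^sup>2 + (1 + 1 / (2 * \<kappa>)) * ?d\<^sup>2" by (simp add: algebra_simps)
      from mult_left_mono[OF this c] le[OF x, of r]
      have "\<bar>\<Phi>b r x - \<Phi>a x\<bar> \<le> c * \<kappa> / 2 * ?y\<^sup>2 + ?k * ?d\<^sup>2" by (simp add: algebra_simps)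
      then have "ennreal (norm (\<Phi>b r x - \<Phi>a x)) \<le> ennreal (c * \<kappa> / 2 * ?y\<^sup>2 + ?k * ?d\<^sup>2)"
        by (simp add: ennreal_leI)
      also have "\<dots> = ennreal (c * \<kappa> / 2) * ennreal (?y\<^sup>2) + ennreal ?k * ennreal (?d\<^sup>2)"
        using c \<kappa> by (subst ennreal_plus) (auto simp: ennreal_mult[symmetric])
      finally show "ennreal (norm (\<Phi>b r x - \<Phi>a x)) \<le> ennreal (c * \<kappa> / 2) * ennreal (?y\<^sup>2) + ennreal ?k * ennreal (?d\<^sup>2)" .
    qed
    also have "\<dots> = ennreal (c * \<kappa> / 2) * (\<integral>\<^sup>+x. ennreal ((1 + norm (b r x))\<^sup>2) \<partial>M) + ennreal ?k * ?E r"
      by (simp add: nn_integral_add nn_integral_cmult)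
    also have "\<dots> \<le> ennreal (c * \<kappa> / 2) * ennreal V + ennreal ?k * ?E r"
      by (intro add_right_mono mult_left_mono V) auto
    also have "ennreal (c * \<kappa> / 2) * ennreal V \<le> ennreal (e / 2)"
      using half c \<kappa> V0 by (simp add: ennreal_mult[symmetric] ennreal_leI)
    finally show ?thesis by (simp add: add_right_mono)
  qed
  have "(\<lambda>r. ennreal ?k * ?E r) \<longlonglongrightarrow> ennreal ?k * 0"
    by (intro ennreal_tendsto_cmult lim) simp
  then have "\<forall>\<^sub>F r in sequentially. ennreal ?k * ?E r < ennreal (e / 2)"
    by (rule order_tendstoD(2)) (use e in simp)
  then obtain n0 where n0: "\<And>r. r \<ge> n0 \<Longrightarrow> ennreal ?k * ?E r < ennreal (e / 2)"
    by (auto simp: eventually_sequentially)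
  show "\<exists>n0. \<forall>r\<ge>n0. norm ((\<integral>x. \<Phi>b r x \<partial>M) - (\<integral>x. \<Phi>a x \<partial>M)) < e"
  proof (intro exI[of _ n0] allI impI)
    fix r assume "n0 \<le> r"
    have "ennreal \<bar>(\<integral>x. \<Phi>b r x \<partial>M) - (\<integral>x. \<Phi>a x \<partial>M)\<bar> \<le> ennreal (e / 2) + ennreal ?k * ?E r" by (rule bound)
    also have "\<dots> < ennreal (e / 2) + ennreal (e / 2)"
      using n0[OF \<open>n0 \<le> r\<close>] by (simp add: ennreal_add_left_cancel_less)
    also have "\<dots> = ennreal e" using e by (simp add: ennreal_plus[symmetric] del: ennreal_plus)
    finally show "norm ((\<integral>x. \<Phi>b r x \<partial>M) - (\<integral>x. \<Phi>a x \<partial>M)) < e" by (simp add: ennreal_less_iff)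
  qed
qed

lemma (in finite_measure) integrable_quartic_growth:
  fixes X :: "'a \<Rightarrow> 'v::euclidean_space" and f :: "'a \<Rightarrow> real"
  assumes [measurable]: "X \<in> borel_measurable M" "f \<in> borel_measurable M"
    and K: "(\<integral>\<^sup>+x. ennreal (norm (X x) ^ 4) \<partial>M) \<le> ennreal K"
    and le: "AE x in M. \<bar>f x\<bar> \<le> c * (1 + norm (X x) ^ 4)"
  shows "integrable M f"
proof -
  have "(\<integral>\<^sup>+x. ennreal (norm (X x) ^ 4) \<partial>M) < \<infinity>" using K by (simp add: le_less_trans)
  then have "integrable M (\<lambda>x. norm (X x) ^ 4)" by (intro integrableI_bounded) auto
  then have "integrable M (\<lambda>x. c * (1 + norm (X x) ^ 4))" by simp
  then show ?thesis
    by (rule Bochner_Integration.integrable_bound) (use le in \<open>auto elim!: eventually_mono\<close>)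
qed

lemma power2_le_quartic: "(x::real)\<^sup>2 \<le> 1 + x ^ 4"
proof -
  have "0 \<le> (x\<^sup>2 - 1)\<^sup>2 + x\<^sup>2 * x\<^sup>2 + 1" by simp
  then show ?thesis by (simp add: power2_eq_square power4_eq_xxxx algebra_simps)
qed

section \<open>Moments of increments of the Ito integral\<close>

context wiener_setup
begin

text \<open>No interval starts before \<open>s\<close>, so \<open>\<eta>\<close> can be absorbed
  into the coefficients, and each increment has mean zero.\<close>

lemma inner_elem_mean_zero:
  fixes \<eta> :: "'w \<Rightarrow> real^'n"
  assumes x: "elementary I a b \<xi>" and s: "\<And>i. i \<in> I \<Longrightarrow> s \<le> a i"
    and \<eta>: "\<eta> \<in> borel_measurable (F s)" "bounded (\<eta> ` space M)"
  shows "has_bochner_integral M (\<lambda>\<omega>. \<eta> \<omega> \<bullet> elem_integral I a b \<xi> \<omega>) 0"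
proof -
  let ?U = "\<lambda>i n e \<omega>. \<eta> \<omega> $ n * \<xi> i \<omega> $ n $ e"
  have eq: "(\<lambda>\<omega>. \<eta> \<omega> \<bullet> elem_integral I a b \<xi> \<omega>) = (\<lambda>\<omega>. \<Sum>i\<in>I. \<Sum>n\<in>UNIV. \<Sum>e\<in>UNIV. ?U i n e \<omega> * (W (b i) \<omega> - W (a i) \<omega>) $ e)"
    unfolding elem_integral_def inner_sum_right
    by (simp add: inner_vec_def matrix_vector_mult_def sum_distrib_left mult_ac)
  have "has_bochner_integral M (\<lambda>\<omega>. ?U i n e \<omega> * (W (b i) \<omega> - W (a i) \<omega>) $ e) 0" if i: "i \<in> I" for i n e
  proof (rule increment_zero)
    have 1: "(\<lambda>\<omega>. \<eta> \<omega> $ n) \<in> borel_measurable (F (a i))"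
      by (rule borel_measurable_continuous_on[OF _ measurable_F_mono[OF \<eta>(1) s[OF i]]], intro continuous_intros)
    have 2: "(\<lambda>\<omega>. \<xi> i \<omega> $ n $ e) \<in> borel_measurable (F (a i))"
      by (rule borel_measurable_continuous_on[OF _ elementaryD(4)[OF x i]], intro continuous_intros)
    show 3: "?U i n e \<in> borel_measurable (F (a i))" using 1 2 by measurable
    obtain c where "\<And>\<omega>. \<omega> \<in> space M \<Longrightarrow> norm (\<eta> \<omega>) \<le> c" using \<eta>(2) by (auto simp: bounded_iff)
    then have "bounded ((\<lambda>\<omega>. \<eta> \<omega> $ n) ` space M)"
      unfolding bounded_iff by (auto intro!: exI[of _ c] order_trans[OF component_le_norm_cart])
    then show "integrable M (?U i n e)"
      by (intro integrable_bounded measurable_F_M[OF 3] bounded_mult_image bounded_component_image elementaryD(5)[OF x i])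
  qed (use elementaryD(2,3)[OF x i] in auto)
  then have "has_bochner_integral M (\<lambda>\<omega>. \<Sum>i\<in>I. \<Sum>n\<in>UNIV. \<Sum>e\<in>UNIV. ?U i n e \<omega> * (W (b i) \<omega> - W (a i) \<omega>) $ e)
     (\<Sum>i\<in>I. \<Sum>n\<in>(UNIV::'n set). \<Sum>e\<in>(UNIV::'d set). 0)"
    by (intro has_bochner_integral_sum)
  then show ?thesis unfolding eq by simp
qed

text \<open>Since \<open>A\<close> is known at time \<open>s\<close> and no interval starts earlier,
  \<open>A \<omega> ** \<xi> i \<omega>\<close> is an admissible coefficient; the bilinear isometry
  is applied to the two families.\<close>

lemma elem_quadratic_form:
  fixes A :: "'w \<Rightarrow> real^'n^'n"
  assumes x: "elementary I a b \<xi>" and s: "\<And>i. i \<in> I \<Longrightarrow> s \<le> a i"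
    and A: "A \<in> borel_measurable (F s)" "bounded (A ` space M)"
  shows "expectation (\<lambda>\<omega>. elem_integral I a b \<xi> \<omega> \<bullet> (A \<omega> *v elem_integral I a b \<xi> \<omega>))
     = expectation (\<lambda>\<omega>. LINT u|lborel. elem_process I a b \<xi> u \<omega> \<bullet> (A \<omega> ** elem_process I a b \<xi> u \<omega>))"
proof -
  let ?\<zeta> = "\<lambda>i \<omega>. A \<omega> ** \<xi> i \<omega>"
  have z: "elementary I a b ?\<zeta>"
    unfolding elementary_def
  proof (intro conjI ballI)
    fix i assume i: "i \<in> I"
    have "continuous_on UNIV (\<lambda>z :: (real^'n^'n) \<times> (real^'d^'n). fst z ** snd z)"
      by (intro continuous_intros continuous_on_matrix_mult)
    from borel_measurable_continuous_Pair[OF measurable_F_mono[OF A(1) s[OF i]] elementaryD(4)[OF x i] this]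
    show "?\<zeta> i \<in> borel_measurable (F (a i))" .
    obtain c d where c: "\<And>\<omega>. \<omega> \<in> space M \<Longrightarrow> norm (A \<omega>) \<le> c" and d: "\<And>\<omega>. \<omega> \<in> space M \<Longrightarrow> norm (\<xi> i \<omega>) \<le> d"
      using A(2) elementaryD(5)[OF x i] by (auto simp: bounded_iff)
    have "norm (?\<zeta> i \<omega>) \<le> c * d" if "\<omega> \<in> space M" for \<omega>
      using norm_matrix_matrix_mult_le[of "A \<omega>" "\<xi> i \<omega>"] mult_mono[OF c[OF that] d[OF that]]
        order_trans[OF norm_ge_zero c[OF that]] by simp
    then show "bounded (?\<zeta> i ` space M)" by (auto simp: bounded_iff)
  qed (use elementaryD[OF x] in auto)
  have e: "elem_integral I a b ?\<zeta> \<omega> = A \<omega> *v elem_integral I a b \<xi> \<omega>" for \<omega>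
    by (simp add: elem_integral_def matrix_vector_mul_assoc[symmetric] linear_sum[OF matrix_vector_mul_linear])
  have st: "elem_process I a b ?\<zeta> u \<omega> = A \<omega> ** elem_process I a b \<xi> u \<omega>" for u \<omega>
    by (simp add: elem_process_def linear_sum[OF linear_matrix_mult] linear_cmul[OF linear_matrix_mult])
  show ?thesis using elem_isometry(3)[OF x z] by (simp add: e st)
qed

text \<open>On the product of the probability space with \<open>(s, t]\<close> the processes are
  bounded functions, and the hypothesis on \<open>sqdist\<close> implies mean square convergence
  there. The limit theorem for quadratic functionals applies, and Fubini's theorem translates
  back.\<close>

lemma quadratic_variation_tendsto:
  fixes A :: "'w \<Rightarrow> real^'n^'n" and Hm :: "real \<Rightarrow> 'w \<Rightarrow> real^'d^'n"
  assumes st: "0 \<le> s" "s < t"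
    and jZ: "\<And>r. jointly_measurable M (Z r)" and jH: "jointly_measurable M Hm"
    and C: "C \<ge> 0" "\<And>u \<omega>. \<omega> \<in> space M \<Longrightarrow> norm (Hm u \<omega>) \<le> C" "\<And>r u \<omega>. norm (Z r u \<omega>) \<le> C"
    and lim: "(\<lambda>r::nat. \<integral>\<^sup>+\<omega>. sqdist t (Z r) Hm \<omega> \<partial>M) \<longlonglongrightarrow> 0"
    and A: "A \<in> borel_measurable M" and c: "\<And>\<omega>. \<omega> \<in> space M \<Longrightarrow> norm (A \<omega>) \<le> c"
  shows "(\<lambda>r. expectation (\<lambda>\<omega>. LINT u:{s<..t}|lborel. Z r u \<omega> \<bullet> (A \<omega> ** Z r u \<omega>)))
       \<longlonglongrightarrow> expectation (\<lambda>\<omega>. LINT u:{s<..t}|lborel. Hm u \<omega> \<bullet> (A \<omega> ** Hm u \<omega>))"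
    and "integrable M (\<lambda>\<omega>. LINT u:{s<..t}|lborel. Hm u \<omega> \<bullet> (A \<omega> ** Hm u \<omega>))"
proof -
  let ?L = "restrict_space lborel {s<..t}"
  let ?N = "M \<Otimes>\<^sub>M ?L"
  interpret L: finite_measure ?L
    using st by (intro finite_measureI) (simp add: space_restrict_space emeasure_restrict_space)
  interpret P: pair_sigma_finite M ?L ..
  have emN: "emeasure ?N (space ?N) = ennreal (t - s)"
  proof -
    have "emeasure ?N (space M \<times> space ?L) = emeasure M (space M) * emeasure ?L (space ?L)"
      by (rule L.emeasure_pair_measure_Times[OF sets.top sets.top])
    then show ?thesis using st
      by (simp add: space_pair_measure emeasure_space_1 space_restrict_space emeasure_restrict_space)
  qed
  interpret N: finite_measure ?N using emN by (intro finite_measureI) simp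
  have id: "(\<lambda>z. z) \<in> measurable ?N (M \<Otimes>\<^sub>M lborel)"
  proof -
    have "(\<lambda>u. u) \<in> measurable ?L lborel" by (intro measurable_restrict_space1) simp
    from measurable_Pair[OF measurable_fst measurable_compose[OF measurable_snd this]] show ?thesis by simp
  qed
  have jN: "(\<lambda>z. G (snd z) (fst z)) \<in> borel_measurable ?N" if "jointly_measurable M G" for G :: "real \<Rightarrow> 'w \<Rightarrow> real^'d^'n"
    using measurable_compose[OF id that] by simp
  have c0: "0 \<le> c" using c not_empty norm_ge_zero order_trans by blast
  have cont: "continuous_on UNIV (\<lambda>z :: (real^'n^'n) \<times> (real^'d^'n). snd z \<bullet> (fst z ** snd z))"
      by (intro continuous_intros continuous_on_matrix_mult)
  have int: "integrable ?N (\<lambda>z. G (snd z) (fst z) \<bullet> (A (fst z) ** G (snd z) (fst z)))"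
    if G: "jointly_measurable M G" "\<And>u \<omega>. \<omega> \<in> space M \<Longrightarrow> norm (G u \<omega>) \<le> C" for G :: "real \<Rightarrow> 'w \<Rightarrow> real^'d^'n"
  proof (rule N.integrable_const_bound[where B="C * (c * C)"])
    show "AE z in ?N. norm (G (snd z) (fst z) \<bullet> (A (fst z) ** G (snd z) (fst z))) \<le> C * (c * C)"
    proof (rule AE_I2)
      fix z assume "z \<in> space ?N"
      then have w: "fst z \<in> space M" by (auto simp: space_pair_measure)
      have AG: "norm (A (fst z) ** G (snd z) (fst z)) \<le> c * C"
        by (rule order_trans[OF norm_matrix_matrix_mult_le mult_mono[OF c[OF w] G(2)[OF w] c0]]) simp
      show "norm (G (snd z) (fst z) \<bullet> (A (fst z) ** G (snd z) (fst z))) \<le> C * (c * C)"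
        using order_trans[OF Cauchy_Schwarz_ineq2 mult_mono[OF G(2)[OF w] AG C(1) norm_ge_zero]] by simp
    qed
    have "(\<lambda>z. A (fst z)) \<in> borel_measurable ?N" using A by measurable
    from borel_measurable_continuous_Pair[OF this jN[OF G(1)] cont]
    show "(\<lambda>z. G (snd z) (fst z) \<bullet> (A (fst z) ** G (snd z) (fst z))) \<in> borel_measurable ?N" by simp
  qed
  have fub: "(\<integral>z. G (snd z) (fst z) \<bullet> (A (fst z) ** G (snd z) (fst z)) \<partial>?N) = expectation (\<lambda>\<omega>. LINT u:{s<..t}|lborel. G u \<omega> \<bullet> (A \<omega> ** G u \<omega>))"
     "integrable M (\<lambda>\<omega>. LINT u:{s<..t}|lborel. G u \<omega> \<bullet> (A \<omega> ** G u \<omega>))"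
    if G: "jointly_measurable M G" "\<And>u \<omega>. \<omega> \<in> space M \<Longrightarrow> norm (G u \<omega>) \<le> C" for G :: "real \<Rightarrow> 'w \<Rightarrow> real^'d^'n"
    using P.integral_fst'[OF int[OF G]] P.integrable_fst'[OF int[OF G]]
    by (simp_all add: integral_restrict_space set_lebesgue_integral_def)
  show "integrable M (\<lambda>\<omega>. LINT u:{s<..t}|lborel. Hm u \<omega> \<bullet> (A \<omega> ** Hm u \<omega>))"
    by (rule fub(2)[OF jH C(2)])
  have conv: "(\<lambda>r. \<integral>z. Z r (snd z) (fst z) \<bullet> (A (fst z) ** Z r (snd z) (fst z)) \<partial>?N)
     \<longlonglongrightarrow> (\<integral>z. Hm (snd z) (fst z) \<bullet> (A (fst z) ** Hm (snd z) (fst z)) \<partial>?N)"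
  proof (rule N.quadratic_functional_tendsto[where a="\<lambda>z. Hm (snd z) (fst z)" and b="\<lambda>r z. Z r (snd z) (fst z)"
        and V="(1 + C)\<^sup>2 * (t - s)" and c="2 * c"])
    have "(\<integral>\<^sup>+z. ennreal ((norm (Z r (snd z) (fst z) - Hm (snd z) (fst z)))\<^sup>2) \<partial>?N) \<le> (\<integral>\<^sup>+\<omega>. sqdist t (Z r) Hm \<omega> \<partial>M)" for r
    proof -
      have "(\<lambda>z. ennreal ((norm (Z r (snd z) (fst z) - Hm (snd z) (fst z)))\<^sup>2)) \<in> borel_measurable ?N"
        using jN[OF jZ[of r]] jN[OF jH] by measurable
      from L.nn_integral_fst[OF this, symmetric]
      have "(\<integral>\<^sup>+z. ennreal ((norm (Z r (snd z) (fst z) - Hm (snd z) (fst z)))\<^sup>2) \<partial>?N)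
        = (\<integral>\<^sup>+\<omega>. (\<integral>\<^sup>+u. ennreal ((norm (Z r u \<omega> - Hm u \<omega>))\<^sup>2) \<partial>?L) \<partial>M)" by simp
      also have "\<dots> \<le> (\<integral>\<^sup>+\<omega>. sqdist t (Z r) Hm \<omega> \<partial>M)"
        unfolding sqdist_def using st
        by (intro nn_integral_mono) (auto simp: nn_integral_restrict_space intro!: nn_integral_mono split: split_indicator)
      finally show ?thesis .
    qed
    then show "(\<lambda>r. \<integral>\<^sup>+z. ennreal ((norm (Z r (snd z) (fst z) - Hm (snd z) (fst z)))\<^sup>2) \<partial>?N) \<longlonglongrightarrow> 0"
      by (intro tendsto_sandwich[OF _ _ tendsto_const lim]) auto
    fix r
    have "(\<integral>\<^sup>+z. ennreal ((1 + norm (Z r (snd z) (fst z)))\<^sup>2) \<partial>?N) \<le> (\<integral>\<^sup>+z. ennreal ((1 + C)\<^sup>2) \<partial>?N)"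
      using C(3) by (intro nn_integral_mono ennreal_leI power_mono) auto
    also have "\<dots> = ennreal ((1 + C)\<^sup>2 * (t - s))" using st emN by (simp add: ennreal_mult)
    finally show "(\<integral>\<^sup>+z. ennreal ((1 + norm (Z r (snd z) (fst z)))\<^sup>2) \<partial>?N) \<le> ennreal ((1 + C)\<^sup>2 * (t - s))" .
    fix z assume "z \<in> space ?N"
    then have w: "fst z \<in> space M" by (auto simp: space_pair_measure)
    show "\<bar>Z r (snd z) (fst z) \<bullet> (A (fst z) ** Z r (snd z) (fst z)) - Hm (snd z) (fst z) \<bullet> (A (fst z) ** Hm (snd z) (fst z))\<bar>
      \<le> 2 * c * ((1 + norm (Z r (snd z) (fst z))) * norm (Z r (snd z) (fst z) - Hm (snd z) (fst z)) + (norm (Z r (snd z) (fst z) - Hm (snd z) (fst z)))\<^sup>2)"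
    proof (rule quadratic_form_diff_le)
      show "linear (\<lambda>X :: real^'d^'n. A (fst z) ** X)"
        by (rule linear_matrix_mult)
      show "norm (A (fst z) ** X) \<le> c * norm X" for X :: "real^'d^'n"
        by (rule order_trans[OF norm_matrix_matrix_mult_le mult_right_mono[OF c[OF w]]]) simp
    qed (rule c0)
  qed (use int[OF jH C(2)] int[OF jZ] C(3) jN[OF jZ] jN[OF jH] st c0 in auto)
  have fubH: "(\<integral>z. Hm (snd z) (fst z) \<bullet> (A (fst z) ** Hm (snd z) (fst z)) \<partial>?N) = expectation (\<lambda>\<omega>. LINT u:{s<..t}|lborel. Hm u \<omega> \<bullet> (A \<omega> ** Hm u \<omega>))"
    by (rule fub(1)[OF jH C(2)])
  have fubZ: "(\<integral>z. Z r (snd z) (fst z) \<bullet> (A (fst z) ** Z r (snd z) (fst z)) \<partial>?N) = expectation (\<lambda>\<omega>. LINT u:{s<..t}|lborel. Z r u \<omega> \<bullet> (A \<omega> ** Z r u \<omega>))" for r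
    by (rule fub(1)[OF jZ C(3)])
  show "(\<lambda>r. expectation (\<lambda>\<omega>. LINT u:{s<..t}|lborel. Z r u \<omega> \<bullet> (A \<omega> ** Z r u \<omega>)))
       \<longlonglongrightarrow> expectation (\<lambda>\<omega>. LINT u:{s<..t}|lborel. Hm u \<omega> \<bullet> (A \<omega> ** Hm u \<omega>))"
    using conv unfolding fubH fubZ .
qed

text \<open>The three facts share one approximation: elementary integrals \<open>?I r\<close> over
  the window \<open>(s, t]\<close> that converge to \<open>J1 - J0\<close> in mean square and have
  uniformly bounded fourth moments. The fourth moment of the limit follows by Fatou's lemma, the
  other two facts by passing to the limit in functionals of at most quadratic growth.\<close>

lemma
  fixes H Hm :: "real \<Rightarrow> 'w \<Rightarrow> real^'d^'n" and J0 J1 :: "'w \<Rightarrow> real^'n"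
  assumes ito0: "has_ito_integral M F W H s J0" and ito1: "has_ito_integral M F W H t J1"
    and st: "0 \<le> s" "s < t"
    and Hm: "jointly_measurable M Hm" and C: "C \<ge> 0" "\<And>u \<omega>. \<omega> \<in> space M \<Longrightarrow> norm (Hm u \<omega>) \<le> C"
    and eq: "AE \<omega> in M. \<forall>u\<in>{0<..t}. H u \<omega> = Hm u \<omega>"
  shows ito_increment_fourth_moment:
      "(\<integral>\<^sup>+\<omega>. ennreal (norm (J1 \<omega> - J0 \<omega>) ^ 4) \<partial>M) \<le> ennreal (48 * (real CARD('n))\<^sup>2 * exp (C\<^sup>2 / 2) * (t - s)\<^sup>2)"
    and ito_increment_mean:
      "\<eta> \<in> borel_measurable (F s) \<Longrightarrow> bounded (\<eta> ` space M) \<Longrightarrow>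
        has_bochner_integral M (\<lambda>\<omega>. \<eta> \<omega> \<bullet> (J1 \<omega> - J0 \<omega>)) 0"
    and ito_increment_quadratic:
      "A \<in> borel_measurable (F s) \<Longrightarrow> bounded (A ` space M) \<Longrightarrow>
        integrable M (\<lambda>\<omega>. LINT u:{s<..t}|lborel. Hm u \<omega> \<bullet> (A \<omega> ** Hm u \<omega>)) \<and>
        has_bochner_integral M (\<lambda>\<omega>. (J1 \<omega> - J0 \<omega>) \<bullet> (A \<omega> *v (J1 \<omega> - J0 \<omega>)))
          (expectation (\<lambda>\<omega>. LINT u:{s<..t}|lborel. Hm u \<omega> \<bullet> (A \<omega> ** Hm u \<omega>)))"
proof -
  have t: "0 \<le> t" using st by simp
  let ?K = "48 * (real CARD('n))\<^sup>2 * exp (C\<^sup>2 / 2) * (t - s)\<^sup>2"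
  let ?J = "\<lambda>\<omega>. J1 \<omega> - J0 \<omega>"
  have K0: "0 \<le> ?K" by simp
  have [measurable]: "J0 \<in> borel_measurable M" "J1 \<in> borel_measurable M"
    using ito0 ito1 by (auto simp: has_ito_integral_def)
  obtain k p \<zeta> where S: "\<And>r::nat. simple_integrand M F (k r) (p r) (\<zeta> r)" and Zb: "\<And>r i \<omega>. norm (\<zeta> r i \<omega>) \<le> C"
    and lim: "(\<lambda>r. \<integral>\<^sup>+\<omega>. sqdist t (simple_process (k r) (p r) (\<zeta> r)) Hm \<omega> \<partial>M) \<longlonglongrightarrow> 0"
    and key1: "\<And>k' p' \<xi>'. simple_integrand M F k' p' \<xi>' \<Longrightarrow>
        (\<integral>\<^sup>+\<omega>. ennreal ((norm (simple_integral W k' p' \<xi>' t \<omega> - J1 \<omega>))\<^sup>2) \<partial>M)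
          \<le> 2 * (\<integral>\<^sup>+\<omega>. sqdist t (simple_process k' p' \<xi>') Hm \<omega> \<partial>M)"
    using ito_approximation[OF ito1 t Hm C eq] by blast
  have eq0: "AE \<omega> in M. \<forall>u\<in>{0<..s}. H u \<omega> = Hm u \<omega>"
    using eq by (rule eventually_mono) (use st in auto)
  \<comment> \<open>The approximating sequence belongs to \<open>J1\<close>; the estimate for
    arbitrary simple integrands makes it serve \<open>J0\<close> too.\<close>
  have key0: "(\<integral>\<^sup>+\<omega>. ennreal ((norm (simple_integral W k' p' \<xi>' s \<omega> - J0 \<omega>))\<^sup>2) \<partial>M)
          \<le> 2 * (\<integral>\<^sup>+\<omega>. sqdist s (simple_process k' p' \<xi>') Hm \<omega> \<partial>M)"
    if G: "simple_integrand M F k' p' \<xi>'" for k' p' \<xi>'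
  proof (rule ito_approximation[OF ito0 st(1) Hm C eq0])
    assume "\<And>k' p' \<xi>'. simple_integrand M F k' p' \<xi>' \<Longrightarrow>
        (\<integral>\<^sup>+\<omega>. ennreal ((norm (simple_integral W k' p' \<xi>' s \<omega> - J0 \<omega>))\<^sup>2) \<partial>M)
          \<le> 2 * (\<integral>\<^sup>+\<omega>. sqdist s (simple_process k' p' \<xi>') Hm \<omega> \<partial>M)"
    from this[OF G] show ?thesis .
  qed
  let ?Z = "\<lambda>r. simple_process (k r) (p r) (\<zeta> r)"
  let ?a = "\<lambda>r i. clip s t (p r i)" and ?b = "\<lambda>r i. clip s t (p r (Suc i))"
  let ?\<xi> = "\<lambda>r i \<omega>. if p r i < t then \<zeta> r i \<omega> else 0"
  let ?I = "\<lambda>r. elem_integral {..<k r} (?a r) (?b r) (?\<xi> r)"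
  note elementary = simple_increment(1)[OF S st(1) less_imp_le[OF st(2)]]
  note incr = simple_increment(2)[OF S st(1) less_imp_le[OF st(2)]]
  note step = simple_increment(3)[OF S st(1) less_imp_le[OF st(2)]]
  note jZ = simple_process_jointly_measurable[OF S]
  have ZC: "norm (?Z r u \<omega>) \<le> C" for r u \<omega>
    using simple_process_cases[of "k r" "p r" u, OF simple_integrandD(2)[OF S]] Zb C(1) by (metis norm_zero)
  note [measurable] = elem_integral_measurable[OF elementary] simple_integral_measurable[OF S t] simple_integral_measurable[OF S st(1)]
    sqdist_measurable[OF jZ Hm]
  have D2: "(\<integral>\<^sup>+\<omega>. ennreal ((norm (?I r \<omega> - ?J \<omega>))\<^sup>2) \<partial>M) \<le> 8 * (\<integral>\<^sup>+\<omega>. sqdist t (?Z r) Hm \<omega> \<partial>M)" for r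
  proof -
    let ?X1 = "\<lambda>\<omega>. simple_integral W (k r) (p r) (\<zeta> r) t \<omega> - J1 \<omega>"
    let ?X0 = "\<lambda>\<omega>. simple_integral W (k r) (p r) (\<zeta> r) s \<omega> - J0 \<omega>"
    have "(\<integral>\<^sup>+\<omega>. ennreal ((norm (?I r \<omega> - ?J \<omega>))\<^sup>2) \<partial>M) \<le> (\<integral>\<^sup>+\<omega>. 2 * ennreal ((norm (?X1 \<omega>))\<^sup>2) + 2 * ennreal ((norm (?X0 \<omega>))\<^sup>2) \<partial>M)"
    proof (intro nn_integral_mono)
      fix \<omega>
      have "?I r \<omega> - ?J \<omega> = ?X1 \<omega> - ?X0 \<omega>" using incr[of r \<omega>] by (simp add: algebra_simps)
      then have "(norm (?I r \<omega> - ?J \<omega>))\<^sup>2 \<le> 2 * (norm (?X1 \<omega>))\<^sup>2 + 2 * (norm (?X0 \<omega>))\<^sup>2"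
        using sum_squares_le[of "?X1 \<omega>" "?X0 \<omega>" 0] by (simp only: diff_0_right diff_0 norm_minus_cancel)
      then have "ennreal ((norm (?I r \<omega> - ?J \<omega>))\<^sup>2) \<le> ennreal (2 * (norm (?X1 \<omega>))\<^sup>2 + 2 * (norm (?X0 \<omega>))\<^sup>2)"
        by (rule ennreal_leI)
      also have "\<dots> = 2 * ennreal ((norm (?X1 \<omega>))\<^sup>2) + 2 * ennreal ((norm (?X0 \<omega>))\<^sup>2)"
        by (simp add: ennreal_plus ennreal_mult)
      finally show "ennreal ((norm (?I r \<omega> - ?J \<omega>))\<^sup>2) \<le> 2 * ennreal ((norm (?X1 \<omega>))\<^sup>2) + 2 * ennreal ((norm (?X0 \<omega>))\<^sup>2)" .
    qed
    also have "\<dots> = 2 * (\<integral>\<^sup>+\<omega>. ennreal ((norm (?X1 \<omega>))\<^sup>2) \<partial>M) + 2 * (\<integral>\<^sup>+\<omega>. ennreal ((norm (?X0 \<omega>))\<^sup>2) \<partial>M)"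
      by (simp add: nn_integral_add nn_integral_cmult)
    also have "\<dots> \<le> 2 * (2 * (\<integral>\<^sup>+\<omega>. sqdist t (?Z r) Hm \<omega> \<partial>M)) + 2 * (2 * (\<integral>\<^sup>+\<omega>. sqdist t (?Z r) Hm \<omega> \<partial>M))"
    proof (intro add_mono mult_left_mono key1 S)
      have "(\<integral>\<^sup>+\<omega>. sqdist s (?Z r) Hm \<omega> \<partial>M) \<le> (\<integral>\<^sup>+\<omega>. sqdist t (?Z r) Hm \<omega> \<partial>M)"
        using st by (intro nn_integral_mono sqdist_mono_time) simp
      then show "(\<integral>\<^sup>+\<omega>. ennreal ((norm (?X0 \<omega>))\<^sup>2) \<partial>M) \<le> 2 * (\<integral>\<^sup>+\<omega>. sqdist t (?Z r) Hm \<omega> \<partial>M)"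
        by (intro order_trans[OF key0[OF S]] mult_left_mono) auto
    qed auto
    also have "\<dots> = 8 * (\<integral>\<^sup>+\<omega>. sqdist t (?Z r) Hm \<omega> \<partial>M)" by (simp add: mult.assoc[symmetric] flip: distrib_right)
    finally show ?thesis .
  qed
  have lim2: "(\<lambda>r. \<integral>\<^sup>+\<omega>. ennreal ((norm (?I r \<omega> - ?J \<omega>))\<^sup>2) \<partial>M) \<longlonglongrightarrow> 0"
  proof (rule tendsto_sandwich[OF _ _ tendsto_const])
    show "(\<lambda>r. 8 * (\<integral>\<^sup>+\<omega>. sqdist t (?Z r) Hm \<omega> \<partial>M)) \<longlonglongrightarrow> 0"
      using ennreal_tendsto_cmult[OF _ lim, of 8] by simp
  qed (auto simp: D2)
  have sumlen: "(\<Sum>i<k r. ?b r i - ?a r i) \<le> t - s" for r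
    using sum_lessThan_telescope[of "\<lambda>i. clip s t (p r i)" "k r"] st
      clip_bounds[of s t "p r (k r)"] clip_bounds[of s t "p r 0"] by simp
  have I4: "(\<integral>\<^sup>+\<omega>. ennreal (norm (?I r \<omega>) ^ 4) \<partial>M) \<le> ennreal ?K" for r
    by (rule elem_fourth_moment[OF elementary clip_disjoint[OF S] _ sumlen]) (use Zb C(1) st in auto)
  have int2: "integrable M (\<lambda>\<omega>. (norm (?I r \<omega> - ?J \<omega>))\<^sup>2)" for r
  proof (rule integrableI_bounded)
    have "(\<integral>\<^sup>+\<omega>. sqdist t (?Z r) Hm \<omega> \<partial>M) \<le> (\<integral>\<^sup>+\<omega>. ennreal ((2 * C)\<^sup>2 * t) \<partial>M)"
      by (intro nn_integral_mono sqdist_bound ZC C(2) t)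
    then have "(\<integral>\<^sup>+\<omega>. sqdist t (?Z r) Hm \<omega> \<partial>M) < top" by (simp add: emeasure_space_1 le_less_trans)
    then have "8 * (\<integral>\<^sup>+\<omega>. sqdist t (?Z r) Hm \<omega> \<partial>M) < top" by (simp add: ennreal_mult_less_top)
    then show "(\<integral>\<^sup>+\<omega>. ennreal (norm ((norm (?I r \<omega> - ?J \<omega>))\<^sup>2)) \<partial>M) < \<infinity>"
      using D2[of r] by (simp add: le_less_trans)
  qed measurable
  have "(\<lambda>r. ennreal (\<integral>\<omega>. norm ((norm (?I r \<omega> - ?J \<omega>))\<^sup>2) \<partial>M)) \<longlonglongrightarrow> ennreal 0"
    using lim2 int2 by (subst (asm) nn_integral_eq_integral) auto
  then have "(\<lambda>r. \<integral>\<omega>. norm ((norm (?I r \<omega> - ?J \<omega>))\<^sup>2) \<partial>M) \<longlonglongrightarrow> 0"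
    by (subst (asm) tendsto_ennreal_iff) auto
  from tendsto_L1_AE_subseq[OF int2 this] obtain q
    where q: "AE \<omega> in M. (\<lambda>r. (norm (?I (q r) \<omega> - ?J \<omega>))\<^sup>2) \<longlonglongrightarrow> 0" by auto
  show J4: "(\<integral>\<^sup>+\<omega>. ennreal (norm (?J \<omega>) ^ 4) \<partial>M) \<le> ennreal ?K"
  proof -
    have "(\<integral>\<^sup>+\<omega>. ennreal (norm (?J \<omega>) ^ 4) \<partial>M) = (\<integral>\<^sup>+\<omega>. liminf (\<lambda>r. ennreal (norm (?I (q r) \<omega>) ^ 4)) \<partial>M)"
      using q
    proof (intro nn_integral_cong_AE, eventually_elim)
      case (elim \<omega>)
      have "(\<lambda>r. norm (?I (q r) \<omega> - ?J \<omega>)) \<longlonglongrightarrow> 0"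
        using tendsto_real_sqrt[OF elim(2)] by simp
      then have "(\<lambda>r. ?I (q r) \<omega>) \<longlonglongrightarrow> ?J \<omega>"
        by (simp only: tendsto_norm_zero_iff LIM_zero_iff)
      then have "(\<lambda>r. ennreal (norm (?I (q r) \<omega>) ^ 4)) \<longlonglongrightarrow> ennreal (norm (?J \<omega>) ^ 4)"
        by (intro tendsto_ennrealI tendsto_intros)
      from lim_imp_Liminf[OF _ this] show ?case by (metis trivial_limit_sequentially)
    qed
    also have "\<dots> \<le> liminf (\<lambda>r. \<integral>\<^sup>+\<omega>. ennreal (norm (?I (q r) \<omega>) ^ 4) \<partial>M)"
      by (rule nn_integral_liminf) measurable
    also have "\<dots> \<le> liminf (\<lambda>r::nat. ennreal ?K)"
      by (intro Liminf_mono always_eventually allI I4)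
    also have "\<dots> = ennreal ?K" by (simp add: Liminf_const)
    finally show ?thesis .
  qed
  have V: "(\<integral>\<^sup>+\<omega>. ennreal ((1 + norm (?I r \<omega>))\<^sup>2) \<partial>M) \<le> ennreal (4 + 2 * ?K)" for r
  proof -
    have "(\<integral>\<^sup>+\<omega>. ennreal ((1 + norm (?I r \<omega>))\<^sup>2) \<partial>M) \<le> (\<integral>\<^sup>+\<omega>. 4 + 2 * ennreal (norm (?I r \<omega>) ^ 4) \<partial>M)"
    proof (intro nn_integral_mono)
      fix \<omega>
      have "(1 + norm (?I r \<omega>))\<^sup>2 \<le> 4 + 2 * norm (?I r \<omega>) ^ 4"
        using power2_le_quartic[of "norm (?I r \<omega>)"] sum_squares_bound[of 1 "norm (?I r \<omega>)"] by (simp add: power2_sum)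
      then have "ennreal ((1 + norm (?I r \<omega>))\<^sup>2) \<le> ennreal (4 + 2 * norm (?I r \<omega>) ^ 4)" by (rule ennreal_leI)
      then show "ennreal ((1 + norm (?I r \<omega>))\<^sup>2) \<le> 4 + 2 * ennreal (norm (?I r \<omega>) ^ 4)"
        by (simp add: ennreal_plus ennreal_mult)
    qed
    also have "\<dots> = 4 + 2 * (\<integral>\<^sup>+\<omega>. ennreal (norm (?I r \<omega>) ^ 4) \<partial>M)"
      by (simp add: nn_integral_add nn_integral_cmult emeasure_space_1)
    also have "\<dots> \<le> 4 + 2 * ennreal ?K" by (intro add_left_mono mult_left_mono I4) auto
    also have "\<dots> = ennreal (4 + 2 * ?K)"
    proof -
      have "4 + 2 * ennreal x = ennreal (4 + 2 * x)" if "0 \<le> x" for x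
        using that by (simp add: ennreal_plus ennreal_mult)
      from this[OF K0] show ?thesis .
    qed
    finally show ?thesis .
  qed
  have Ja: "s \<le> ?a r i" for r i using clip_bounds(1) st by auto
  show "has_bochner_integral M (\<lambda>\<omega>. \<eta> \<omega> \<bullet> (J1 \<omega> - J0 \<omega>)) 0"
    if \<eta>: "\<eta> \<in> borel_measurable (F s)" "bounded (\<eta> ` space M)"
  proof -
    note [measurable] = measurable_F_M[OF \<eta>(1)]
    obtain c where c: "\<And>\<omega>. \<omega> \<in> space M \<Longrightarrow> norm (\<eta> \<omega>) \<le> c" using \<eta>(2) by (auto simp: bounded_iff)
    have c0: "0 \<le> c" using c not_empty norm_ge_zero order_trans by blast
    have zero: "has_bochner_integral M (\<lambda>\<omega>. \<eta> \<omega> \<bullet> ?I r \<omega>) 0" for r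
      by (rule inner_elem_mean_zero[OF elementary Ja \<eta>])
    have iJ: "integrable M (\<lambda>\<omega>. \<eta> \<omega> \<bullet> ?J \<omega>)"
    proof (rule integrable_quartic_growth[OF _ _ J4, where c="2 * c"])
      show "AE \<omega> in M. \<bar>\<eta> \<omega> \<bullet> ?J \<omega>\<bar> \<le> 2 * c * (1 + norm (?J \<omega>) ^ 4)"
      proof (rule AE_I2)
        fix \<omega> assume w: "\<omega> \<in> space M"
        have "norm (?J \<omega>) \<le> 1 + (norm (?J \<omega>))\<^sup>2" using sum_squares_bound[of 1 "norm (?J \<omega>)"] zero_le_power2[of "norm (?J \<omega>)"]
          unfolding one_power2 mult_1_right by linarith
        then have "norm (?J \<omega>) \<le> 2 * (1 + norm (?J \<omega>) ^ 4)" using power2_le_quartic[of "norm (?J \<omega>)"]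
          zero_le_power[OF norm_ge_zero[of "?J \<omega>"], of 4] unfolding distrib_left by linarith
        then have "c * norm (?J \<omega>) \<le> c * (2 * (1 + norm (?J \<omega>) ^ 4))" using c0 by (rule mult_left_mono)
        moreover have "\<bar>\<eta> \<omega> \<bullet> ?J \<omega>\<bar> \<le> c * norm (?J \<omega>)"
          by (rule order_trans[OF Cauchy_Schwarz_ineq2 mult_right_mono[OF c[OF w]]]) simp
        ultimately show "\<bar>\<eta> \<omega> \<bullet> ?J \<omega>\<bar> \<le> 2 * c * (1 + norm (?J \<omega>) ^ 4)"
          unfolding mult.left_commute[of c 2] mult.assoc by linarith
      qed
    qed measurable
    have "(\<lambda>r. expectation (\<lambda>\<omega>. \<eta> \<omega> \<bullet> ?I r \<omega>)) \<longlonglongrightarrow> expectation (\<lambda>\<omega>. \<eta> \<omega> \<bullet> ?J \<omega>)"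
    proof (rule quadratic_functional_tendsto[OF _ _ lim2 V _ c0 iJ])
      fix r \<omega> assume w: "\<omega> \<in> space M"
      have "\<bar>\<eta> \<omega> \<bullet> ?I r \<omega> - \<eta> \<omega> \<bullet> ?J \<omega>\<bar> \<le> c * norm (?I r \<omega> - ?J \<omega>)"
        unfolding inner_diff_right[symmetric] by (rule order_trans[OF Cauchy_Schwarz_ineq2 mult_right_mono[OF c[OF w]]]) simp
      also have "\<dots> \<le> c * ((1 + norm (?I r \<omega>)) * norm (?I r \<omega> - ?J \<omega>) + (norm (?I r \<omega> - ?J \<omega>))\<^sup>2)"
        using c0 by (intro mult_left_mono) (auto simp: distrib_right)
      finally show "\<bar>\<eta> \<omega> \<bullet> ?I r \<omega> - \<eta> \<omega> \<bullet> ?J \<omega>\<bar> \<le> c * ((1 + norm (?I r \<omega>)) * norm (?I r \<omega> - ?J \<omega>) + (norm (?I r \<omega> - ?J \<omega>))\<^sup>2)" .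
    qed (use zero K0 in \<open>auto simp: has_bochner_integral_iff\<close>)
    then have "expectation (\<lambda>\<omega>. \<eta> \<omega> \<bullet> ?J \<omega>) = 0"
      unfolding has_bochner_integral_integral_eq[OF zero] by (simp only: LIMSEQ_const_iff)
    with iJ show ?thesis by (simp add: has_bochner_integral_iff)
  qed
  show "integrable M (\<lambda>\<omega>. LINT u:{s<..t}|lborel. Hm u \<omega> \<bullet> (A \<omega> ** Hm u \<omega>)) \<and>
        has_bochner_integral M (\<lambda>\<omega>. (J1 \<omega> - J0 \<omega>) \<bullet> (A \<omega> *v (J1 \<omega> - J0 \<omega>)))
          (expectation (\<lambda>\<omega>. LINT u:{s<..t}|lborel. Hm u \<omega> \<bullet> (A \<omega> ** Hm u \<omega>)))"
    if A: "A \<in> borel_measurable (F s)" "bounded (A ` space M)"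
  proof -
    note AM[measurable] = measurable_F_M[OF A(1)]
    obtain c where c: "\<And>\<omega>. \<omega> \<in> space M \<Longrightarrow> norm (A \<omega>) \<le> c" using A(2) by (auto simp: bounded_iff)
    have c0: "0 \<le> c" using c not_empty norm_ge_zero order_trans by blast
    have Ac: "norm (A \<omega> *v x) \<le> c * norm x" if "\<omega> \<in> space M" for \<omega> x
      by (rule order_trans[OF norm_matrix_vector_mult_le mult_right_mono[OF c[OF that]]]) simp
    have cont: "continuous_on UNIV (\<lambda>z :: (real^'n^'n) \<times> (real^'n). snd z \<bullet> (fst z *v snd z))"
      by (intro continuous_intros continuous_on_matrix_mult)
    have qi: "integrable M (\<lambda>\<omega>. X \<omega> \<bullet> (A \<omega> *v X \<omega>))"
      if X: "X \<in> borel_measurable M" "(\<integral>\<^sup>+\<omega>. ennreal (norm (X \<omega>) ^ 4) \<partial>M) \<le> ennreal ?K" for X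
    proof (rule integrable_quartic_growth[OF X(1) _ X(2), where c=c])
      show "(\<lambda>\<omega>. X \<omega> \<bullet> (A \<omega> *v X \<omega>)) \<in> borel_measurable M"
        using borel_measurable_continuous_Pair[OF AM X(1) cont] by simp
      show "AE \<omega> in M. \<bar>X \<omega> \<bullet> (A \<omega> *v X \<omega>)\<bar> \<le> c * (1 + norm (X \<omega>) ^ 4)"
      proof (rule AE_I2)
        fix \<omega> assume w: "\<omega> \<in> space M"
        have "\<bar>X \<omega> \<bullet> (A \<omega> *v X \<omega>)\<bar> \<le> norm (X \<omega>) * (c * norm (X \<omega>))"
          by (rule order_trans[OF Cauchy_Schwarz_ineq2 mult_left_mono[OF Ac[OF w]]]) simp
        also have "\<dots> = c * (norm (X \<omega>))\<^sup>2" by (simp add: power2_eq_square)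
        also have "\<dots> \<le> c * (1 + norm (X \<omega>) ^ 4)" using c0 by (intro mult_left_mono power2_le_quartic)
        finally show "\<bar>X \<omega> \<bullet> (A \<omega> *v X \<omega>)\<bar> \<le> c * (1 + norm (X \<omega>) ^ 4)" .
      qed
    qed
    have iJ: "integrable M (\<lambda>\<omega>. ?J \<omega> \<bullet> (A \<omega> *v ?J \<omega>))" by (rule qi[OF _ J4]) measurable
    have L: "(\<lambda>r. expectation (\<lambda>\<omega>. ?I r \<omega> \<bullet> (A \<omega> *v ?I r \<omega>))) \<longlonglongrightarrow> expectation (\<lambda>\<omega>. ?J \<omega> \<bullet> (A \<omega> *v ?J \<omega>))"
    proof (rule quadratic_functional_tendsto[OF _ _ lim2 V _ _ iJ, where c="2 * c"])
      show "integrable M (\<lambda>\<omega>. ?I r \<omega> \<bullet> (A \<omega> *v ?I r \<omega>))" for r by (rule qi[OF _ I4]) measurable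
      fix r \<omega> assume w: "\<omega> \<in> space M"
      show "\<bar>?I r \<omega> \<bullet> (A \<omega> *v ?I r \<omega>) - ?J \<omega> \<bullet> (A \<omega> *v ?J \<omega>)\<bar> \<le> 2 * c * ((1 + norm (?I r \<omega>)) * norm (?I r \<omega> - ?J \<omega>) + (norm (?I r \<omega> - ?J \<omega>))\<^sup>2)"
        by (rule quadratic_form_diff_le[OF matrix_vector_mul_linear Ac[OF w] c0])
    qed (use K0 c0 in auto)
    \<comment> \<open>The isometry is exact for every elementary integral, so the two sides of the
      claim are limits of the same sequence.\<close>
    have eqr: "expectation (\<lambda>\<omega>. ?I r \<omega> \<bullet> (A \<omega> *v ?I r \<omega>)) = expectation (\<lambda>\<omega>. LINT u:{s<..t}|lborel. ?Z r u \<omega> \<bullet> (A \<omega> ** ?Z r u \<omega>))" for r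
    proof -
      have *: "(indicator {s<..t} u *\<^sub>R X) \<bullet> (B ** (indicator {s<..t} u *\<^sub>R X)) = indicator {s<..t} u *\<^sub>R (X \<bullet> (B ** X))" for u and X :: "real^'d^'n" and B :: "real^'n^'n"
        by (simp add: indicator_def)
      show ?thesis
        unfolding elem_quadratic_form[OF elementary Ja A] step set_lebesgue_integral_def * ..
    qed
    note Q = quadratic_variation_tendsto[OF st jZ Hm C ZC lim AM c]
    have "expectation (\<lambda>\<omega>. ?J \<omega> \<bullet> (A \<omega> *v ?J \<omega>)) = expectation (\<lambda>\<omega>. LINT u:{s<..t}|lborel. Hm u \<omega> \<bullet> (A \<omega> ** Hm u \<omega>))"
      using LIMSEQ_unique[OF L[unfolded eqr] Q(1)] .
    with iJ Q(2) show ?thesis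
      by (simp add: has_bochner_integral_iff)
  qed
qed

end

section \<open>The solution stopped at a level of the barrier\<close>

text \<open>Time is rounded to a grid of mesh \<open>1 / (n + 1)\<close>, which leaves countably
  many random variables. The \<open>+ 1\<close> in \<open>a\<close> rounds strictly upwards, so the
  limit is taken from the right: a path set to \<open>0\<close> from its lifetime on is
  right-continuous but may jump at the lifetime.\<close>

lemma right_continuous_jointly_measurable:
  fixes Y :: "real \<Rightarrow> 'w \<Rightarrow> 'b::metric_space"
  assumes Y: "\<And>s. 0 \<le> s \<Longrightarrow> Y s \<in> borel_measurable M"
    and rc: "\<And>\<omega> s. \<omega> \<in> space M \<Longrightarrow> 0 \<le> s \<Longrightarrow> ((\<lambda>u. Y u \<omega>) \<longlongrightarrow> Y s \<omega>) (at_right s)"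
  shows "jointly_measurable M (\<lambda>s. Y (max 0 s))"
proof -
  define g where "g n s = nat \<lfloor>real (Suc n) * max 0 s\<rfloor>" for n and s :: real
  define a where "a n s = (real (g n s) + 1) / real (Suc n)" for n s
  have g_real: "real (g n s) = of_int \<lfloor>real (Suc n) * max 0 s\<rfloor>" for n s
    by (simp add: g_def)
  have a_gt: "max 0 s < a n s" for n s
  proof -
    have "real (Suc n) * max 0 s < real (g n s) + 1" unfolding g_real by linarith
    then show ?thesis unfolding a_def by (simp only: pos_less_divide_eq of_nat_0_less_iff zero_less_Suc mult.commute)
  qed
  have a_le: "a n s \<le> max 0 s + 1 / real (Suc n)" for n s
  proof -
    have "real (g n s) \<le> real (Suc n) * max 0 s" unfolding g_real by linarith
    then have "real (g n s) / real (Suc n) \<le> max 0 s" by (simp add: pos_divide_le_eq mult.commute)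
    then show ?thesis unfolding a_def add_divide_distrib by simp
  qed
  have lim: "(\<lambda>n. Y (a n s) \<omega>) \<longlonglongrightarrow> Y (max 0 s) \<omega>" if w: "\<omega> \<in> space M" for s \<omega>
  proof -
    have "(\<lambda>n. a n s) \<longlonglongrightarrow> max 0 s"
    proof (rule tendsto_sandwich[OF always_eventually always_eventually tendsto_const])
      show "(\<lambda>n. max 0 s + 1 / real (Suc n)) \<longlonglongrightarrow> max 0 s"
        using tendsto_add[OF tendsto_const LIMSEQ_inverse_real_of_nat, of "max 0 s"] by (simp add: inverse_eq_divide)
      show "\<forall>n. max 0 s \<le> a n s" "\<forall>n. a n s \<le> max 0 s + 1 / real (Suc n)"
        using a_gt a_le by (blast intro: less_imp_le)+
    qed
    then have "filterlim (\<lambda>n. a n s) (at_right (max 0 s)) sequentially"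
      using a_gt by (intro filterlim_at_withinI always_eventually) (auto simp: less_imp_neq[THEN not_sym])
    from filterlim_compose[OF rc[OF w] this] show ?thesis by simp
  qed
  show ?thesis
  proof (rule borel_measurable_LIMSEQ_metric)
    fix n
    have gm: "(\<lambda>z. g n (snd z)) \<in> measurable (M \<Otimes>\<^sub>M lborel) (count_space UNIV)"
      unfolding g_def by measurable
    have "(\<lambda>z. Y ((real i + 1) / real (Suc n)) (fst z)) \<in> borel_measurable (M \<Otimes>\<^sub>M lborel)" for i
      by (rule measurable_compose[OF measurable_fst Y]) simp
    from measurable_compose_countable[OF this gm]
    show "(\<lambda>z. Y (a n (snd z)) (fst z)) \<in> borel_measurable (M \<Otimes>\<^sub>M lborel)" unfolding a_def .
  next
    fix z :: "'w \<times> real" assume "z \<in> space (M \<Otimes>\<^sub>M lborel)"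
    then have "fst z \<in> space M" by (auto simp: space_pair_measure)
    from lim[OF this] show "(\<lambda>n. Y (a n (snd z)) (fst z)) \<longlonglongrightarrow> Y (max 0 (snd z)) (fst z)" .
  qed
qed

lemma locally_lipschitz_continuous:
  assumes "locally_lipschitz f" shows "continuous_on UNIV f"
proof -
  have "isCont f x" for x
  proof -
    obtain u L where u: "u > 0" "L-lipschitz_on (cball x u) f"
      using assms unfolding locally_lipschitz_def by blast
    have "continuous_on (ball x u) f"
      using lipschitz_on_continuous_on[OF u(2)] by (rule continuous_on_subset) auto
    then show ?thesis using u(1) by (simp add: continuous_on_eq_continuous_at)
  qed
  then show ?thesis by (simp add: continuous_on_eq_continuous_at)
qed

locale stopped_solution = wiener_setup M F W
  for M :: "'w measure" and F :: "real \<Rightarrow> 'w measure" and W :: "real \<Rightarrow> 'w \<Rightarrow> real^'d" +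
  fixes b :: "real^'n \<Rightarrow> real^'n" and \<sigma> :: "real^'n \<Rightarrow> real^'d^'n" and D :: "(real^'n) set" and x0 :: "real^'n"
    and X :: "real \<Rightarrow> 'w \<Rightarrow> real^'n" and T :: "'w \<Rightarrow> ereal" and B :: "real^'n \<Rightarrow> real" and k l :: real
  assumes maximal: "maximal_solution M F W b \<sigma> D x0 X T"
    and D: "open D" and b: "continuous_on D b" and \<sigma>: "continuous_on D \<sigma>"
    and B: "C2_on D B" and B_nonneg: "\<And>x. x \<in> D \<Longrightarrow> 0 \<le> B x" and K_compact: "compact {x\<in>D. B x \<le> k}"
    and x0: "x0 \<in> D" "B x0 < k" and l: "0 \<le> l"
begin

definition "K = {x\<in>D. B x \<le> k}"

definition hits :: "'w \<Rightarrow> real set" where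
  "hits \<omega> = {s. 0 \<le> s \<and> s \<le> l \<and> ereal s < T \<omega> \<and> k \<le> B (X s \<omega>)}"

text \<open>Without a hit the value is the horizon \<open>l\<close>, which makes
  \<open>\<tau>\<close> real-valued, as the stopped integral equation requires. Paths that end by
  time \<open>l\<close> without a hit have \<open>\<tau> = l \<ge> T\<close>; maximality makes them
  a null set.\<close>

definition \<tau> :: "'w \<Rightarrow> real" where
  "\<tau> \<omega> = (if hits \<omega> = {} then l else Inf (hits \<omega>))"

lemma sol: "local_solution M F W b \<sigma> D x0 X T"
  using maximal by (simp add: maximal_solution_def)

lemma T_pos: "\<omega> \<in> space M \<Longrightarrow> 0 < T \<omega>"
  using sol by (simp add: local_solution_def)

lemma X_in_D: "\<omega> \<in> space M \<Longrightarrow> 0 \<le> s \<Longrightarrow> ereal s < T \<omega> \<Longrightarrow> X s \<omega> \<in> D"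
  using sol by (simp add: local_solution_def)

lemma X_adapted: "0 \<le> s \<Longrightarrow> (\<lambda>\<omega>. if ereal s < T \<omega> then X s \<omega> else 0) \<in> borel_measurable (F s)"
  using sol by (simp add: local_solution_def)

lemma T_adapted: "0 \<le> s \<Longrightarrow> {\<omega>\<in>space M. ereal s < T \<omega>} \<in> sets (F s)"
proof -
  assume "0 \<le> s"
  then have "Measurable.pred (F s) (\<lambda>\<omega>. \<not> T \<omega> \<le> ereal s)"
    using sol unfolding local_solution_def extended_stopping_time_def by (intro pred_intros_logic) auto
  then show ?thesis by (simp add: pred_def not_le)
qed

lemma T_downward: "ereal h < T \<omega> \<Longrightarrow> s \<le> h \<Longrightarrow> ereal s < T \<omega>"
  by (metis ereal_less_eq(3) le_less_trans)

lemma X_continuous: "\<omega> \<in> space M \<Longrightarrow> continuous_on {t. 0 \<le> t \<and> ereal t < T \<omega>} (\<lambda>t. X t \<omega>)"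
  using sol by (simp add: local_solution_def)

lemma X_continuous_upto:
  assumes "\<omega> \<in> space M" "ereal h < T \<omega>" shows "continuous_on {0..h} (\<lambda>t. X t \<omega>)"
proof (rule continuous_on_subset[OF X_continuous[OF assms(1)]])
  show "{0..h} \<subseteq> {t. 0 \<le> t \<and> ereal t < T \<omega>}"
    using T_downward[OF assms(2)] by auto
qed

lemma BX_continuous_upto:
  assumes "\<omega> \<in> space M" "ereal h < T \<omega>" shows "continuous_on {0..h} (\<lambda>t. B (X t \<omega>))"
proof (rule continuous_on_compose2[OF C2_on_continuous(1)[OF B] X_continuous_upto[OF assms]])
  show "(\<lambda>t. X t \<omega>) ` {0..h} \<subseteq> D"
    using T_downward[OF assms(2)] X_in_D[OF assms(1)] by auto
qed

text \<open>The infimum is attained: up to a given hit \<open>h\<close> the path is continuous, so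
  the hits in \<open>[0, h]\<close> form a closed set, and later hits do not affect the
  infimum.\<close>

lemma \<tau>_hit:
  assumes w: "\<omega> \<in> space M" and ne: "hits \<omega> \<noteq> {}"
  shows "\<tau> \<omega> \<in> hits \<omega>"
proof -
  obtain h where h: "h \<in> hits \<omega>" using ne by blast
  have hT: "ereal h < T \<omega>" and h0: "0 \<le> h" "h \<le> l" using h by (auto simp: hits_def)
  let ?S = "{s\<in>{0..h}. k \<le> B (X s \<omega>)}"
  have "closed ?S"
  proof -
    have "?S = {0..h} \<inter> (\<lambda>t. B (X t \<omega>)) -` {k..}" by auto
    then show ?thesis using continuous_closed_preimage[OF BX_continuous_upto[OF w hT], of "{k..}"] by simp
  qed
  moreover have "bounded ?S" by (rule bounded_subset[of "{0..h}"]) auto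
  moreover have "h \<in> ?S" using h by (auto simp: hits_def)
  ultimately have inf: "Inf ?S \<in> ?S" by (intro closed_contains_Inf) (auto intro: bounded_imp_bdd_below)
  have sub: "?S \<subseteq> hits \<omega>"
    using h0 T_downward[OF hT] by (auto simp: hits_def)
  have "Inf (hits \<omega>) = Inf ?S"
  proof (rule antisym)
    have bdd: "bdd_below (hits \<omega>)" by (rule bdd_belowI[of _ 0]) (auto simp: hits_def)
    show "Inf (hits \<omega>) \<le> Inf ?S" using inf sub bdd by (intro cInf_lower) auto
    show "Inf ?S \<le> Inf (hits \<omega>)"
    proof (rule cInf_greatest[OF ne])
      fix s assume s: "s \<in> hits \<omega>"
      show "Inf ?S \<le> s"
      proof (cases "s \<le> h")
        case True
        then have "s \<in> ?S" using s by (auto simp: hits_def)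
        then show ?thesis by (intro cInf_lower) (auto intro!: bdd_belowI[of _ 0])
      next
        case False
        then show ?thesis using inf by auto
      qed
    qed
  qed
  then show ?thesis using inf sub ne unfolding \<tau>_def by auto
qed

lemma \<tau>_bounds: "\<omega> \<in> space M \<Longrightarrow> 0 \<le> \<tau> \<omega>" "\<omega> \<in> space M \<Longrightarrow> \<tau> \<omega> \<le> l"
proof -
  have "0 \<le> \<tau> \<omega> \<and> \<tau> \<omega> \<le> l" if w: "\<omega> \<in> space M"
  proof (cases "hits \<omega> = {}")
    case True
    then show ?thesis using l by (simp add: \<tau>_def)
  next
    case False
    from \<tau>_hit[OF w this] show ?thesis by (simp add: hits_def)
  qed
  then show "\<omega> \<in> space M \<Longrightarrow> 0 \<le> \<tau> \<omega>" "\<omega> \<in> space M \<Longrightarrow> \<tau> \<omega> \<le> l" by auto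
qed

lemma before_\<tau>:
  assumes "\<omega> \<in> space M" "0 \<le> s" "s < \<tau> \<omega>" "ereal s < T \<omega>" shows "B (X s \<omega>) < k"
proof (rule ccontr)
  assume "\<not> B (X s \<omega>) < k"
  then have "s \<in> hits \<omega>" using assms \<tau>_bounds(2)[OF assms(1)] by (auto simp: hits_def)
  then have "\<tau> \<omega> \<le> s" unfolding \<tau>_def by (auto intro!: cInf_lower bdd_belowI[of _ 0] simp: hits_def)
  then show False using assms by simp
qed

text \<open>Before \<open>\<tau>\<close> the level is not reached; at \<open>\<tau>\<close> itself
  continuity applies, and at time \<open>0\<close> the start below the level.\<close>

lemma upto_\<tau>:
  assumes w: "\<omega> \<in> space M" and X0: "X 0 \<omega> = x0" and T: "ereal (\<tau> \<omega>) < T \<omega>" and s: "0 \<le> s" "s \<le> \<tau> \<omega>"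
  shows "X s \<omega> \<in> K"
proof -
  have sT: "ereal s < T \<omega>" using T_downward[OF T s(2)] .
  have "B (X s \<omega>) \<le> k"
  proof (cases "s < \<tau> \<omega> \<or> s = 0")
    case True
    then show ?thesis using before_\<tau>[OF w s(1) _ sT] X0 x0 by auto
  next
    case False
    then have s': "s = \<tau> \<omega>" "0 < s" using s by auto
    have cl: "closed {u\<in>{0..s}. B (X u \<omega>) \<le> k}"
    proof -
      have "{u\<in>{0..s}. B (X u \<omega>) \<le> k} = {0..s} \<inter> (\<lambda>t. B (X t \<omega>)) -` {..k}" by auto
      then show ?thesis using continuous_closed_preimage[OF BX_continuous_upto[OF w sT], of "{..k}"] by simp
    qed
    have "{0<..<s} \<subseteq> {u\<in>{0..s}. B (X u \<omega>) \<le> k}"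
    proof
      fix u assume "u \<in> {0<..<s}"
      then have u: "0 \<le> u" "u < \<tau> \<omega>" "u \<le> s" using s' by auto
      show "u \<in> {u\<in>{0..s}. B (X u \<omega>) \<le> k}"
        using before_\<tau>[OF w u(1,2) T_downward[OF sT u(3)]] u by simp
    qed
    from closure_minimal[OF this cl] have "{0..s} \<subseteq> {u\<in>{0..s}. B (X u \<omega>) \<le> k}" using s' by simp
    from subsetD[OF this, of s] show ?thesis using s' by simp
  qed
  then show ?thesis using X_in_D[OF w s(1) sT] by (simp add: K_def)
qed

text \<open>\<open>u\<close> is controlled only on \<open>D\<close>; the indicator discards its
  arbitrary values elsewhere.\<close>

lemma indicator_comp_measurable:
  fixes u :: "real^'n \<Rightarrow> 'b::euclidean_space"
  assumes u: "continuous_on D u" and N: "N \<in> borel_measurable M'"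
  shows "(\<lambda>\<omega>. indicator D (N \<omega>) *\<^sub>R u (N \<omega>)) \<in> borel_measurable M'"
  using measurable_compose[OF N borel_measurable_continuous_on_indicator[OF borel_open[OF D] u]] .

lemma comp_X_adapted:
  fixes u :: "real^'n \<Rightarrow> 'b::euclidean_space"
  assumes u: "continuous_on D u" and s: "0 \<le> s"
  shows "(\<lambda>\<omega>. if ereal s < T \<omega> then u (X s \<omega>) else 0) \<in> borel_measurable (F s)"
proof -
  have "(\<lambda>\<omega>. if ereal s < T \<omega> then indicator D (if ereal s < T \<omega> then X s \<omega> else 0) *\<^sub>R u (if ereal s < T \<omega> then X s \<omega> else 0) else 0) \<in> borel_measurable (F s)"
    using T_adapted[OF s] by (intro measurable_If indicator_comp_measurable[OF u X_adapted[OF s]]) auto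
  also have "?this \<longleftrightarrow> ?thesis"
    by (rule measurable_cong) (use X_in_D[OF _ s] in auto)
  finally show ?thesis .
qed

text \<open>Turns a hit at some real time into countably many conditions. A hit need not occur at a
  rational time, hence the levels \<open>k - 1 / (n + 1)\<close>, which are exceeded near it;
  conversely, compactness of \<open>[0, q]\<close> yields a maximiser that reaches \<open>k\<close>.
  The time \<open>q\<close> keeps the search inside the lifetime, and \<open>t\<close> itself is
  inserted because later times are not known in \<open>F t\<close>.\<close>

lemma hit_before_iff:
  assumes w: "\<omega> \<in> space M" and t: "0 \<le> t"
  shows "(\<exists>s\<in>{0..t}. ereal s < T \<omega> \<and> k \<le> B (X s \<omega>)) \<longleftrightarrow>
     (\<exists>q\<in>insert t ({0..t} \<inter> \<rat>). ereal q < T \<omega> \<and>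
        (\<forall>n::nat. \<exists>r\<in>insert q ({0..q} \<inter> \<rat>). k - 1 / real (Suc n) < B (X r \<omega>)))" (is "?L \<longleftrightarrow> ?R")
proof
  assume ?L
  then obtain s where s: "0 \<le> s" "s \<le> t" "ereal s < T \<omega>" "k \<le> B (X s \<omega>)" by auto
  obtain q where q: "q \<in> insert t ({0..t} \<inter> \<rat>)" "ereal q < T \<omega>" "s < q \<or> s = q"
  proof (cases "s = t")
    case False
    then have "ereal s < min (ereal t) (T \<omega>)" using s by simp
    then obtain v where v: "ereal s < ereal v" "ereal v < min (ereal t) (T \<omega>)" using ereal_dense2 by blast
    then have "s < v" "v < t" "ereal v < T \<omega>" by auto
    obtain q where q: "q \<in> \<rat>" "s < q" "q < v" using Rats_dense_in_real[OF \<open>s < v\<close>] by blast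
    have "ereal q < T \<omega>" using q T_downward[OF \<open>ereal v < T \<omega>\<close>, of q] by simp
    then show ?thesis using q s \<open>v < t\<close> by (intro that[of q]) auto
  qed (use s that in auto)
  have "\<exists>r\<in>insert q ({0..q} \<inter> \<rat>). k - 1 / real (Suc n) < B (X r \<omega>)" for n
  proof (cases "s = q")
    case True
    then show ?thesis using s by (intro bexI[of _ q]) (auto intro: less_le_trans[of _ k])
  next
    case False
    then have "s < q" using q by auto
    have "0 < 1 / real (Suc n)" by simp
    then obtain \<delta> where \<delta>: "\<delta> > 0" "\<And>r. r \<in> {0..q} \<Longrightarrow> dist r s < \<delta> \<Longrightarrow> dist (B (X r \<omega>)) (B (X s \<omega>)) < 1 / real (Suc n)"
      using BX_continuous_upto[OF w q(2)] s(1) \<open>s < q\<close> unfolding continuous_on_iff by (metis atLeastAtMost_iff less_imp_le)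
    have "s < min q (s + \<delta>)" using \<open>s < q\<close> \<delta> by simp
    then obtain r where r: "r \<in> \<rat>" "s < r" "r < min q (s + \<delta>)" using Rats_dense_in_real by blast
    have "dist (B (X r \<omega>)) (B (X s \<omega>)) < 1 / real (Suc n)"
      using r s(1) by (intro \<delta>(2)) (auto simp: dist_real_def)
    then have "k - 1 / real (Suc n) < B (X r \<omega>)" using s(4) by (simp add: dist_real_def abs_less_iff)
    then show ?thesis using r s(1) by (intro bexI[of _ r]) auto
  qed
  then show ?R using q by blast
next
  assume ?R
  then obtain q where q: "q \<in> insert t ({0..t} \<inter> \<rat>)" "ereal q < T \<omega>"
    and near: "\<And>n::nat. \<exists>r\<in>insert q ({0..q} \<inter> \<rat>). k - 1 / real (Suc n) < B (X r \<omega>)" by blast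
  have q0: "0 \<le> q" "q \<le> t" using q t by auto
  obtain s where s: "s \<in> {0..q}" "\<And>r. r \<in> {0..q} \<Longrightarrow> B (X r \<omega>) \<le> B (X s \<omega>)"
    using continuous_attains_sup[OF _ _ BX_continuous_upto[OF w q(2)]] q0 by auto
  have bnd: "k \<le> B (X s \<omega>) + 1 / real (Suc n)" for n
  proof -
    obtain r where r: "r \<in> insert q ({0..q} \<inter> \<rat>)" "k - 1 / real (Suc n) < B (X r \<omega>)" using near by blast
    have "r \<in> {0..q}" using r q0 by auto
    then show ?thesis using s(2)[of r] r(2) by simp
  qed
  have "(\<lambda>n. B (X s \<omega>) + 1 / real (Suc n)) \<longlonglongrightarrow> B (X s \<omega>)"
    using tendsto_add[OF tendsto_const LIMSEQ_inverse_real_of_nat, of "B (X s \<omega>)"] by (simp add: inverse_eq_divide)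
  then have "k \<le> B (X s \<omega>)" by (rule Lim_bounded2) (use bnd in auto)
  moreover have "ereal s < T \<omega>" using s(1) T_downward[OF q(2)] by simp
  ultimately show ?L using s(1) q0 by (intro bexI[of _ s]) auto
qed

text \<open>Only times in \<open>[0, l)\<close> need work: earlier the event is empty, from
  \<open>l\<close> on it is everything. In between, a hit by time \<open>t\<close> is a countable
  combination of events of \<open>F t\<close>.\<close>

lemma stopping_\<tau>: "stopping_time F \<tau>"
proof (rule stopping_timeI)
  fix t
  have "{\<omega>\<in>space M. \<tau> \<omega> \<le> t} \<in> sets (F t)"
  proof -
    consider "t < 0" | "l \<le> t" | "0 \<le> t" "t < l" by linarith
    then show ?thesis
    proof cases
      case 1
      then have "{\<omega>\<in>space M. \<tau> \<omega> \<le> t} = {}" using \<tau>_bounds(1) by fastforce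
      then show ?thesis by (simp only: sets.empty_sets)
    next
      case 2
      then have "{\<omega>\<in>space M. \<tau> \<omega> \<le> t} = space (F t)" using \<tau>_bounds(2) by (auto intro: order_trans)
      then show ?thesis by (simp only: sets.top)
    next
      case 3
      let ?P = "\<lambda>r n. {\<omega>\<in>space M. ereal r < T \<omega> \<and> k - 1 / real (Suc n) < B (X r \<omega>)}"
      let ?Q = "\<lambda>q. {\<omega>\<in>space M. ereal q < T \<omega>} \<inter> (\<Inter>n::nat. \<Union>r\<in>insert q ({0..q} \<inter> \<rat>). ?P r n)"
      have iff: "\<tau> \<omega> \<le> t \<longleftrightarrow> (\<exists>s\<in>{0..t}. ereal s < T \<omega> \<and> k \<le> B (X s \<omega>))" if w: "\<omega> \<in> space M" for \<omega>
      proof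
        assume le: "\<tau> \<omega> \<le> t"
        then have "hits \<omega> \<noteq> {}" using 3 by (auto simp: \<tau>_def)
        from \<tau>_hit[OF w this] le show "\<exists>s\<in>{0..t}. ereal s < T \<omega> \<and> k \<le> B (X s \<omega>)" by (auto simp: hits_def)
      next
        assume "\<exists>s\<in>{0..t}. ereal s < T \<omega> \<and> k \<le> B (X s \<omega>)"
        then obtain s where "0 \<le> s" "s \<le> t" "ereal s < T \<omega>" "k \<le> B (X s \<omega>)" by auto
        then show "\<tau> \<omega> \<le> t" using before_\<tau>[OF w, of s] by fastforce
      qed
      have "{\<omega>\<in>space M. \<tau> \<omega> \<le> t} = (\<Union>q\<in>insert t ({0..t} \<inter> \<rat>). ?Q q)"
      proof (intro set_eqI iffI)
        fix \<omega> assume "\<omega> \<in> {\<omega>\<in>space M. \<tau> \<omega> \<le> t}"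
        then have w: "\<omega> \<in> space M" and le: "\<tau> \<omega> \<le> t" by auto
        obtain q where q: "q \<in> insert t ({0..t} \<inter> \<rat>)" "ereal q < T \<omega>"
          and near: "\<And>n::nat. \<exists>r\<in>insert q ({0..q} \<inter> \<rat>). k - 1 / real (Suc n) < B (X r \<omega>)"
          using iff[OF w, THEN iffD1, OF le] hit_before_iff[OF w 3(1)] by blast
        show "\<omega> \<in> (\<Union>q\<in>insert t ({0..t} \<inter> \<rat>). ?Q q)"
        proof (rule UN_I[OF q(1)], rule IntI)
          show "\<omega> \<in> {\<omega>\<in>space M. ereal q < T \<omega>}" using w q by simp
          show "\<omega> \<in> (\<Inter>n::nat. \<Union>r\<in>insert q ({0..q} \<inter> \<rat>). ?P r n)"
          proof (rule INT_I)
            fix n :: nat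
            obtain r where r: "r \<in> insert q ({0..q} \<inter> \<rat>)" "k - 1 / real (Suc n) < B (X r \<omega>)" using near by blast
            have "r \<le> q" using r(1) by auto
            from T_downward[OF q(2) this] have "\<omega> \<in> ?P r n" using w r(2) by simp
            with r(1) show "\<omega> \<in> (\<Union>r\<in>insert q ({0..q} \<inter> \<rat>). ?P r n)" by (rule UN_I)
          qed
        qed
      next
        fix \<omega> assume "\<omega> \<in> (\<Union>q\<in>insert t ({0..t} \<inter> \<rat>). ?Q q)"
        then obtain q where q: "q \<in> insert t ({0..t} \<inter> \<rat>)" and Q: "\<omega> \<in> ?Q q" by (rule UN_E)
        from Q have w: "\<omega> \<in> space M" and qT: "ereal q < T \<omega>" by auto
        have "\<exists>r\<in>insert q ({0..q} \<inter> \<rat>). k - 1 / real (Suc n) < B (X r \<omega>)" for n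
        proof -
          have "\<omega> \<in> (\<Union>r\<in>insert q ({0..q} \<inter> \<rat>). ?P r n)" using Q by (blast dest: INT_D)
          then show ?thesis by blast
        qed
        with q qT have "\<exists>s\<in>{0..t}. ereal s < T \<omega> \<and> k \<le> B (X s \<omega>)"
          using hit_before_iff[OF w 3(1)] by blast
        then show "\<omega> \<in> {\<omega>\<in>space M. \<tau> \<omega> \<le> t}" using iff[OF w] w by simp
      qed
      also have "\<dots> \<in> sets (F t)"
      proof (rule sets.countable_UN'')
        show "countable (insert t ({0..t} \<inter> \<rat>))" by (intro countable_insert countable_subset[OF _ countable_rat]) auto
        fix q assume "q \<in> insert t ({0..t} \<inter> \<rat>)"
        then have q: "0 \<le> q" "q \<le> t" using 3 by auto
        have 1: "{\<omega>\<in>space M. ereal q < T \<omega>} \<in> sets (F t)" using T_adapted[OF q(1)] sets_F_mono[OF q(2)] by auto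
        have U: "(\<Union>r\<in>insert q ({0..q} \<inter> \<rat>). ?P r n) \<in> sets (F t)" for n
        proof (rule sets.countable_UN'')
          show "countable (insert q ({0..q} \<inter> \<rat>))" by (intro countable_insert countable_subset[OF _ countable_rat]) auto
          fix r assume "r \<in> insert q ({0..q} \<inter> \<rat>)"
          then have r: "0 \<le> r" "r \<le> t" using q by auto
          have "{\<omega>\<in>space (F r). k - 1 / real (Suc n) < (if ereal r < T \<omega> then B (X r \<omega>) else 0)} \<in> sets (F r)"
            using comp_X_adapted[OF C2_on_continuous(1)[OF B] r(1)] by (intro borel_measurable_less) auto
          from sets.Int[OF T_adapted[OF r(1)] this]
          have "?P r n \<in> sets (F r)" by (rule back_subst[of "\<lambda>A. A \<in> sets (F r)"]) auto
          then show "?P r n \<in> sets (F t)" using sets_F_mono[OF r(2)] by blast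
        qed
        have 2: "(\<Inter>n::nat. \<Union>r\<in>insert q ({0..q} \<inter> \<rat>). ?P r n) \<in> sets (F t)"
          by (rule sets.countable_INT[OF image_subsetI[OF U] UNIV_not_empty])
        show "?Q q \<in> sets (F t)" by (rule sets.Int[OF 1 2])
      qed
      finally show ?thesis .
    qed
  qed
  then show "Measurable.pred (F t) (\<lambda>\<omega>. \<tau> \<omega> \<le> t)" by (simp add: pred_def)
qed

lemma K_subset: "K \<subseteq> D" and K_comp: "compact K" and x0_in_K: "x0 \<in> K"
  using K_compact x0 by (auto simp: K_def)

text \<open>A path of finite lifetime leaves the compact set \<open>K\<close> before it ends. If
  that happens by time \<open>l\<close>, it is a hit, and hits lie in the lifetime; if it happens
  after \<open>l\<close>, the lifetime exceeds \<open>l\<close>.\<close>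

lemma \<tau>_less_T_AE: "AE \<omega> in M. ereal (\<tau> \<omega>) < T \<omega>"
proof -
  have "AE \<omega> in M. T \<omega> < \<infinity> \<longrightarrow> (\<exists>t\<ge>0. ereal t < T \<omega> \<and> X t \<omega> \<notin> K)"
    using maximal K_comp K_subset unfolding maximal_solution_def by (auto elim!: eventually_mono)
  then show ?thesis
  proof (rule AE_mp, intro AE_I2 impI)
    fix \<omega> assume w: "\<omega> \<in> space M" and ex: "T \<omega> < \<infinity> \<longrightarrow> (\<exists>t\<ge>0. ereal t < T \<omega> \<and> X t \<omega> \<notin> K)"
    show "ereal (\<tau> \<omega>) < T \<omega>"
    proof (cases "hits \<omega> = {}")
      case False
      from \<tau>_hit[OF w this] show ?thesis by (simp add: hits_def)
    next
      case True
      then have \<tau>: "\<tau> \<omega> = l" by (simp add: \<tau>_def)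
      show ?thesis
      proof (cases "T \<omega> < \<infinity>")
        case True
        then obtain t where t: "0 \<le> t" "ereal t < T \<omega>" "X t \<omega> \<notin> K" using ex by blast
        then have "k \<le> B (X t \<omega>)" using X_in_D[OF w t(1,2)] by (auto simp: K_def)
        then have "\<not> t \<le> l" using t \<open>hits \<omega> = {}\<close> by (auto simp: hits_def)
        then show ?thesis using T_downward[OF t(2), of l] \<tau> by simp
      next
        case False
        then show ?thesis by (cases "T \<omega>") auto
      qed
    qed
  qed
qed

lemma T_measurable: "T \<in> borel_measurable M"
proof (rule borel_measurableI_le)
  fix y :: ereal
  consider "y < 0" | "y = \<infinity>" | t where "0 \<le> t" "y = ereal t" by (cases y) force+
  then show "{\<omega>\<in>space M. T \<omega> \<le> y} \<in> sets M"
  proof cases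
    case 1
    then have "{\<omega>\<in>space M. T \<omega> \<le> y} = {}" using T_pos by fastforce
    then show ?thesis by (simp only: sets.empty_sets)
  next
    case 2
    then show ?thesis by simp
  next
    case 3
    have "{\<omega>\<in>space M. T \<omega> \<le> y} = space M - {\<omega>\<in>space M. ereal t < T \<omega>}" using 3 by (auto simp: not_less)
    also have "\<dots> \<in> sets M" using T_adapted[OF 3(1)] sets_F_M by blast
    finally show ?thesis .
  qed
qed

section \<open>The stopped process and its coefficients\<close>

lemma \<tau>_measurable: "\<tau> \<in> borel_measurable M"
  by (rule measurable_stopping_time[OF stopping_\<tau> sets_F_M]) simp

definition "regular = {\<omega>\<in>space M. ereal (\<tau> \<omega>) < T \<omega> \<and> X 0 \<omega> = x0}"

lemma regular_sets: "regular \<in> sets M"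
proof -
  have 1: "{\<omega>\<in>space M. ereal (\<tau> \<omega>) < T \<omega>} \<in> sets M"
    using \<tau>_measurable by (intro borel_measurable_less T_measurable) measurable
  have "(\<lambda>\<omega>. if ereal 0 < T \<omega> then X 0 \<omega> else 0) \<in> borel_measurable M"
    using X_adapted[of 0] measurable_F_M by blast
  then have "{\<omega>\<in>space M. (if ereal 0 < T \<omega> then X 0 \<omega> else 0) = x0} \<in> sets M" by measurable
  from sets.Int[OF 1 this] show ?thesis
    by (rule back_subst[of "\<lambda>A. A \<in> sets M"]) (use T_pos in \<open>auto simp: regular_def zero_ereal_def\<close>)
qed

lemma regular_AE: "AE \<omega> in M. \<omega> \<in> regular"
proof -
  have "AE \<omega> in M. X 0 \<omega> = x0" using sol by (simp add: local_solution_def)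
  then show ?thesis using \<tau>_less_T_AE AE_space by eventually_elim (simp add: regular_def)
qed

text \<open>On the exceptional null set the constant \<open>x0\<close> is the default, and negative
  times are sent to \<open>0\<close>. So \<open>Z\<close> lies in \<open>K\<close> for every path
  and every time, and bounds over \<open>K\<close> hold without exceptional sets.\<close>

definition Z :: "real \<Rightarrow> 'w \<Rightarrow> real^'n" where
  "Z s \<omega> = (if \<omega> \<in> regular then X (min (max 0 s) (\<tau> \<omega>)) \<omega> else x0)"

lemma regular_space: "\<omega> \<in> regular \<Longrightarrow> \<omega> \<in> space M"
  by (simp add: regular_def)

lemma Z_in_K: "Z s \<omega> \<in> K"
proof (cases "\<omega> \<in> regular")
  case True
  then have "X (min (max 0 s) (\<tau> \<omega>)) \<omega> \<in> K"
    using \<tau>_bounds(1)[of \<omega>] by (intro upto_\<tau>) (auto simp: regular_def)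
  then show ?thesis using True by (simp add: Z_def)
qed (simp add: Z_def x0_in_K)

lemma Z_in_D: "Z s \<omega> \<in> D"
  using Z_in_K K_subset by blast

lemma Z_eq: "\<omega> \<in> regular \<Longrightarrow> 0 \<le> s \<Longrightarrow> s \<le> \<tau> \<omega> \<Longrightarrow> Z s \<omega> = X s \<omega>"
  by (simp add: Z_def)

lemma Z_stopped: "\<omega> \<in> regular \<Longrightarrow> \<tau> \<omega> \<le> s \<Longrightarrow> s \<le> t \<Longrightarrow> Z t \<omega> = Z s \<omega>"
proof -
  assume w: "\<omega> \<in> regular" and "\<tau> \<omega> \<le> s" "s \<le> t"
  then have "min (max 0 t) (\<tau> \<omega>) = \<tau> \<omega>" "min (max 0 s) (\<tau> \<omega>) = \<tau> \<omega>" by auto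
  then show ?thesis using w by (simp only: Z_def)
qed

lemma Z_0: "Z 0 \<omega> = x0"
  using \<tau>_bounds(1)[OF regular_space, of \<omega>] by (auto simp: Z_def regular_def min_def)

lemma X_right_continuous:
  assumes w: "\<omega> \<in> space M" and s: "0 \<le> s"
  shows "((\<lambda>u. if ereal u < T \<omega> then X u \<omega> else 0) \<longlongrightarrow> (if ereal s < T \<omega> then X s \<omega> else 0)) (at_right s)"
proof (cases "ereal s < T \<omega>")
  case True
  then obtain v where v: "ereal s < ereal v" "ereal v < T \<omega>" using ereal_dense2 by blast
  then have sv: "s < v" by simp
  have "((\<lambda>u. X u \<omega>) \<longlongrightarrow> X s \<omega>) (at s within {0..v})"
    using X_continuous_upto[OF w v(2)] s sv by (simp add: continuous_on_def)
  then have lim: "((\<lambda>u. X u \<omega>) \<longlongrightarrow> X s \<omega>) (at s within {s<..<v})"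
    by (rule tendsto_within_subset) (use s in auto)
  have ev: "\<forall>\<^sub>F u in at_right s. u \<in> {s<..<v}" by (rule eventually_at_right_real[OF sv])
  have "at s within {s<..<v} = at_right s"
  proof -
    have "{s<..} \<inter> {..<v} = {s<..<v} \<inter> {..<v}" by auto
    then show ?thesis using at_within_nhd[of s "{..<v}" "{s<..}" "{s<..<v}"] sv by simp
  qed
  with lim have "((\<lambda>u. X u \<omega>) \<longlongrightarrow> X s \<omega>) (at_right s)" by simp
  moreover have "\<forall>\<^sub>F u in at_right s. X u \<omega> = (if ereal u < T \<omega> then X u \<omega> else 0)"
    using ev by (rule eventually_mono) (use T_downward[OF v(2)] in auto)
  ultimately show ?thesis using True by (simp add: Lim_transform_eventually)
next
  case False
  have "\<forall>\<^sub>F u in at_right s. (if ereal u < T \<omega> then X u \<omega> else 0) = 0"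
    using eventually_at_right_less[of s]
  proof (rule eventually_mono)
    fix u assume "s < u"
    then have "\<not> ereal u < T \<omega>" using False T_downward[of u \<omega> s] by (meson less_imp_le)
    then show "(if ereal u < T \<omega> then X u \<omega> else 0) = 0" by simp
  qed
  then show ?thesis using False by (simp add: tendsto_eventually)
qed

text \<open>The path, set to \<open>0\<close> from its lifetime on, is right-continuous and hence
  jointly measurable; evaluating it at \<open>min s \<tau>\<close> composes it with a measurable
  change of time.\<close>

lemma Z_jointly_measurable: "jointly_measurable M Z"
proof -
  define Y where "Y s \<omega> = (if ereal s < T \<omega> then X s \<omega> else 0)" for s \<omega>
  have jY: "jointly_measurable M (\<lambda>s. Y (max 0 s))"
  proof (rule right_continuous_jointly_measurable)
    show "Y s \<in> borel_measurable M" if "0 \<le> s" for s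
      unfolding Y_def[abs_def] using X_adapted[OF that] measurable_F_M by blast
    show "((\<lambda>u. Y u \<omega>) \<longlongrightarrow> Y s \<omega>) (at_right s)" if "\<omega> \<in> space M" "0 \<le> s" for s \<omega>
      unfolding Y_def by (rule X_right_continuous[OF that])
  qed
  have "(\<lambda>z. (fst z, min (max 0 (snd z)) (\<tau> (fst z)))) \<in> measurable (M \<Otimes>\<^sub>M lborel) (M \<Otimes>\<^sub>M lborel)"
    using \<tau>_measurable by measurable
  from measurable_compose[OF this jY]
  have "(\<lambda>z. Y (max 0 (min (max 0 (snd z)) (\<tau> (fst z)))) (fst z)) \<in> borel_measurable (M \<Otimes>\<^sub>M lborel)" by simp
  moreover have "{z \<in> space (M \<Otimes>\<^sub>M lborel). fst z \<in> regular} \<in> sets (M \<Otimes>\<^sub>M lborel)"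
    using regular_sets by measurable
  ultimately have "(\<lambda>z. if fst z \<in> regular then Y (max 0 (min (max 0 (snd z)) (\<tau> (fst z)))) (fst z) else x0) \<in> borel_measurable (M \<Otimes>\<^sub>M lborel)"
    by (intro measurable_If) auto
  moreover have "(if fst z \<in> regular then Y (max 0 (min (max 0 (snd z)) (\<tau> (fst z)))) (fst z) else x0) = Z (snd z) (fst z)"
    for z :: "'w \<times> real"
  proof (cases "fst z \<in> regular")
    case True
    then have "0 \<le> \<tau> (fst z)" "ereal (\<tau> (fst z)) < T (fst z)" using \<tau>_bounds(1) by (auto simp: regular_def)
    moreover have "ereal (min (max 0 (snd z)) (\<tau> (fst z))) < T (fst z)" by (rule T_downward) (use calculation in auto)
    ultimately show ?thesis using True by (simp add: Y_def Z_def max_absorb2)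
  qed (simp add: Z_def)
  ultimately show ?thesis by simp
qed

lemma comp_Z_jointly_measurable:
  fixes u :: "real^'n \<Rightarrow> 'b::euclidean_space"
  assumes "continuous_on D u" shows "jointly_measurable M (\<lambda>s \<omega>. u (Z s \<omega>))"
  using indicator_comp_measurable[OF assms Z_jointly_measurable] Z_in_D by simp

lemma section_measurable:
  assumes "jointly_measurable M G" shows "G s \<in> borel_measurable M"
  using measurable_compose[OF measurable_Pair2'[of s lborel M] assms] by simp

lemma comp_Z_measurable:
  fixes u :: "real^'n \<Rightarrow> 'b::euclidean_space"
  assumes "continuous_on D u" shows "(\<lambda>\<omega>. u (Z s \<omega>)) \<in> borel_measurable M"
  using section_measurable[OF comp_Z_jointly_measurable[OF assms]] .

text \<open>The time \<open>\<tau>\<close> is included and \<open>0\<close> excluded, in agreement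
  with the half-open intervals of integration and with the cut-off in the stopped integral
  equation.\<close>

definition alive :: "real \<Rightarrow> 'w \<Rightarrow> bool" where
  "alive s \<omega> \<longleftrightarrow> \<omega> \<in> regular \<and> 0 < s \<and> s \<le> \<tau> \<omega>"

text \<open>The bounded, jointly measurable version of the integrand in the stopped equation. The
  two agree at all positive times for almost every path, which is what the results on increments ask
  for.\<close>

definition diffusion :: "real \<Rightarrow> 'w \<Rightarrow> real^'d^'n" where
  "diffusion s \<omega> = (if alive s \<omega> then \<sigma> (Z s \<omega>) else 0)"

definition drift :: "real \<Rightarrow> 'w \<Rightarrow> real^'n" where
  "drift s \<omega> = (if alive s \<omega> then b (Z s \<omega>) else 0)"

lemma alive_measurable: "{z \<in> space (M \<Otimes>\<^sub>M lborel). alive (snd z) (fst z)} \<in> sets (M \<Otimes>\<^sub>M lborel)"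
  unfolding alive_def using regular_sets \<tau>_measurable by measurable

lemma diffusion_jointly_measurable: "jointly_measurable M diffusion" and drift_jointly_measurable: "jointly_measurable M drift"
  unfolding diffusion_def drift_def
  by (intro measurable_If comp_Z_jointly_measurable \<sigma> b alive_measurable; simp)+

lemma K_bound:
  fixes u :: "real^'n \<Rightarrow> 'b::real_normed_vector"
  assumes "continuous_on D u" obtains c where "0 \<le> c" "\<And>x. x \<in> K \<Longrightarrow> norm (u x) \<le> c"
proof -
  have "bounded (u ` K)"
    by (intro compact_imp_bounded compact_continuous_image continuous_on_subset[OF assms K_subset] K_comp)
  then show ?thesis using that unfolding bounded_pos by (metis image_eqI less_imp_le)
qed

text \<open>After \<open>\<tau>\<close> the drift vanishes, so the integrands differ at most at the
  null set \<open>{0}\<close>.\<close>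

lemma drift_integral:
  assumes w: "\<omega> \<in> regular" and t: "0 \<le> t"
  shows "(LINT u:{0..min t (\<tau> \<omega>)}|lborel. b (X u \<omega>)) = (LINT u:{0<..t}|lborel. drift u \<omega>)"
proof -
  have meas: "(\<lambda>u. indicator {0<..t} u *\<^sub>R drift u \<omega>) \<in> borel_measurable lborel"
    using jointly_measurable_section[OF drift_jointly_measurable regular_space[OF w]] by measurable
  have ev: "AE u in lborel. indicator {0..min t (\<tau> \<omega>)} u *\<^sub>R b (X u \<omega>) = indicator {0<..t} u *\<^sub>R drift u \<omega>"
    using AE_lborel_singleton[of "0::real"]
  proof (rule eventually_mono)
    fix u :: real assume "u \<noteq> 0"
    then show "indicator {0..min t (\<tau> \<omega>)} u *\<^sub>R b (X u \<omega>) = indicator {0<..t} u *\<^sub>R drift u \<omega>"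
      using w by (auto simp: drift_def alive_def Z_eq split: split_indicator)
  qed
  have meas': "(\<lambda>u. indicator {0..min t (\<tau> \<omega>)} u *\<^sub>R b (X u \<omega>)) \<in> borel_measurable lborel"
  proof -
    have "\<tau> \<omega> < T \<omega>" and "\<omega> \<in> space M" using w by (auto simp: regular_def)
    have sub: "(\<lambda>u. X u \<omega>) ` {0..min t (\<tau> \<omega>)} \<subseteq> D"
      using X_in_D[OF \<open>\<omega> \<in> space M\<close>] T_downward[OF \<open>\<tau> \<omega> < T \<omega>\<close>] by auto
    have "continuous_on {0..min t (\<tau> \<omega>)} (\<lambda>u. X u \<omega>)"
      using X_continuous_upto[OF \<open>\<omega> \<in> space M\<close> \<open>\<tau> \<omega> < T \<omega>\<close>] by (rule continuous_on_subset) auto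
    from continuous_on_compose2[OF b this sub] have "continuous_on {0..min t (\<tau> \<omega>)} (\<lambda>u. b (X u \<omega>))" .
    from borel_measurable_continuous_on_indicator[OF _ this] show ?thesis by simp
  qed
  show ?thesis unfolding set_lebesgue_integral_def by (rule integral_cong_AE[OF meas' meas ev])
qed

lemma drift_set_integrable:
  assumes w: "\<omega> \<in> space M" and st: "s \<le> t" shows "set_integrable lborel {s<..t} (\<lambda>u. drift u \<omega>)"
proof -
  obtain c where c: "0 \<le> c" "\<And>x. x \<in> K \<Longrightarrow> norm (b x) \<le> c" using K_bound[OF b] by blast
  have "integrable lborel (\<lambda>u. indicator {s<..t} u *\<^sub>R c)"
    using st by (intro integrable_scaleR_left) (simp add: integrable_indicator_iff)
  then show ?thesis
    unfolding set_integrable_def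
  proof (rule Bochner_Integration.integrable_bound)
    show "(\<lambda>u. indicator {s<..t} u *\<^sub>R drift u \<omega>) \<in> borel_measurable lborel"
      using jointly_measurable_section[OF drift_jointly_measurable w] by measurable
    show "AE u in lborel. norm (indicator {s<..t} u *\<^sub>R drift u \<omega>) \<le> norm (indicator {s<..t} u *\<^sub>R c)"
      using c Z_in_K by (intro AE_I2) (auto simp: drift_def split: split_indicator)
  qed
qed

lemma drift_integral_diff:
  assumes w: "\<omega> \<in> space M" and st: "0 \<le> s" "s < t"
  shows "(LINT u:{0<..t}|lborel. drift u \<omega>) - (LINT u:{0<..s}|lborel. drift u \<omega>) = (LINT u:{s<..t}|lborel. drift u \<omega>)"
proof -
  have "{0<..t} = {0<..s} \<union> {s<..t}" using st by auto
  then have "(LINT u:{0<..t}|lborel. drift u \<omega>) = (LINT u:{0<..s}|lborel. drift u \<omega>) + (LINT u:{s<..t}|lborel. drift u \<omega>)"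
    using drift_set_integrable[OF w] st by (simp only:) (rule set_integral_Un; auto)
  then show ?thesis by simp
qed

text \<open>Using the same stopping time \<open>\<tau>\<close> at both times gives a single
  integrand \<open>H\<close>, as the results on increments of the Ito integral require; the drift
  parts subtract to an integral over \<open>(s, t]\<close>.\<close>

lemma increment_decomposition:
  assumes st: "0 \<le> s" "s < t" "t \<le> l"
  obtains H J0 J1 where "has_ito_integral M F W H s J0" "has_ito_integral M F W H t J1"
    "AE \<omega> in M. \<forall>u\<in>{0<..t}. H u \<omega> = diffusion u \<omega>"
    "AE \<omega> in M. Z t \<omega> - Z s \<omega> = (LINT u:{s<..t}|lborel. drift u \<omega>) + (J1 \<omega> - J0 \<omega>)"
proof -
  let ?H = "\<lambda>s \<omega>. if s \<le> \<tau> \<omega> \<and> ereal s < T \<omega> then \<sigma> (X s \<omega>) else 0"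
  have ex: "\<exists>J. has_ito_integral M F W ?H t J \<and>
      (AE \<omega> in M. X (min t (\<tau> \<omega>)) \<omega> = x0 + (LINT s:{0..min t (\<tau> \<omega>)}|lborel. b (X s \<omega>)) + J \<omega>)" if "0 \<le> t" for t
    using sol stopping_\<tau> \<tau>_bounds(1) \<tau>_less_T_AE that unfolding local_solution_def by blast
  obtain J0 where J0: "has_ito_integral M F W ?H s J0"
      "AE \<omega> in M. X (min s (\<tau> \<omega>)) \<omega> = x0 + (LINT u:{0..min s (\<tau> \<omega>)}|lborel. b (X u \<omega>)) + J0 \<omega>"
    using ex[OF st(1)] by blast
  obtain J1 where J1: "has_ito_integral M F W ?H t J1"
      "AE \<omega> in M. X (min t (\<tau> \<omega>)) \<omega> = x0 + (LINT u:{0..min t (\<tau> \<omega>)}|lborel. b (X u \<omega>)) + J1 \<omega>"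
    using ex[of t] st by auto
  show ?thesis
  proof (rule that[OF J0(1) J1(1)])
    show "AE \<omega> in M. \<forall>u\<in>{0<..t}. ?H u \<omega> = diffusion u \<omega>"
      using regular_AE
    proof (rule eventually_mono, intro ballI)
      fix \<omega> u assume w: "\<omega> \<in> regular" and u: "u \<in> {0<..t}"
      have "ereal u < T \<omega>" if "u \<le> \<tau> \<omega>" using that w T_downward[of "\<tau> \<omega>" \<omega> u] by (simp add: regular_def)
      then show "?H u \<omega> = diffusion u \<omega>" using w u by (auto simp: diffusion_def alive_def Z_eq)
    qed
    show "AE \<omega> in M. Z t \<omega> - Z s \<omega> = (LINT u:{s<..t}|lborel. drift u \<omega>) + (J1 \<omega> - J0 \<omega>)"
      using regular_AE J0(2) J1(2)
    proof eventually_elim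
      case (elim \<omega>)
      have t: "0 \<le> t" using st by simp
      have "Z t \<omega> = x0 + (LINT u:{0<..t}|lborel. drift u \<omega>) + J1 \<omega>"
        using elim t unfolding drift_integral[OF elim(1) t, symmetric] by (simp add: Z_def)
      moreover have "Z s \<omega> = x0 + (LINT u:{0<..s}|lborel. drift u \<omega>) + J0 \<omega>"
        using elim st unfolding drift_integral[OF elim(1) st(1), symmetric] by (simp add: Z_def)
      ultimately show ?case
        using drift_integral_diff[OF regular_space[OF elim(1)] st(1,2)] by (simp add: algebra_simps)
    qed
  qed
qed

end

section \<open>The expected barrier along the stopped solution\<close>

lemma (in finite_measure) integral_le_of_nn_integral:
  fixes f :: "'a \<Rightarrow> real"
  assumes "f \<in> borel_measurable M" "\<And>x. 0 \<le> f x" "(\<integral>\<^sup>+x. ennreal (f x) \<partial>M) \<le> ennreal c" "0 \<le> c"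
  shows "integrable M f" "integral\<^sup>L M f \<le> c"
proof -
  show int: "integrable M f"
    by (rule integrableI_nonneg) (use assms in \<open>auto simp: le_less_trans\<close>)
  have "ennreal (integral\<^sup>L M f) \<le> ennreal c"
    using assms nn_integral_eq_integral[OF int] by simp
  then show "integral\<^sup>L M f \<le> c" using assms(4) by simp
qed

lemma power4_sum_le:
  fixes p q :: real assumes "0 \<le> p" "0 \<le> q" shows "(p + q) ^ 4 \<le> 8 * p ^ 4 + 8 * q ^ 4"
proof -
  have sq: "(u + v)\<^sup>2 \<le> 2 * u\<^sup>2 + 2 * v\<^sup>2" for u v :: real
    using sum_squares_bound[of u v] by (simp add: power2_sum)
  have "(p + q) ^ 4 = ((p + q)\<^sup>2)\<^sup>2" by simp
  also have "\<dots> \<le> (2 * p\<^sup>2 + 2 * q\<^sup>2)\<^sup>2" by (intro power_mono sq) simp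
  also have "\<dots> \<le> 2 * (2 * p\<^sup>2)\<^sup>2 + 2 * (2 * q\<^sup>2)\<^sup>2" by (rule sq)
  also have "\<dots> = 8 * p ^ 4 + 8 * q ^ 4" by (simp add: power_mult_distrib)
  finally show ?thesis .
qed

text \<open>Used with \<open>r\<^sup>2\<close> equal to the step length: a second moment is bounded
  by the step length plus a fourth moment divided by it, both of first order in the step.\<close>

lemma square_le_quartic:
  fixes r N :: real assumes "0 < r" shows "N\<^sup>2 \<le> r\<^sup>2 + N ^ 4 / r\<^sup>2"
proof (cases "N\<^sup>2 \<le> r\<^sup>2")
  case True
  then show ?thesis by (simp add: add_increasing2)
next
  case False
  then have "N\<^sup>2 * r\<^sup>2 \<le> N\<^sup>2 * N\<^sup>2" by (intro mult_left_mono) auto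
  also have "N\<^sup>2 * N\<^sup>2 = N ^ 4" by (simp add: power_add[symmetric])
  finally have "N\<^sup>2 \<le> N ^ 4 / r\<^sup>2" using assms by (simp add: pos_le_divide_eq)
  then show ?thesis by (simp add: add_increasing)
qed

text \<open>With \<open>r\<^sup>2\<close> the step length and a fourth moment of \<open>N\<close> of
  order \<open>r ^ 4\<close>, both terms on the right have mean of order \<open>r ^ 3\<close>;
  products of drift and noise are thus negligible.\<close>

lemma linear_le_quartic:
  fixes r N :: real assumes "0 < r" "0 \<le> N" shows "r\<^sup>2 * N \<le> r ^ 3 + N ^ 4 / r"
proof (cases "N \<le> r")
  case True
  then have "r\<^sup>2 * N \<le> r\<^sup>2 * r" by (intro mult_left_mono) auto
  also have "\<dots> = r ^ 3" by (simp add: power2_eq_square power3_eq_cube)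
  finally show ?thesis using assms by (simp add: add_increasing2)
next
  case False
  then have "r ^ 3 * N \<le> N ^ 3 * N" using assms by (intro mult_right_mono power_mono) auto
  then have "r\<^sup>2 * N * r \<le> N ^ 4" by (simp add: power2_eq_square power3_eq_cube power4_eq_xxxx mult_ac)
  then have "r\<^sup>2 * N \<le> N ^ 4 / r" using assms by (simp add: pos_le_divide_eq)
  then show ?thesis using assms by (simp add: add_increasing)
qed

lemma set_integrable_bounded_interval:
  fixes f :: "real \<Rightarrow> 'b::{banach, second_countable_topology}"
  assumes "f \<in> borel_measurable lborel" "\<And>u. norm (f u) \<le> c" "s \<le> t"
  shows "set_integrable lborel {s<..t} f"
proof -
  have c: "0 \<le> c" using assms(2) norm_ge_zero order_trans by blast
  have "integrable lborel (\<lambda>u. indicator {s<..t} u *\<^sub>R c)"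
    using assms(3) by (intro integrable_scaleR_left) (simp add: integrable_indicator_iff)
  then show ?thesis
    unfolding set_integrable_def
    by (rule Bochner_Integration.integrable_bound)
       (use assms c in \<open>auto intro!: AE_I2 borel_measurable_scaleR split: split_indicator\<close>)
qed

text \<open>One time step, with all constants as parameters: they are to be chosen from the level
  set and the tolerance \<open>\<epsilon>\<close> before \<open>s\<close> and \<open>t\<close>,
  which makes the estimate uniform. In \<open>gen\<close> the derivatives are taken at
  \<open>x\<close> and the coefficients at \<open>z\<close>, because the derivatives are frozen at
  the start of the step.\<close>

locale step_setting = stopped_solution M F W b \<sigma> D x0 X T B k l
  for M :: "'w measure" and F :: "real \<Rightarrow> 'w measure" and W :: "real \<Rightarrow> 'w \<Rightarrow> real^'d"
    and b :: "real^'n \<Rightarrow> real^'n" and \<sigma> :: "real^'n \<Rightarrow> real^'d^'n" and D x0 X T B k l +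
  fixes \<gamma> cb C ch \<epsilon> Ct Cq s t :: real
  assumes \<gamma>: "0 \<le> \<gamma>" and st: "0 \<le> s" "s < t" "t \<le> l" "t - s \<le> 1"
    and cb: "0 \<le> cb" "\<And>x. x \<in> K \<Longrightarrow> norm (b x) \<le> cb"
    and C: "0 \<le> C" "\<And>x. x \<in> K \<Longrightarrow> norm (\<sigma> x) \<le> C"
    and ch: "0 \<le> ch" "\<And>x. x \<in> K \<Longrightarrow> norm (hessian B x) \<le> ch"
    and \<epsilon>: "0 < \<epsilon>" and Ct: "0 \<le> Ct" and Cq: "0 \<le> Cq"
    and Taylor: "\<And>x z. x \<in> K \<Longrightarrow> z \<in> K \<Longrightarrow>
       \<bar>B z - B x - gradient B x \<bullet> (z - x) - 1/2 * ((z - x) \<bullet> (hessian B x *v (z - x)))\<bar>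
            \<le> \<epsilon> * (norm (z - x))\<^sup>2 + Ct * norm (z - x) ^ 4"
    and gen: "\<And>x z. x \<in> K \<Longrightarrow> z \<in> K \<Longrightarrow>
       gradient B x \<bullet> b z + 1/2 * (\<sigma> z \<bullet> (hessian B x ** \<sigma> z)) - \<gamma> * B x \<le> \<epsilon> + Cq * (norm (z - x))\<^sup>2"
begin

text \<open>
  \<open>\<eta>\<close> and \<open>A\<close> are the gradient and the Hessian at \<open>Z s\<close>, cut off after \<open>\<tau>\<close>: there the stopped
  process does not move, and the cut makes them measurable with respect to \<open>F s\<close>.
\<close>

definition "\<delta> = t - s"
definition "r = sqrt \<delta>"
definition "K4 = 48 * (real CARD('n))\<^sup>2 * exp (C\<^sup>2 / 2)"
definition "drift_inc \<omega> = (LINT u:{s<..t}|lborel. drift u \<omega>)"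
definition "\<eta> \<omega> = (if s < \<tau> \<omega> then (if ereal s < T \<omega> then gradient B (X s \<omega>) else 0) else 0)"
definition "A \<omega> = (if s < \<tau> \<omega> then (if ereal s < T \<omega> then hessian B (X s \<omega>) else 0) else 0)"
definition "I2 \<omega> = (LINT u:{s<..t}|lborel. diffusion u \<omega> \<bullet> (A \<omega> ** diffusion u \<omega>))"
definition "S \<omega> = (LINT u:{s<..t}|lborel. (norm (Z u \<omega> - Z s \<omega>))\<^sup>2)"
text \<open>\<open>\<alpha>\<close> and \<open>\<beta>\<close> split the error of a step into a
  deterministic part and a multiple of the fourth power of the Ito increment. Every term contributes
  in the mean at most order \<open>\<epsilon> * \<delta>\<close> or order
  \<open>\<delta> * r\<close>.\<close>

definition "\<alpha> = ch * cb * r ^ 3 + ch * cb\<^sup>2 * r ^ 4 + 2 * \<epsilon> * cb\<^sup>2 * r ^ 4 + 2 * \<epsilon> * r\<^sup>2 + 8 * Ct * cb ^ 4 * r ^ 8"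
definition "\<beta> = ch * cb / r + 2 * \<epsilon> / r\<^sup>2 + 8 * Ct"

lemma \<delta>_pos: "0 < \<delta>" and \<delta>_le: "\<delta> \<le> 1" and r_pos: "0 < r" and r_le: "r \<le> 1" and r_sq: "r\<^sup>2 = \<delta>" and K4_nonneg: "0 \<le> K4"
  using st by (auto simp: \<delta>_def r_def K4_def)

lemma \<alpha>_nonneg: "0 \<le> \<alpha>" and \<beta>_nonneg: "0 \<le> \<beta>"
  using ch(1) cb(1) \<epsilon> Ct r_pos by (auto simp: \<alpha>_def \<beta>_def)

lemma drift_norm_le: "norm (drift u \<omega>) \<le> cb"
  using cb Z_in_K by (simp add: drift_def)

lemma diffusion_norm_le: "norm (diffusion u \<omega>) \<le> C"
  using C Z_in_K by (simp add: diffusion_def)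

lemma drift_integral_bound:
  assumes "\<omega> \<in> space M" "s < v" shows "norm (LINT u:{s<..v}|lborel. drift u \<omega>) \<le> cb * (v - s)"
proof -
  have "norm (LINT u:{s<..v}|lborel. drift u \<omega>) \<le> (LINT u:{s<..v}|lborel. norm (drift u \<omega>))"
    using assms by (intro set_integral_norm_bound drift_set_integrable) auto
  also have "\<dots> \<le> (LINT u:{s<..v}|lborel. cb)"
  proof (rule set_integral_mono)
    show "set_integrable lborel {s<..v} (\<lambda>u. norm (drift u \<omega>))"
      using assms by (intro set_integrable_norm drift_set_integrable) auto
    show "set_integrable lborel {s<..v} (\<lambda>u. cb)"
      using assms cb(1) by (intro set_integrable_bounded_interval[where c=cb]) auto
  qed (rule drift_norm_le)
  also have "\<dots> = cb * (v - s)" using assms by (simp add: set_lebesgue_integral_def mult.commute)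
  finally show ?thesis .
qed

lemma drift_inc_bound: "\<omega> \<in> space M \<Longrightarrow> norm (drift_inc \<omega>) \<le> cb * \<delta>"
  unfolding drift_inc_def \<delta>_def by (rule drift_integral_bound[OF _ st(2)])

text \<open>\<open>p\<close> and \<open>N\<close> stand for the norms of the drift part and the Ito
  part of the increment, \<open>m\<close> for the norm of the whole. The first summand comes from
  the Hessian form, where the drift enters, the second from the Taylor remainder; lower powers of
  \<open>N\<close> are traded for \<open>N ^ 4\<close> at scale \<open>r\<close>.\<close>

lemma remainder_le:
  assumes N: "0 \<le> N" and p: "0 \<le> p" "p \<le> cb * \<delta>" and m: "0 \<le> m" "m \<le> p + N"
  shows "ch * (p * N + p\<^sup>2) + (\<epsilon> * m\<^sup>2 + Ct * m ^ 4) \<le> \<alpha> + \<beta> * N ^ 4"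
proof -
  have p': "p \<le> cb * r\<^sup>2" using p(2) r_sq by simp
  have pN: "p * N \<le> cb * (r ^ 3 + N ^ 4 / r)"
  proof -
    have "p * N \<le> cb * r\<^sup>2 * N" using p' N by (intro mult_right_mono)
    also have "\<dots> = cb * (r\<^sup>2 * N)" by simp
    also have "\<dots> \<le> cb * (r ^ 3 + N ^ 4 / r)" using cb(1) linear_le_quartic[OF r_pos N] by (intro mult_left_mono)
    finally show ?thesis .
  qed
  have p2: "p\<^sup>2 \<le> cb\<^sup>2 * r ^ 4"
    using power_mono[OF p' p(1), of 2] by (simp add: power_mult_distrib)
  have p4: "p ^ 4 \<le> cb ^ 4 * r ^ 8"
    using power_mono[OF p' p(1), of 4] by (simp add: power_mult_distrib)
  have m2: "m\<^sup>2 \<le> 2 * (cb\<^sup>2 * r ^ 4) + 2 * (r\<^sup>2 + N ^ 4 / r\<^sup>2)"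
  proof -
    have "m\<^sup>2 \<le> (p + N)\<^sup>2" using m by (intro power_mono)
    also have "\<dots> \<le> 2 * p\<^sup>2 + 2 * N\<^sup>2" using sum_squares_bound[of p N] by (simp add: power2_sum)
    also have "\<dots> \<le> 2 * (cb\<^sup>2 * r ^ 4) + 2 * (r\<^sup>2 + N ^ 4 / r\<^sup>2)"
      using p2 square_le_quartic[OF r_pos, of N] by (intro add_mono mult_left_mono) auto
    finally show ?thesis .
  qed
  have m4: "m ^ 4 \<le> 8 * (cb ^ 4 * r ^ 8) + 8 * N ^ 4"
  proof -
    have "m ^ 4 \<le> (p + N) ^ 4" using m by (intro power_mono)
    also have "\<dots> \<le> 8 * p ^ 4 + 8 * N ^ 4" by (rule power4_sum_le[OF p(1) N])
    finally show ?thesis using p4 by simp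
  qed
  have "ch * (p * N + p\<^sup>2) + (\<epsilon> * m\<^sup>2 + Ct * m ^ 4) \<le> ch * (cb * (r ^ 3 + N ^ 4 / r) + cb\<^sup>2 * r ^ 4)
     + (\<epsilon> * (2 * (cb\<^sup>2 * r ^ 4) + 2 * (r\<^sup>2 + N ^ 4 / r\<^sup>2)) + Ct * (8 * (cb ^ 4 * r ^ 8) + 8 * N ^ 4))"
    using pN p2 m2 m4 ch(1) \<epsilon> Ct by (intro add_mono mult_left_mono) auto
  also have "\<dots> = \<alpha> + \<beta> * N ^ 4" by (simp add: \<alpha>_def \<beta>_def algebra_simps)
  finally show ?thesis .
qed

text \<open>As \<open>r \<le> 1\<close>, higher powers of \<open>r\<close> may be lowered: to
  \<open>r\<^sup>2 = \<delta>\<close> in terms that carry a factor \<open>\<epsilon>\<close>, and to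
  \<open>r ^ 3 = \<delta> * r\<close> in all others.\<close>

lemma expected_remainder_le:
  "\<alpha> + \<beta> * (K4 * \<delta>\<^sup>2) \<le> \<delta> * (2 * \<epsilon> * (cb\<^sup>2 + 1 + K4) + r * (ch * cb * (1 + K4) + ch * cb\<^sup>2 + 8 * Ct * (cb ^ 4 + K4)))"
proof -
  have le1: "r ^ 4 \<le> r\<^sup>2" "r ^ 4 \<le> r ^ 3" "r ^ 8 \<le> r ^ 3"
    using r_pos r_le by (auto intro: power_decreasing)
  have d: "\<delta> = r\<^sup>2" using r_sq by simp
  have "\<alpha> \<le> ch * cb * r ^ 3 + ch * cb\<^sup>2 * r ^ 3 + 2 * \<epsilon> * cb\<^sup>2 * r\<^sup>2 + 2 * \<epsilon> * r\<^sup>2 + 8 * Ct * cb ^ 4 * r ^ 3"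
    unfolding \<alpha>_def using ch(1) cb(1) \<epsilon> Ct le1 by (intro add_mono mult_left_mono) auto
  moreover have "\<beta> * (K4 * \<delta>\<^sup>2) = ch * cb * K4 * r ^ 3 + 2 * \<epsilon> * K4 * r\<^sup>2 + 8 * Ct * K4 * r ^ 4"
    unfolding \<beta>_def d using r_pos by (simp add: field_simps power2_eq_square power3_eq_cube power4_eq_xxxx)
  moreover have "8 * Ct * K4 * r ^ 4 \<le> 8 * Ct * K4 * r ^ 3"
    using Ct K4_nonneg le1 by (intro mult_left_mono) auto
  ultimately show ?thesis
    unfolding d by (simp add: algebra_simps power2_eq_square power3_eq_cube)
qed

lemma Z_diff_set_integrable:
  assumes w: "\<omega> \<in> space M" shows "set_integrable lborel {s<..t} (\<lambda>u. (norm (Z u \<omega> - Z s \<omega>))\<^sup>2)"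
proof -
  obtain c where c: "\<And>x. x \<in> K \<Longrightarrow> norm x \<le> c" using compact_imp_bounded[OF K_comp] by (auto simp: bounded_iff)
  have "norm ((norm (Z u \<omega> - Z s \<omega>))\<^sup>2) \<le> (2 * c)\<^sup>2" for u
  proof -
    have "norm (Z u \<omega> - Z s \<omega>) \<le> 2 * c"
      using norm_triangle_ineq4[of "Z u \<omega>" "Z s \<omega>"] c[OF Z_in_K, of u \<omega>] c[OF Z_in_K, of s \<omega>] by linarith
    from power_mono[OF this norm_ge_zero, of 2] show ?thesis by simp
  qed
  moreover have "(\<lambda>u. (norm (Z u \<omega> - Z s \<omega>))\<^sup>2) \<in> borel_measurable lborel"
    using jointly_measurable_section[OF Z_jointly_measurable w]
    by (intro borel_measurable_power borel_measurable_norm[THEN measurable_compose[rotated]] borel_measurable_diff borel_measurable_const)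
  ultimately show ?thesis
    using st by (intro set_integrable_bounded_interval[where c="(2 * c)\<^sup>2"]) auto
qed

lemma quadratic_set_integrable:
  assumes w: "\<omega> \<in> space M" shows "set_integrable lborel {s<..t} (\<lambda>u. diffusion u \<omega> \<bullet> (Q ** diffusion u \<omega>))"
proof (rule set_integrable_bounded_interval[where c="C * (norm Q * C)"])
  have "continuous_on UNIV (\<lambda>Y :: real^'d^'n. Y \<bullet> (Q ** Y))"
      by (intro continuous_intros continuous_on_matrix_mult)
  from borel_measurable_continuous_on[OF this jointly_measurable_section[OF diffusion_jointly_measurable w]]
  show "(\<lambda>u. diffusion u \<omega> \<bullet> (Q ** diffusion u \<omega>)) \<in> borel_measurable lborel" .
  fix u
  have "norm (Q ** diffusion u \<omega>) \<le> norm Q * C"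
    by (rule order_trans[OF norm_matrix_matrix_mult_le mult_left_mono[OF diffusion_norm_le]]) simp
  from order_trans[OF Cauchy_Schwarz_ineq2 mult_mono[OF diffusion_norm_le this C(1) norm_ge_zero]]
  show "norm (diffusion u \<omega> \<bullet> (Q ** diffusion u \<omega>)) \<le> C * (norm Q * C)" by simp
qed (use st in simp)

text \<open>Taylor's formula at \<open>Z s\<close>, with the increment split into drift and Ito
  part. The term \<open>I2\<close>, added and subtracted, links two halves: together with the drift
  it is the integrated generator, bounded through \<open>gen\<close>, and against the quadratic form
  in \<open>J\<close> it cancels in the mean.\<close>

lemma pointwise_step:
  assumes w: "\<omega> \<in> regular" and eq: "Z t \<omega> - Z s \<omega> = drift_inc \<omega> + J"
  shows "B (Z t \<omega>) \<le> B (Z s \<omega>) * (1 + \<gamma> * \<delta>) + \<delta> * \<epsilon> + Cq * S \<omega> + \<eta> \<omega> \<bullet> J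
     + 1/2 * (J \<bullet> (A \<omega> *v J)) - 1/2 * I2 \<omega> + \<alpha> + \<beta> * norm J ^ 4"
proof -
  have M: "\<omega> \<in> space M" by (rule regular_space[OF w])
  have Bs: "0 \<le> B (Z s \<omega>)" using B_nonneg Z_in_D by blast
  have S0: "0 \<le> S \<omega>" unfolding S_def set_lebesgue_integral_def by (intro Bochner_Integration.integral_nonneg) simp
  have N4: "0 \<le> \<beta> * norm J ^ 4" using \<beta>_nonneg by simp
  show ?thesis
  proof (cases "s < \<tau> \<omega>")
    \<comment> \<open>After \<open>\<tau>\<close> nothing moves and the cut-off terms vanish, so the
      remaining summands only have to be nonnegative.\<close>
    case False
    then have "Z t \<omega> = Z s \<omega>" using Z_stopped[OF w, of s t] st by simp
    moreover have "\<eta> \<omega> = 0" "A \<omega> = 0" using False by (auto simp: \<eta>_def A_def)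
    moreover have "I2 \<omega> = 0" unfolding I2_def set_lebesgue_integral_def
      using \<open>A \<omega> = 0\<close> by simp
    moreover have "0 \<le> B (Z s \<omega>) * (\<gamma> * \<delta>)" "0 \<le> \<delta> * \<epsilon>" "0 \<le> Cq * S \<omega>"
      using Bs \<gamma> \<delta>_pos \<epsilon> Cq S0 by auto
    ultimately show ?thesis using \<alpha>_nonneg N4 by (simp add: distrib_left)
  next
    case True
    have sT: "ereal s < T \<omega>" using w True T_downward[of "\<tau> \<omega>" \<omega> s] by (simp add: regular_def)
    have Zs: "Z s \<omega> = X s \<omega>" using Z_eq[OF w st(1)] True by simp
    have \<eta>: "\<eta> \<omega> = gradient B (Z s \<omega>)" and A: "A \<omega> = hessian B (Z s \<omega>)"
      using True sT Zs by (auto simp: \<eta>_def A_def)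
    let ?x = "Z s \<omega>" and ?H = "hessian B (Z s \<omega>)"
    have Hb: "norm (?H *v v) \<le> ch * norm v" for v
      by (rule order_trans[OF norm_matrix_vector_mult_le mult_right_mono[OF ch(2)[OF Z_in_K]]]) simp
    have "B (Z t \<omega>) - B ?x - gradient B ?x \<bullet> (drift_inc \<omega> + J) - 1/2 * ((drift_inc \<omega> + J) \<bullet> (?H *v (drift_inc \<omega> + J)))
       \<le> \<epsilon> * (norm (drift_inc \<omega> + J))\<^sup>2 + Ct * norm (drift_inc \<omega> + J) ^ 4"
      using Taylor[OF Z_in_K[of s \<omega>] Z_in_K[of t \<omega>]] unfolding eq by linarith
    moreover have "1/2 * ((drift_inc \<omega> + J) \<bullet> (?H *v (drift_inc \<omega> + J))) \<le> 1/2 * (J \<bullet> (?H *v J)) + ch * (norm (drift_inc \<omega>) * norm J + (norm (drift_inc \<omega>))\<^sup>2)"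
    proof -
      have "(drift_inc \<omega> + J) \<bullet> (?H *v (drift_inc \<omega> + J)) = J \<bullet> (?H *v J) + drift_inc \<omega> \<bullet> (?H *v J) + J \<bullet> (?H *v drift_inc \<omega>) + drift_inc \<omega> \<bullet> (?H *v drift_inc \<omega>)"
        by (simp add: matrix_vector_right_distrib inner_add_left inner_add_right)
      moreover have cs: "u \<bullet> (?H *v v) \<le> norm u * (ch * norm v)" for u v
        by (rule order_trans[OF norm_cauchy_schwarz mult_left_mono[OF Hb]]) simp
      ultimately have "(drift_inc \<omega> + J) \<bullet> (?H *v (drift_inc \<omega> + J)) \<le> J \<bullet> (?H *v J) + norm (drift_inc \<omega>) * (ch * norm J) + norm J * (ch * norm (drift_inc \<omega>)) + norm (drift_inc \<omega>) * (ch * norm (drift_inc \<omega>))"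
        using cs[of "drift_inc \<omega>" J] cs[of J "drift_inc \<omega>"] cs[of "drift_inc \<omega>" "drift_inc \<omega>"] by linarith
      moreover have "norm (drift_inc \<omega>) * (ch * norm (drift_inc \<omega>)) \<ge> 0" using ch(1) by simp
      ultimately show ?thesis by (simp add: algebra_simps power2_eq_square)
    qed
    moreover have "ch * (norm (drift_inc \<omega>) * norm J + (norm (drift_inc \<omega>))\<^sup>2) + (\<epsilon> * (norm (drift_inc \<omega> + J))\<^sup>2 + Ct * norm (drift_inc \<omega> + J) ^ 4) \<le> \<alpha> + \<beta> * norm J ^ 4"
      by (rule remainder_le) (use drift_inc_bound[OF M] norm_triangle_ineq in auto)
    moreover have "gradient B ?x \<bullet> drift_inc \<omega> + 1/2 * I2 \<omega> \<le> \<delta> * (\<gamma> * B ?x + \<epsilon>) + Cq * S \<omega>"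
    proof -
      let ?f = "\<lambda>u. \<eta> \<omega> \<bullet> drift u \<omega> + 1/2 * (diffusion u \<omega> \<bullet> (A \<omega> ** diffusion u \<omega>))"
      have i1: "set_integrable lborel {s<..t} (\<lambda>u. \<eta> \<omega> \<bullet> drift u \<omega>)"
      proof -
        have "integrable lborel (\<lambda>u. \<eta> \<omega> \<bullet> (indicator {s<..t} u *\<^sub>R drift u \<omega>))"
          using drift_set_integrable[OF M, of s t] st by (intro integrable_inner_right) (simp add: set_integrable_def)
        then show ?thesis by (simp add: set_integrable_def)
      qed
      note i2 = set_integrable_mult_right[OF quadratic_set_integrable[OF M], of "1/2" "A \<omega>"]
      have e1: "\<eta> \<omega> \<bullet> drift_inc \<omega> = (LINT u:{s<..t}|lborel. \<eta> \<omega> \<bullet> drift u \<omega>)"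
      proof -
        have "(\<integral>u. \<eta> \<omega> \<bullet> (indicator {s<..t} u *\<^sub>R drift u \<omega>) \<partial>lborel) = \<eta> \<omega> \<bullet> (\<integral>u. indicator {s<..t} u *\<^sub>R drift u \<omega> \<partial>lborel)"
          using drift_set_integrable[OF M, of s t] st by (intro integral_inner_right) (simp add: set_integrable_def)
        then show ?thesis by (simp add: drift_inc_def set_lebesgue_integral_def)
      qed
      have e2: "1/2 * I2 \<omega> = (LINT u:{s<..t}|lborel. 1/2 * (diffusion u \<omega> \<bullet> (A \<omega> ** diffusion u \<omega>)))"
        unfolding I2_def by simp
      have i3: "set_integrable lborel {s<..t} (\<lambda>u. \<gamma> * B ?x + \<epsilon>)"
        using st by (intro set_integrable_bounded_interval[where c="\<bar>\<gamma> * B ?x + \<epsilon>\<bar>"]) auto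
      note i4 = set_integrable_mult_right[OF Z_diff_set_integrable[OF M], of Cq]
      have "gradient B ?x \<bullet> drift_inc \<omega> + 1/2 * I2 \<omega> = (LINT u:{s<..t}|lborel. ?f u)"
        unfolding \<eta>[symmetric] e1 e2 by (rule set_integral_add(2)[OF i1 i2, symmetric])
      also have "\<dots> \<le> (LINT u:{s<..t}|lborel. (\<gamma> * B ?x + \<epsilon>) + Cq * (norm (Z u \<omega> - ?x))\<^sup>2)"
      proof (rule set_integral_mono[OF set_integral_add(1)[OF i1 i2] set_integral_add(1)[OF i3 i4]])
        fix u assume u: "u \<in> {s<..t}"
        show "?f u \<le> (\<gamma> * B ?x + \<epsilon>) + Cq * (norm (Z u \<omega> - ?x))\<^sup>2"
        proof (cases "u \<le> \<tau> \<omega>")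
          case True
          then have "alive u \<omega>" using w u st by (simp add: alive_def)
          then show ?thesis using gen[OF Z_in_K[of s \<omega>] Z_in_K[of u \<omega>]] by (simp add: drift_def diffusion_def \<eta> A)
        next
          \<comment> \<open>Past \<open>\<tau>\<close> both coefficients are \<open>0\<close>, and
            the right side is nonnegative because \<open>B\<close> is.\<close>
          case False
          then have "\<not> alive u \<omega>" by (simp add: alive_def)
          then show ?thesis using Bs \<gamma> \<epsilon> Cq by (simp add: drift_def diffusion_def)
        qed
      qed
      also have "\<dots> = (LINT u:{s<..t}|lborel. \<gamma> * B ?x + \<epsilon>) + Cq * S \<omega>"
        unfolding set_integral_add(2)[OF i3 i4] S_def by simp
      also have "(LINT u:{s<..t}|lborel. \<gamma> * B ?x + \<epsilon>) = \<delta> * (\<gamma> * B ?x + \<epsilon>)"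
        using st by (simp add: set_lebesgue_integral_def \<delta>_def)
      finally show ?thesis .
    qed
    ultimately show ?thesis unfolding \<eta> A by (simp add: inner_add_right algebra_simps)
  qed
qed

lemma stopped_adapted:
  fixes u :: "real^'n \<Rightarrow> 'b::euclidean_space"
  assumes u: "continuous_on D u"
  shows "(\<lambda>\<omega>. if s < \<tau> \<omega> then (if ereal s < T \<omega> then u (X s \<omega>) else 0) else 0) \<in> borel_measurable (F s)"
    "bounded ((\<lambda>\<omega>. if s < \<tau> \<omega> then (if ereal s < T \<omega> then u (X s \<omega>) else 0) else 0) ` space M)"
proof -
  show "(\<lambda>\<omega>. if s < \<tau> \<omega> then (if ereal s < T \<omega> then u (X s \<omega>) else 0) else 0) \<in> borel_measurable (F s)"
    using stopping_timeD2[OF stopping_\<tau>, of s]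
    by (intro measurable_If comp_X_adapted[OF u st(1)]) (auto simp: pred_def)
  obtain c where c: "0 \<le> c" "\<And>x. x \<in> K \<Longrightarrow> norm (u x) \<le> c" using K_bound[OF u] by blast
  have "X s \<omega> \<in> K" if "\<omega> \<in> space M" "s < \<tau> \<omega>" "ereal s < T \<omega>" for \<omega>
    using before_\<tau>[OF that(1) st(1) that(2,3)] X_in_D[OF that(1) st(1) that(3)] by (simp add: K_def)
  then show "bounded ((\<lambda>\<omega>. if s < \<tau> \<omega> then (if ereal s < T \<omega> then u (X s \<omega>) else 0) else 0) ` space M)"
    unfolding bounded_iff by (intro exI[of _ c]) (auto simp: c)
qed

lemma \<eta>_adapted: "\<eta> \<in> borel_measurable (F s)" "bounded (\<eta> ` space M)"
  and A_adapted: "A \<in> borel_measurable (F s)" "bounded (A ` space M)"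
  unfolding \<eta>_def[abs_def] A_def[abs_def]
  by (rule stopped_adapted[OF C2_on_continuous(2)[OF B]] stopped_adapted[OF C2_on_continuous(3)[OF B]])+

text \<open>The fourth moment of the Ito part already controls the second one at scale
  \<open>sqrt (v - s)\<close>; the result is of first order in the step.\<close>

lemma Z_second_moment:
  assumes v: "s < v" "v \<le> t"
  shows "(\<integral>\<^sup>+\<omega>. ennreal ((norm (Z v \<omega> - Z s \<omega>))\<^sup>2) \<partial>M) \<le> ennreal (2 * cb\<^sup>2 * \<delta>\<^sup>2 + 2 * (1 + K4) * \<delta>)"
proof -
  have vl: "v \<le> l" using v st by simp
  obtain H J0 J1 where i: "has_ito_integral M F W H s J0" "has_ito_integral M F W H v J1"
    "AE \<omega> in M. \<forall>u\<in>{0<..v}. H u \<omega> = diffusion u \<omega>"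
    and dec: "AE \<omega> in M. Z v \<omega> - Z s \<omega> = (LINT u:{s<..v}|lborel. drift u \<omega>) + (J1 \<omega> - J0 \<omega>)"
    using increment_decomposition[OF st(1) v(1) vl] by blast
  have J4: "(\<integral>\<^sup>+\<omega>. ennreal (norm (J1 \<omega> - J0 \<omega>) ^ 4) \<partial>M) \<le> ennreal (K4 * (v - s)\<^sup>2)"
    unfolding K4_def by (rule ito_increment_fourth_moment[OF i(1,2) st(1) v(1) diffusion_jointly_measurable C(1) diffusion_norm_le i(3)])
  have [measurable]: "J0 \<in> borel_measurable M" "J1 \<in> borel_measurable M"
    using i by (auto simp: has_ito_integral_def)
  let ?d = "v - s"
  have d: "0 < ?d" "?d \<le> \<delta>" using v by (auto simp: \<delta>_def)
  have "(\<integral>\<^sup>+\<omega>. ennreal ((norm (Z v \<omega> - Z s \<omega>))\<^sup>2) \<partial>M)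
      \<le> (\<integral>\<^sup>+\<omega>. ennreal (2 * cb\<^sup>2 * ?d\<^sup>2 + 2 * ?d) + ennreal (2 / ?d) * ennreal (norm (J1 \<omega> - J0 \<omega>) ^ 4) \<partial>M)"
  proof (rule nn_integral_mono_AE, rule eventually_mono[OF eventually_conj[OF dec AE_space]])
    fix \<omega> assume elim: "Z v \<omega> - Z s \<omega> = (LINT u:{s<..v}|lborel. drift u \<omega>) + (J1 \<omega> - J0 \<omega>) \<and> \<omega> \<in> space M"
    let ?N = "norm (J1 \<omega> - J0 \<omega>)" and ?p = "norm (LINT u:{s<..v}|lborel. drift u \<omega>)"
    have dec': "Z v \<omega> - Z s \<omega> = (LINT u:{s<..v}|lborel. drift u \<omega>) + (J1 \<omega> - J0 \<omega>)" and w: "\<omega> \<in> space M"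
      using elim by auto
    have "(norm (Z v \<omega> - Z s \<omega>))\<^sup>2 \<le> (?p + ?N)\<^sup>2"
      unfolding dec' by (intro power_mono norm_triangle_ineq) simp
    also have "\<dots> \<le> 2 * ?p\<^sup>2 + 2 * ?N\<^sup>2" using sum_squares_bound[of ?p ?N] by (simp add: power2_sum)
    also have "\<dots> \<le> 2 * (cb * ?d)\<^sup>2 + 2 * (?d + ?N ^ 4 / ?d)"
    proof (intro add_mono mult_left_mono)
      show "?p\<^sup>2 \<le> (cb * ?d)\<^sup>2" using drift_integral_bound[OF w v(1)] by (intro power_mono) auto
      show "?N\<^sup>2 \<le> ?d + ?N ^ 4 / ?d"
        using square_le_quartic[of "sqrt ?d" ?N] d by simp
    qed auto
    finally have "(norm (Z v \<omega> - Z s \<omega>))\<^sup>2 \<le> (2 * cb\<^sup>2 * ?d\<^sup>2 + 2 * ?d) + 2 / ?d * ?N ^ 4"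
      by (simp add: power_mult_distrib)
    then have "ennreal ((norm (Z v \<omega> - Z s \<omega>))\<^sup>2) \<le> ennreal ((2 * cb\<^sup>2 * ?d\<^sup>2 + 2 * ?d) + 2 / ?d * ?N ^ 4)" by (rule ennreal_leI)
    also have "\<dots> = ennreal (2 * cb\<^sup>2 * ?d\<^sup>2 + 2 * ?d) + ennreal (2 / ?d) * ennreal (?N ^ 4)"
      using d by (subst ennreal_plus) (auto simp: ennreal_mult[symmetric])
    finally show "ennreal ((norm (Z v \<omega> - Z s \<omega>))\<^sup>2) \<le> ennreal (2 * cb\<^sup>2 * ?d\<^sup>2 + 2 * ?d) + ennreal (2 / ?d) * ennreal (?N ^ 4)" .
  qed
  also have "\<dots> = ennreal (2 * cb\<^sup>2 * ?d\<^sup>2 + 2 * ?d) + ennreal (2 / ?d) * (\<integral>\<^sup>+\<omega>. ennreal (norm (J1 \<omega> - J0 \<omega>) ^ 4) \<partial>M)"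
    by (subst nn_integral_add) (auto simp: nn_integral_cmult emeasure_space_1)
  also have "\<dots> \<le> ennreal (2 * cb\<^sup>2 * ?d\<^sup>2 + 2 * ?d) + ennreal (2 / ?d) * ennreal (K4 * ?d\<^sup>2)"
    by (intro add_left_mono mult_left_mono J4) simp
  also have "\<dots> = ennreal (2 * cb\<^sup>2 * ?d\<^sup>2 + 2 * ?d + 2 / ?d * (K4 * ?d\<^sup>2))"
    using d K4_nonneg by (subst ennreal_plus) (auto simp: ennreal_mult[symmetric])
  also have "2 * cb\<^sup>2 * ?d\<^sup>2 + 2 * ?d + 2 / ?d * (K4 * ?d\<^sup>2) = 2 * cb\<^sup>2 * ?d\<^sup>2 + 2 * (1 + K4) * ?d"
    using d by (simp add: field_simps power2_eq_square)
  also have "ennreal \<dots> \<le> ennreal (2 * cb\<^sup>2 * \<delta>\<^sup>2 + 2 * (1 + K4) * \<delta>)"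
    using d K4_nonneg by (intro ennreal_leI add_mono mult_left_mono power_mono) auto
  finally show ?thesis .
qed

text \<open>\<open>S\<close> integrates over the step a quantity whose mean is of first order, so by
  Fubini's theorem its mean is of second order, and a large constant \<open>Cq\<close> in front of
  it does no harm.\<close>

lemma S_expectation: "integrable M S" "expectation S \<le> \<delta> * (2 * cb\<^sup>2 * \<delta>\<^sup>2 + 2 * (1 + K4) * \<delta>)"
proof -
  let ?V = "2 * cb\<^sup>2 * \<delta>\<^sup>2 + 2 * (1 + K4) * \<delta>"
  have V: "0 \<le> ?V" using \<delta>_pos K4_nonneg by simp
  let ?f = "\<lambda>\<omega> u. indicator {s<..t} u *\<^sub>R (norm (Z u \<omega> - Z s \<omega>))\<^sup>2"
  have Zs: "Z s \<in> borel_measurable M" by (rule section_measurable[OF Z_jointly_measurable])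
  have jm: "case_prod ?f \<in> borel_measurable (M \<Otimes>\<^sub>M lborel)"
    unfolding case_prod_unfold using Z_jointly_measurable measurable_compose[OF measurable_fst Zs] by measurable
  have Sm: "S \<in> borel_measurable M"
    unfolding S_def[abs_def] set_lebesgue_integral_def by (rule lborel.borel_measurable_lebesgue_integral[OF jm])
  have S0: "0 \<le> S \<omega>" for \<omega>
    unfolding S_def set_lebesgue_integral_def by (intro Bochner_Integration.integral_nonneg) simp
  interpret P: pair_sigma_finite M lborel ..
  have "(\<integral>\<^sup>+\<omega>. ennreal (S \<omega>) \<partial>M) = (\<integral>\<^sup>+\<omega>. (\<integral>\<^sup>+u. ennreal (?f \<omega> u) \<partial>lborel) \<partial>M)"
  proof (intro nn_integral_cong)
    fix \<omega> assume w: "\<omega> \<in> space M"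
    show "ennreal (S \<omega>) = (\<integral>\<^sup>+u. ennreal (?f \<omega> u) \<partial>lborel)"
      using Z_diff_set_integrable[OF w] unfolding S_def set_lebesgue_integral_def set_integrable_def
      by (intro nn_integral_eq_integral[symmetric]) auto
  qed
  also have "\<dots> = (\<integral>\<^sup>+u. (\<integral>\<^sup>+\<omega>. ennreal (?f \<omega> u) \<partial>M) \<partial>lborel)"
    by (rule P.Fubini'[symmetric]) (use jm in measurable)
  also have "\<dots> \<le> (\<integral>\<^sup>+u. ennreal ?V * indicator {s<..t} u \<partial>lborel)"
  proof (intro nn_integral_mono)
    fix u
    show "(\<integral>\<^sup>+\<omega>. ennreal (?f \<omega> u) \<partial>M) \<le> ennreal ?V * indicator {s<..t} u"
      using Z_second_moment[of u] by (cases "u \<in> {s<..t}") simp_all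
  qed
  also have "\<dots> = ennreal (\<delta> * ?V)"
  proof -
    have "(\<integral>\<^sup>+u. ennreal v * indicator {s<..t} u \<partial>lborel) = ennreal (\<delta> * v)" if "0 \<le> v" for v
      using that st by (simp add: nn_integral_cmult_indicator ennreal_mult[symmetric] \<delta>_def mult.commute[of v])
    from this[OF V] show ?thesis .
  qed
  finally have "(\<integral>\<^sup>+\<omega>. ennreal (S \<omega>) \<partial>M) \<le> ennreal (\<delta> * ?V)" .
  from integral_le_of_nn_integral[OF Sm S0 this] show "integrable M S" "expectation S \<le> \<delta> * ?V"
    using V \<delta>_pos by auto
qed

lemma BZ_integrable: "integrable M (\<lambda>\<omega>. B (Z u \<omega>))"
proof (rule integrable_const_bound[where B=k])
  show "AE \<omega> in M. norm (B (Z u \<omega>)) \<le> k"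
    using Z_in_K B_nonneg[OF Z_in_D] by (intro AE_I2) (auto simp: K_def)
qed (rule comp_Z_measurable[OF C2_on_continuous(1)[OF B]])

text \<open>In the mean the term with \<open>\<eta>\<close> vanishes and the quadratic form in the
  Ito increment cancels against \<open>I2\<close>. Besides the growth factor there remains
  \<open>\<delta>\<close> times a multiple of \<open>\<epsilon>\<close> plus a multiple of
  \<open>r\<close>, and \<open>Ct\<close> and \<open>Cq\<close> enter only the latter.\<close>

lemma expectation_step:
  "expectation (\<lambda>\<omega>. B (Z t \<omega>)) \<le> expectation (\<lambda>\<omega>. B (Z s \<omega>)) * (1 + \<gamma> * \<delta>)
     + \<delta> * (\<epsilon> * (1 + 2 * (cb\<^sup>2 + 1 + K4))
        + r * (Cq * (2 * cb\<^sup>2 + 2 * (1 + K4)) + ch * cb * (1 + K4) + ch * cb\<^sup>2 + 8 * Ct * (cb ^ 4 + K4)))"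
proof -
  obtain H J0 J1 where i: "has_ito_integral M F W H s J0" "has_ito_integral M F W H t J1"
    "AE \<omega> in M. \<forall>u\<in>{0<..t}. H u \<omega> = diffusion u \<omega>"
    and dec: "AE \<omega> in M. Z t \<omega> - Z s \<omega> = (LINT u:{s<..t}|lborel. drift u \<omega>) + (J1 \<omega> - J0 \<omega>)"
    using increment_decomposition[OF st(1-3)] by blast
  let ?J = "\<lambda>\<omega>. J1 \<omega> - J0 \<omega>"
  have [measurable]: "J0 \<in> borel_measurable M" "J1 \<in> borel_measurable M"
    using i by (auto simp: has_ito_integral_def)
  note ito = i(1,2) st(1,2) diffusion_jointly_measurable C(1) diffusion_norm_le i(3)
  have J4: "(\<integral>\<^sup>+\<omega>. ennreal (norm (?J \<omega>) ^ 4) \<partial>M) \<le> ennreal (K4 * \<delta>\<^sup>2)"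
    unfolding K4_def \<delta>_def by (rule ito_increment_fourth_moment[OF ito])
  have N4: "integrable M (\<lambda>\<omega>. norm (?J \<omega>) ^ 4)" "expectation (\<lambda>\<omega>. norm (?J \<omega>) ^ 4) \<le> K4 * \<delta>\<^sup>2"
    by (rule integral_le_of_nn_integral[OF _ _ J4]; use K4_nonneg in simp)+
  have mean: "integrable M (\<lambda>\<omega>. \<eta> \<omega> \<bullet> ?J \<omega>)" "expectation (\<lambda>\<omega>. \<eta> \<omega> \<bullet> ?J \<omega>) = 0"
    using ito_increment_mean[OF ito \<eta>_adapted] by (auto simp: has_bochner_integral_iff)
  have quad: "integrable M I2" "integrable M (\<lambda>\<omega>. ?J \<omega> \<bullet> (A \<omega> *v ?J \<omega>))"
    "expectation (\<lambda>\<omega>. ?J \<omega> \<bullet> (A \<omega> *v ?J \<omega>)) = expectation I2"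
    using ito_increment_quadratic[OF ito A_adapted] by (auto simp: has_bochner_integral_iff I2_def[abs_def])
  let ?R = "\<lambda>\<omega>. B (Z s \<omega>) * (1 + \<gamma> * \<delta>) + \<delta> * \<epsilon> + Cq * S \<omega> + \<eta> \<omega> \<bullet> ?J \<omega>
     + 1/2 * (?J \<omega> \<bullet> (A \<omega> *v ?J \<omega>)) - 1/2 * I2 \<omega> + \<alpha> + \<beta> * norm (?J \<omega>) ^ 4"
  note ints = BZ_integrable S_expectation(1) mean(1) quad(1,2) N4(1)
  have "expectation (\<lambda>\<omega>. B (Z t \<omega>)) \<le> expectation ?R"
  proof (rule integral_mono_AE)
    show "AE \<omega> in M. B (Z t \<omega>) \<le> ?R \<omega>"
      using regular_AE dec by eventually_elim (rule pointwise_step, simp_all add: drift_inc_def)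
  qed (use ints in simp_all)
  also have "expectation ?R = expectation (\<lambda>\<omega>. B (Z s \<omega>)) * (1 + \<gamma> * \<delta>) + \<delta> * \<epsilon> + Cq * expectation S + 0
     + 1/2 * expectation I2 - 1/2 * expectation I2 + \<alpha> + \<beta> * expectation (\<lambda>\<omega>. norm (?J \<omega>) ^ 4)"
    using ints mean(2) quad(3) by (simp add: prob_space)
  also have "\<dots> \<le> expectation (\<lambda>\<omega>. B (Z s \<omega>)) * (1 + \<gamma> * \<delta>) + \<delta> * \<epsilon>
      + Cq * (\<delta> * (2 * cb\<^sup>2 * \<delta>\<^sup>2 + 2 * (1 + K4) * \<delta>)) + (\<alpha> + \<beta> * (K4 * \<delta>\<^sup>2))"
    using mult_left_mono[OF S_expectation(2) Cq] mult_left_mono[OF N4(2) \<beta>_nonneg] by simp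
  also have "\<dots> \<le> expectation (\<lambda>\<omega>. B (Z s \<omega>)) * (1 + \<gamma> * \<delta>) + \<delta> * \<epsilon>
      + Cq * (\<delta> * (2 * cb\<^sup>2 * r + 2 * (1 + K4) * r))
      + \<delta> * (2 * \<epsilon> * (cb\<^sup>2 + 1 + K4) + r * (ch * cb * (1 + K4) + ch * cb\<^sup>2 + 8 * Ct * (cb ^ 4 + K4)))"
  \<comment> \<open>Both \<open>\<delta>\<close> and \<open>\<delta>\<^sup>2\<close> are at most
    \<open>r\<close>, which brings the contribution of \<open>S\<close> into the same form as the
    other errors.\<close>
  proof (intro add_mono order_refl mult_left_mono expected_remainder_le)
    have "r\<^sup>2 \<le> r" using r_pos r_le by (simp add: power2_eq_square mult_left_le)
    then show "\<delta> \<le> r" using r_sq by simp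
    moreover have "\<delta>\<^sup>2 \<le> \<delta>" using \<delta>_pos \<delta>_le by (simp add: power2_eq_square mult_left_le)
    ultimately show "\<delta>\<^sup>2 \<le> r" by simp
  qed (use Cq \<delta>_pos K4_nonneg in auto)
  also have "\<dots> = expectation (\<lambda>\<omega>. B (Z s \<omega>)) * (1 + \<gamma> * \<delta>)
     + \<delta> * (\<epsilon> * (1 + 2 * (cb\<^sup>2 + 1 + K4))
        + r * (Cq * (2 * cb\<^sup>2 + 2 * (1 + K4)) + ch * cb * (1 + K4) + ch * cb\<^sup>2 + 8 * Ct * (cb ^ 4 + K4)))"
    by (simp add: algebra_simps)
  finally show ?thesis .
qed

end

section \<open>From one step to the whole horizon\<close>

context stopped_solution
begin

text \<open>The order of the choices matters. \<open>M1\<close> does not involve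
  \<open>\<epsilon>\<close>, so \<open>\<epsilon>\<close> is fixed by
  \<open>\<epsilon> * M1 = e / 2\<close>. Only then are \<open>Ct\<close> and \<open>Cq\<close>,
  hence \<open>M2\<close>, available; their size is compensated by the step length
  \<open>\<rho>\<^sup>2\<close> with \<open>\<rho> * M2 \<le> e / 2\<close>.\<close>

lemma step_estimate:
  assumes \<gamma>: "0 \<le> \<gamma>"
    and gen: "\<And>x. x \<in> D \<Longrightarrow> gradient B x \<bullet> b x + 1/2 * (\<sigma> x \<bullet> (hessian B x ** \<sigma> x)) \<le> \<gamma> * B x"
    and e: "0 < e"
  shows "\<exists>d>0. \<forall>s t. 0 \<le> s \<and> s < t \<and> t \<le> l \<and> t - s \<le> d \<longrightarrow>
    expectation (\<lambda>\<omega>. B (Z t \<omega>)) \<le> expectation (\<lambda>\<omega>. B (Z s \<omega>)) * (1 + \<gamma> * (t - s)) + e * (t - s)"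
proof -
  obtain cb where cb: "0 \<le> cb" "\<And>x. x \<in> K \<Longrightarrow> norm (b x) \<le> cb" using K_bound[OF b] by blast
  obtain C where C: "0 \<le> C" "\<And>x. x \<in> K \<Longrightarrow> norm (\<sigma> x) \<le> C" using K_bound[OF \<sigma>] by blast
  obtain ch where ch: "0 \<le> ch" "\<And>x. x \<in> K \<Longrightarrow> norm (hessian B x) \<le> ch"
    using K_bound[OF C2_on_continuous(3)[OF B]] by blast
  define K4 where "K4 = 48 * (real CARD('n))\<^sup>2 * exp (C\<^sup>2 / 2)"
  have K4: "0 \<le> K4" by (simp add: K4_def)
  define M1 where "M1 = 1 + 2 * (cb\<^sup>2 + 1 + K4)"
  have M1: "0 < M1" unfolding M1_def using K4 by (intro add_pos_nonneg mult_nonneg_nonneg add_nonneg_nonneg) auto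
  define \<epsilon> where "\<epsilon> = e / (2 * M1)"
  have \<epsilon>: "0 < \<epsilon>" and \<epsilon>M: "\<epsilon> * M1 = e / 2" using e M1 by (auto simp: \<epsilon>_def)
  obtain Ct where Ct: "0 \<le> Ct" "\<forall>x\<in>K. \<forall>z\<in>K. \<bar>B z - B x - gradient B x \<bullet> (z - x) - 1/2 * ((z - x) \<bullet> (hessian B x *v (z - x)))\<bar>
            \<le> \<epsilon> * (norm (z - x))\<^sup>2 + Ct * norm (z - x) ^ 4"
    using Taylor2_quartic_remainder[OF D B K_comp K_subset \<epsilon>] by blast
  let ?Q = "\<lambda>x z. gradient B x \<bullet> b z + 1/2 * (\<sigma> z \<bullet> (hessian B x ** \<sigma> z)) - \<gamma> * B x"
  have "\<exists>Cq\<ge>0. \<forall>x\<in>K. \<forall>z\<in>K. ?Q x z \<le> \<epsilon> + Cq * (norm (z - x))\<^sup>2"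
  proof (rule diagonal_nonpos_quadratic_bound[OF K_comp _ _ \<epsilon>])
    show "?Q x x \<le> 0" if "x \<in> K" for x using gen[of x] that K_subset by auto
    note c1 = C2_on_continuous[OF B, THEN continuous_on_comp_fst, OF K_subset, where L=K]
    note c2 = continuous_on_comp_snd[OF b K_subset, where L=K] continuous_on_comp_snd[OF \<sigma> K_subset, where L=K]
    have "continuous_on (K \<times> K) (\<lambda>p. hessian B (fst p) ** \<sigma> (snd p))"
      by (intro continuous_intros continuous_on_matrix_mult c1 c2)
    then show "continuous_on (K \<times> K) (\<lambda>(x, z). ?Q x z)"
      unfolding case_prod_unfold by (intro continuous_intros c1 c2)
  qed
  then obtain Cq where Cq: "0 \<le> Cq" "\<And>x z. x \<in> K \<Longrightarrow> z \<in> K \<Longrightarrow> ?Q x z \<le> \<epsilon> + Cq * (norm (z - x))\<^sup>2" by blast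
  define M2 where "M2 = Cq * (2 * cb\<^sup>2 + 2 * (1 + K4)) + ch * cb * (1 + K4) + ch * cb\<^sup>2 + 8 * Ct * (cb ^ 4 + K4)"
  have M2: "0 \<le> M2" unfolding M2_def using Cq(1) K4 ch(1) cb(1) Ct(1) by simp
  define \<rho> where "\<rho> = min 1 (e / (2 * (M2 + 1)))"
  have \<rho>: "0 < \<rho>" "\<rho> \<le> 1" using e M2 by (auto simp: \<rho>_def)
  have "\<rho> * M2 \<le> e / (2 * (M2 + 1)) * (M2 + 1)" using M2 e by (intro mult_mono) (auto simp: \<rho>_def)
  also have "\<dots> = e / 2" using M2 by (simp add: divide_simps)
  finally have \<rho>M: "\<rho> * M2 \<le> e / 2" .
  show ?thesis
  proof (intro exI[of _ "\<rho>\<^sup>2"] conjI allI impI)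
    show "0 < \<rho>\<^sup>2" using \<rho> by simp
    fix s t assume a: "0 \<le> s \<and> s < t \<and> t \<le> l \<and> t - s \<le> \<rho>\<^sup>2"
    have "\<rho>\<^sup>2 \<le> 1" using \<rho> by (simp add: power_le_one)
    then interpret step_setting M F W b \<sigma> D x0 X T B k l \<gamma> cb C ch \<epsilon> Ct Cq s t
      using \<gamma> a cb C ch \<epsilon> Ct Cq by unfold_locales auto
    have r: "sqrt (t - s) \<le> \<rho>" using a \<rho> by (intro real_le_lsqrt) auto
    have "expectation (\<lambda>\<omega>. B (Z t \<omega>)) \<le> expectation (\<lambda>\<omega>. B (Z s \<omega>)) * (1 + \<gamma> * (t - s)) + (t - s) * (\<epsilon> * M1 + sqrt (t - s) * M2)"
      using expectation_step unfolding \<delta>_def r_def K4_def M1_def M2_def \<open>K4 = _\<close> .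
    also have "\<dots> \<le> expectation (\<lambda>\<omega>. B (Z s \<omega>)) * (1 + \<gamma> * (t - s)) + (t - s) * (e / 2 + e / 2)"
      using a mult_right_mono[OF r M2] \<rho>M \<epsilon>M by (intro add_left_mono mult_left_mono add_mono) auto
    finally show "expectation (\<lambda>\<omega>. B (Z t \<omega>)) \<le> expectation (\<lambda>\<omega>. B (Z s \<omega>)) * (1 + \<gamma> * (t - s)) + e * (t - s)"
      by (simp add: mult.commute)
  qed
qed

lemma expectation_bound:
  assumes "0 \<le> \<gamma>" "\<And>x. x \<in> D \<Longrightarrow> gradient B x \<bullet> b x + 1/2 * (\<sigma> x \<bullet> (hessian B x ** \<sigma> x)) \<le> \<gamma> * B x"
  shows "expectation (\<lambda>\<omega>. B (Z l \<omega>)) \<le> exp (\<gamma> * l) * B x0"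
proof -
  have "expectation (\<lambda>\<omega>. B (Z l \<omega>)) \<le> exp (\<gamma> * l) * expectation (\<lambda>\<omega>. B (Z 0 \<omega>))"
    by (rule discrete_Gronwall[OF l assms(1) _ step_estimate[OF assms]])
       (auto intro!: Bochner_Integration.integral_nonneg B_nonneg Z_in_D)
  then show ?thesis by (simp add: Z_0 prob_space)
qed

section \<open>Probability of staying below the level\<close>

definition "confined = {\<omega>\<in>space M. \<forall>t\<in>{0..l}. ereal t < T \<omega> \<and> X t \<omega> \<in> D \<and> B (X t \<omega>) \<le> k}"

text \<open>Measurability matters: \<^const>\<open>measure\<close> is \<open>0\<close> on sets that are not measurable.\<close>

lemma confined_sets: "confined \<in> sets M"
proof -
  \<comment> \<open>On this event all times up to \<open>l\<close> lie in the lifetime, so the level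
    can be tested at fixed times.\<close>
  let ?P = "\<lambda>r. {\<omega>\<in>space M. ereal l < T \<omega> \<and> k < B (X r \<omega>)}"
  have P: "?P r \<in> sets M" if r: "0 \<le> r" "r \<le> l" for r
  proof -
    have "(\<lambda>\<omega>. if ereal r < T \<omega> then B (X r \<omega>) else 0) \<in> borel_measurable M"
      using comp_X_adapted[OF C2_on_continuous(1)[OF B] r(1)] by (rule measurable_F_M)
    then have "{\<omega>\<in>space M. k < (if ereal r < T \<omega> then B (X r \<omega>) else 0)} \<in> sets M" by measurable
    moreover have "{\<omega>\<in>space M. ereal l < T \<omega>} \<in> sets M" using T_adapted[OF l] sets_F_M by blast
    ultimately have "{\<omega>\<in>space M. ereal l < T \<omega>} \<inter> {\<omega>\<in>space M. k < (if ereal r < T \<omega> then B (X r \<omega>) else 0)} \<in> sets M" by blast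
    then show ?thesis
      by (rule back_subst[of "\<lambda>A. A \<in> sets M"]) (use T_downward[OF _ r(2)] in auto)
  qed
  \<comment> \<open>Exceeding \<open>k\<close> is an open condition along a continuous path: if it
    happens before \<open>l\<close>, it also happens at a rational time up to
    \<open>l\<close>.\<close>
  have dense: "\<exists>r\<in>insert l ({0..l} \<inter> \<rat>). k < B (X r \<omega>)"
    if w: "\<omega> \<in> space M" "ereal l < T \<omega>" and t: "0 \<le> t" "t \<le> l" "k < B (X t \<omega>)" for \<omega> t
  proof (cases "t = l")
    case False
    then have "t < l" using t by simp
    obtain \<delta> where \<delta>: "\<delta> > 0" "\<And>r. r \<in> {0..l} \<Longrightarrow> dist r t < \<delta> \<Longrightarrow> dist (B (X r \<omega>)) (B (X t \<omega>)) < B (X t \<omega>) - k"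
    proof -
      have "0 < B (X t \<omega>) - k" "t \<in> {0..l}" using t by auto
      then show ?thesis using BX_continuous_upto[OF w] that unfolding continuous_on_iff by blast
    qed
    have "t < min l (t + \<delta>)" using \<open>t < l\<close> \<delta> by simp
    then obtain r where r: "r \<in> \<rat>" "t < r" "r < min l (t + \<delta>)" using Rats_dense_in_real by blast
    have "dist (B (X r \<omega>)) (B (X t \<omega>)) < B (X t \<omega>) - k"
      using r t by (intro \<delta>(2)) (auto simp: dist_real_def)
    then have "k < B (X r \<omega>)" by (simp add: dist_real_def abs_less_iff)
    then show ?thesis using r t by (intro bexI[of _ r]) auto
  qed (use t in auto)
  have "confined = {\<omega>\<in>space M. ereal l < T \<omega>} - (\<Union>r\<in>insert l ({0..l} \<inter> \<rat>). ?P r)"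
  proof (intro set_eqI iffI)
    fix \<omega> assume c: "\<omega> \<in> confined"
    then have "\<omega> \<in> space M" "ereal l < T \<omega>" using l by (auto simp: confined_def)
    moreover have "B (X r \<omega>) \<le> k" if "r \<in> insert l ({0..l} \<inter> \<rat>)" for r
      using c that l by (auto simp: confined_def)
    ultimately show "\<omega> \<in> {\<omega>\<in>space M. ereal l < T \<omega>} - (\<Union>r\<in>insert l ({0..l} \<inter> \<rat>). ?P r)"
      by (auto simp: not_less[symmetric])
  next
    fix \<omega> assume d: "\<omega> \<in> {\<omega>\<in>space M. ereal l < T \<omega>} - (\<Union>r\<in>insert l ({0..l} \<inter> \<rat>). ?P r)"
    then have w: "\<omega> \<in> space M" "ereal l < T \<omega>" by auto
    have "ereal t < T \<omega> \<and> X t \<omega> \<in> D \<and> B (X t \<omega>) \<le> k" if t: "t \<in> {0..l}" for t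
    proof -
      have "ereal t < T \<omega>" using T_downward[OF w(2)] t by simp
      moreover have "B (X t \<omega>) \<le> k"
      proof (rule ccontr)
        assume "\<not> B (X t \<omega>) \<le> k"
        then have "0 \<le> t" "t \<le> l" "k < B (X t \<omega>)" using t by auto
        from dense[OF w this] obtain r where "r \<in> insert l ({0..l} \<inter> \<rat>)" "k < B (X r \<omega>)" by blast
        then show False using d w by blast
      qed
      ultimately show ?thesis using X_in_D[OF w(1)] t by simp
    qed
    then show "\<omega> \<in> confined" using w by (simp add: confined_def)
  qed
  also have "\<dots> \<in> sets M"
  proof (rule sets.Diff)
    show "{\<omega>\<in>space M. ereal l < T \<omega>} \<in> sets M" using T_adapted[OF l] sets_F_M by blast
    show "(\<Union>r\<in>insert l ({0..l} \<inter> \<rat>). ?P r) \<in> sets M"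
    proof (rule sets.countable_UN'')
      show "countable (insert l ({0..l} \<inter> \<rat>))" by (intro countable_insert countable_subset[OF _ countable_rat]) auto
    qed (use P l in auto)
  qed
  finally show ?thesis .
qed

text \<open>If the level were hit by time \<open>l\<close>, the stopped process would still sit at
  the hitting point at time \<open>l\<close>, where \<open>B\<close> is at least \<open>k\<close>.
  Without a hit, \<open>\<tau> = l\<close> lies in the lifetime.\<close>

lemma confined_if_below:
  assumes w: "\<omega> \<in> regular" and below: "B (Z l \<omega>) < k" shows "\<omega> \<in> confined"
proof -
  have M: "\<omega> \<in> space M" by (rule regular_space[OF w])
  have "hits \<omega> = {}"
  proof (rule ccontr)
    assume "hits \<omega> \<noteq> {}"
    from \<tau>_hit[OF M this] have "k \<le> B (X (\<tau> \<omega>) \<omega>)" by (simp add: hits_def)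
    moreover have "Z l \<omega> = X (\<tau> \<omega>) \<omega>" using w l \<tau>_bounds(2)[OF M] by (simp add: Z_def min_absorb2)
    ultimately show False using below by simp
  qed
  then have T: "ereal l < T \<omega>" using w by (simp add: regular_def \<tau>_def)
  have "ereal t < T \<omega> \<and> X t \<omega> \<in> D \<and> B (X t \<omega>) \<le> k" if t: "t \<in> {0..l}" for t
  proof -
    have tT: "ereal t < T \<omega>" using T_downward[OF T] t by simp
    then have "t \<notin> hits \<omega>" using \<open>hits \<omega> = {}\<close> by simp
    then show ?thesis using t tT X_in_D[OF M _ tT] by (auto simp: hits_def)
  qed
  then show ?thesis using M by (simp add: confined_def)
qed

lemma confined_probability:
  assumes "0 \<le> \<gamma>" "\<And>x. x \<in> D \<Longrightarrow> gradient B x \<bullet> b x + 1/2 * (\<sigma> x \<bullet> (hessian B x ** \<sigma> x)) \<le> \<gamma> * B x"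
    and k: "0 < k"
  shows "1 - exp (\<gamma> * l) * B x0 / k \<le> prob confined"
proof -
  have BZ: "(\<lambda>\<omega>. B (Z l \<omega>)) \<in> borel_measurable M" by (rule comp_Z_measurable[OF C2_on_continuous(1)[OF B]])
  have int: "integrable M (\<lambda>\<omega>. B (Z l \<omega>))"
    using Z_in_K B_nonneg[OF Z_in_D] by (intro integrable_const_bound[where B=k] BZ AE_I2) (auto simp: K_def)
  let ?E = "{\<omega>\<in>space M. k \<le> B (Z l \<omega>)}"
  have E: "?E \<in> sets M" using BZ by measurable
  have "prob ?E \<le> expectation (\<lambda>\<omega>. B (Z l \<omega>)) / k"
    by (rule integral_Markov_inequality_measure[OF int _ _ k, of "{}"]) (use B_nonneg[OF Z_in_D] in auto)
  also have "\<dots> \<le> exp (\<gamma> * l) * B x0 / k"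
    using expectation_bound[OF assms(1,2)] k by (intro divide_right_mono) auto
  finally have "1 - exp (\<gamma> * l) * B x0 / k \<le> 1 - prob ?E" by simp
  also have "\<dots> = prob (space M - ?E)" using prob_compl[OF E] by simp
  also have "\<dots> \<le> prob confined"
  proof (rule finite_measure_mono_AE[OF _ confined_sets])
    show "AE \<omega> in M. \<omega> \<in> space M - ?E \<longrightarrow> \<omega> \<in> confined"
      using regular_AE by eventually_elim (auto intro: confined_if_below)
  qed
  finally show ?thesis .
qed

end

text \<open>The trace in the generator is the entrywise inner product of \<open>\<sigma> x\<close>
  and \<open>hessian y x ** \<sigma> x\<close>, which is the form in which the isometry produces the
  second-order term.\<close>

lemma generator_closed_loop:
  "generator f g \<sigma> (\<phi> x) uo y x
     = gradient y x \<bullet> closed_loop f g uo \<phi> x + 1/2 * (\<sigma> x \<bullet> (hessian y x ** \<sigma> x))"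
proof -
  have "trace (S ** transpose S ** H) = S \<bullet> (H ** S)" for S :: "real^'d^'n" and H :: "real^'n^'n"
  proof -
    have "trace (S ** transpose S ** H) = (\<Sum>i\<in>UNIV. \<Sum>j\<in>UNIV. \<Sum>e\<in>UNIV. S $ i $ e * S $ j $ e * H $ j $ i)"
      by (simp add: trace_def matrix_matrix_mult_def transpose_def sum_distrib_right)
    also have "\<dots> = (\<Sum>j\<in>UNIV. \<Sum>i\<in>UNIV. \<Sum>e\<in>UNIV. S $ i $ e * S $ j $ e * H $ j $ i)"
      by (rule sum.swap)
    also have "\<dots> = (\<Sum>j\<in>UNIV. \<Sum>e\<in>UNIV. \<Sum>i\<in>UNIV. S $ i $ e * S $ j $ e * H $ j $ i)"
      by (intro sum.cong refl sum.swap)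
    also have "\<dots> = S \<bullet> (H ** S)"
      by (simp add: inner_vec_def matrix_matrix_mult_def sum_distrib_left mult_ac)
    finally show ?thesis .
  qed
  then show ?thesis
    by (simp add: generator_def LD_def LI_def lie_vec_def lie_mat_def closed_loop_def dot_lmul_matrix
        inner_add_right matrix_vector_right_distrib add_ac)
qed

theorem theorem2:
  fixes f :: "real^'n \<Rightarrow> real^'n"
    and g :: "real^'n \<Rightarrow> real^'m^'n"
    and \<sigma> :: "real^'n \<Rightarrow> real^'d^'n"
    and uo \<phi> :: "real^'n \<Rightarrow> real^'m"
    and h :: "real^'n \<Rightarrow> real"
    and chi :: "(real^'n) set"
    and M :: "'w measure"
    and F :: "real \<Rightarrow> 'w measure"
    and W :: "real \<Rightarrow> 'w \<Rightarrow> real^'d"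
  assumes "locally_lipschitz f" and "locally_lipschitz g" and "locally_lipschitz \<sigma>"
    and "continuous_on UNIV uo"
    and "filtered_prob_space M F" and "wiener_process M F W"
    and "open chi"
    and Z1: "C2_on chi h"
    and Z2: "\<And>L. L > 0 \<Longrightarrow> compact {x\<in>chi. h x \<ge> L}"
    and Z3: "chi = {x. h x > 0}" "frontier chi = {x. h x = 0}"
    and barrier: "AS_RCBF_with f g \<sigma> uo chi \<phi> (\<lambda>x. 1 / h x)"
  shows "FIiP M F W f g \<sigma> uo \<phi> chi"
proof -
  let ?B = "\<lambda>x. 1 / h x" and ?b = "closed_loop f g uo \<phi>"
  have h_pos: "0 < h x" if "x \<in> chi" for x using that Z3(1) by simp
  have B: "C2_on chi ?B"
    by (rule C2_on_inverse[OF \<open>open chi\<close> Z1]) (use h_pos in force)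
  have proper: "compact {x\<in>chi. ?B x \<le> L}" for L
  proof (cases "L > 0")
    case True
    have "{x\<in>chi. ?B x \<le> L} = {x\<in>chi. h x \<ge> 1 / L}"
      using h_pos True by (auto simp: field_simps)
    then show ?thesis using Z2[of "1 / L"] True by simp
  next
    case False
    have "\<not> ?B x \<le> L" if "x \<in> chi" for x
    proof -
      have "0 < ?B x" using h_pos[OF that] by simp
      then show ?thesis using False by linarith
    qed
    then have "{x\<in>chi. ?B x \<le> L} = {}" by blast
    then show ?thesis by (simp only: compact_empty)
  qed
  obtain \<gamma> where \<phi>: "continuous_on chi \<phi>" and \<gamma>: "\<gamma> > 0" and gen: "\<And>x. x \<in> chi \<Longrightarrow> generator f g \<sigma> (\<phi> x) uo ?B x \<le> \<gamma> * ?B x"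
    using barrier unfolding AS_RCBF_with_def by blast
  have gen': "gradient ?B x \<bullet> ?b x + 1/2 * (\<sigma> x \<bullet> (hessian ?B x ** \<sigma> x)) \<le> \<gamma> * ?B x" if "x \<in> chi" for x
    using gen[OF that] unfolding generator_closed_loop .
  note cont = locally_lipschitz_continuous[THEN continuous_on_subset, OF _ subset_UNIV[of chi]]
  have b: "continuous_on chi ?b"
  proof -
    note c = cont[OF \<open>locally_lipschitz f\<close>] cont[OF \<open>locally_lipschitz g\<close>] \<phi>
      continuous_on_subset[OF \<open>continuous_on UNIV uo\<close> subset_UNIV[of chi]]
    have "continuous_on chi (\<lambda>x. g x *v (uo x + \<phi> x))"
      by (intro continuous_intros continuous_on_matrix_mult c)
    then show ?thesis unfolding closed_loop_def[abs_def] by (intro continuous_on_add c)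
  qed
  \<comment> \<open>The level at which the bound from Markov's inequality equals
    \<open>\<epsilon>\<close>.\<close>
  let ?\<psi> = "\<lambda>x0 l \<epsilon>. exp (\<gamma> * l) * ?B x0 / \<epsilon>"
  show ?thesis
    unfolding FIiP_def
  proof (intro exI[of _ ?B] conjI ballI allI impI B proper)
    show "0 \<le> ?B x" if "x \<in> chi" for x using h_pos[OF that] by simp
    fix x0 assume x0: "x0 \<in> chi"
    then have B0: "0 < ?B x0" using h_pos by simp
    show "\<exists>\<psi>. continuous_on ({0..} \<times> {0<..<1}) (\<lambda>(l, \<epsilon>). \<psi> l \<epsilon>) \<and>
          (\<forall>l\<ge>0. \<forall>\<epsilon>\<in>{0<..<1}. 0 \<le> \<psi> l \<epsilon>) \<and>
          (\<forall>X T. maximal_solution M F W ?b \<sigma> chi x0 X T \<longrightarrow>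
             (\<forall>l\<ge>0. \<forall>\<epsilon>\<in>{0<..<1}.
                measure M {\<omega>\<in>space M. \<forall>t\<in>{0..l}. ereal t < T \<omega> \<and> X t \<omega> \<in> chi \<and> ?B (X t \<omega>) \<le> \<psi> l \<epsilon>}
                  \<ge> 1 - \<epsilon>))"
    proof (intro exI[of _ "?\<psi> x0"] conjI allI impI ballI)
      show "continuous_on ({0..} \<times> {0<..<1}) (\<lambda>(l, \<epsilon>). ?\<psi> x0 l \<epsilon>)"
        unfolding case_prod_unfold by (intro continuous_intros) auto
      show "0 \<le> ?\<psi> x0 l \<epsilon>" if "\<epsilon> \<in> {0<..<1}" for l \<epsilon> using B0 that by simp
      fix X T and l \<epsilon> :: real
      assume max: "maximal_solution M F W ?b \<sigma> chi x0 X T" and l: "0 \<le> l" and \<epsilon>: "\<epsilon> \<in> {0<..<1}"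
      define k where "k = ?\<psi> x0 l \<epsilon>"
      have "1 \<le> exp (\<gamma> * l)" using \<gamma> l by simp
      from mult_right_mono[OF this less_imp_le[OF B0]] have "?B x0 \<le> exp (\<gamma> * l) * ?B x0" by simp
      \<comment> \<open>Here \<open>\<epsilon> < 1\<close> provides the strict start below the level
        that the stopping construction assumes.\<close>
      moreover have "exp (\<gamma> * l) * ?B x0 < k" using \<epsilon> B0 by (simp add: k_def field_simps)
      ultimately have k: "?B x0 < k" by simp
      interpret stopped_solution M F W ?b \<sigma> chi x0 X T ?B k l
      proof unfold_locales
        show "filtered_prob_space M F" "wiener_process M F W" "open chi" by fact+
        show "maximal_solution M F W ?b \<sigma> chi x0 X T" by (rule max)
        show "continuous_on chi ?b" by (rule b)
        show "continuous_on chi \<sigma>" by (rule cont) fact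
        show "C2_on chi ?B" by (rule B)
        show "0 \<le> ?B x" if "x \<in> chi" for x using h_pos[OF that] by simp
        show "compact {x\<in>chi. ?B x \<le> k}" by (rule proper)
        show "x0 \<in> chi" "?B x0 < k" "0 \<le> l" by (rule x0 k l)+
      qed
      have "1 - exp (\<gamma> * l) * ?B x0 / k \<le> measure M confined"
        by (rule confined_probability[OF less_imp_le[OF \<gamma>] gen' less_trans[OF B0 k]])
      moreover have "exp (\<gamma> * l) * ?B x0 / k = \<epsilon>" using B0 \<epsilon> by (simp add: k_def field_simps)
      ultimately have "1 - \<epsilon> \<le> measure M confined" by simp
      then show "1 - \<epsilon> \<le> measure M {\<omega>\<in>space M. \<forall>t\<in>{0..l}. ereal t < T \<omega> \<and> X t \<omega> \<in> chi \<and> ?B (X t \<omega>) \<le> ?\<psi> x0 l \<epsilon>}"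
        unfolding k_def confined_def[unfolded k_def] .
    qed
  qed
qed

end
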